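(* Let $(\Omega,\Sigma)$ be a measurable space whose $\sigma$-algebra is countably generated. Let $\mathscr{T}=(T_t)_{t\in(0,\infty)}$ be a bounded semigroup of positive kernel operators on $B_b(\Omega)$ with associated kernels $k_t$, and let $\mathscr{S}=(S_t)_{t\in(0,\infty)}:=(T_t')_{t\in(0,\infty)}$ denote the dual semigroup on $\mathscr{M}(\Omega)$. Suppose that there exist a measure $0\le\mu\in\mathscr{M}(\Omega)$ and a time $t_0\in(0,\infty)$ such that, for each $x\in\Omega$, the measure $k_{t_0}(x,\cdot)$ is absolutely continuous with respect to $\mu$. Then the following assertions are equivalent: (i) For each $f\in B_b(\Omega)$, $T_tf$ converges with respect to $\sigma(B_b(\Omega),\mathscr{M}(\Omega))$ to a function in $B_b(\Omega)$ as $t\to\infty$. (ii) For each $\nu\in\mathscr{M}(\Omega)$, $S_t\nu$ converges in total variation norm to a measure in $\mathscr{M}(\Omega)$ as $t\to\infty$. (iii) The space $\mathrm{fix}\,\mathscr{S}$ separates $\mathrm{fix}\,\mathscr{T}$.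
   Context: $\mathscr{M}(\Omega)$ is the Banach lattice of finite signed measures on $(\Omega,\Sigma)$ with the total variation norm; $B_b(\Omega)$ is the Banach lattice of bounded real-valued measurable functions with the supremum norm; $\langle\mu,f\rangle=\int_\Omega f\,d\mu$. A bounded kernel on $\Omega$ is a map $k:\Omega\times\Sigma\to\mathbb{R}$ such that $k(\cdot,A)$ is measurable for each $A\in\Sigma$, $k(x,\cdot)$ is a finite signed measure for each $x\in\Omega$, and $\sup_{x}|k|(x,\Omega)<\infty$, where $|k|(x,\cdot)$ is the total variation of $k(x,\cdot)$. An operator $T$ on $B_b(\Omega)$ is a kernel operator with kernel $k$ if $(Tf)(x)=\int_\Omega f(y)\,k(x,dy)$ for all $f,x$; it is positive iff $k\ge 0$. Its dual $T'$ is the operator on $\mathscr{M}(\Omega)$ given by $(T'\mu)(A)=\int_\Omega k(x,A)\,d\mu(x)$; thus $\langle T'\mu,f\rangle=\langle\mu,Tf\rangle$. A semigroup $(T_t)_{t\in(0,\infty)}$ satisfies $T_{t+s}=T_tT_s$ for $s,t>0$ (no regularity in $t$ is assumed) and is bounded if $\sup_{t>0}\|T_t\|<\infty$. $\mathrm{fix}\,\mathscr{T}=\{f\in B_b(\Omega):T_tf=f\ \forall t>0\}$, $\mathrm{fix}\,\mathscr{S}=\{\nu\in\mathscr{M}(\Omega):S_t\nu=\nu\ \forall t>0\}$. "$\mathrm{fix}\,\mathscr{S}$ separates $\mathrm{fix}\,\mathscr{T}$" means: for every nonzero $f\in\mathrm{fix}\,\mathscr{T}$ there is $\nu\in\mathrm{fix}\,\mathscr{S}$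 with $\langle\nu,f\rangle\neq 0$. $\Sigma$ is countably generated if it is the smallest $\sigma$-algebra containing some countable family of sets. *)

theory Defs
  imports "HOL-Analysis.Analysis"
begin

text \<open>
  Throughout, a value \<open>M :: 'a measure\<close> stands for the measurable space
  \<open>(space M, sets M)\<close>; the measure stored in \<open>M\<close> is never used.
  A function on the space is a total function \<open>'a \<Rightarrow> real\<close> whose values outside \<open>space M\<close> are
  irrelevant, and a signed measure is a total function \<open>'a set \<Rightarrow> real\<close> whose values outside
  \<open>sets M\<close> are irrelevant. Accordingly, equality of functions is stated on \<open>space M\<close> and equality
  of signed measures on \<open>sets M\<close>.
\<close>

definition countably_generated :: "'a measure \<Rightarrow> bool" where
  "countably_generated M \<longleftrightarrow>
     (\<exists>C. countable C \<and> C \<subseteq> Pow (space M) \<and> sets M = sigma_sets (space M) C)"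

subsection \<open>Finite signed measures\<close>

definition signed_measures :: "'a measure \<Rightarrow> ('a set \<Rightarrow> real) set" where
  "signed_measures M = {\<nu>. \<forall>A :: nat \<Rightarrow> 'a set.
     range A \<subseteq> sets M \<longrightarrow> disjoint_family A \<longrightarrow> (\<lambda>i. \<nu> (A i)) sums \<nu> (\<Union>i. A i)}"

text \<open>
  The positive part \<open>\<nu>\<^sup>+(A) = sup {\<nu>(B) | B \<subseteq> A}\<close> of the Jordan decomposition, as a measure. Since
  \<open>ennreal\<close> truncates negative reals to 0 and the empty set is admitted for \<open>B\<close>, the truncation does
  not change the supremum. The negative part is the positive part of \<open>-\<nu>\<close>.
\<close>

definition pos_part :: "'a measure \<Rightarrow> ('a set \<Rightarrow> real) \<Rightarrow> 'a measure" where
  "pos_part M \<nu> = measure_of (space M) (sets M)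
     (\<lambda>A. SUP B\<in>{B \<in> sets M. B \<subseteq> A}. ennreal (\<nu> B))"

lemma sets_pos_part [simp]: "sets (pos_part M \<nu>) = sets M"
  by (simp add: pos_part_def sets.space_closed sets.sigma_sets_eq)

lemma space_pos_part [simp]: "space (pos_part M \<nu>) = space M"
  by (simp add: pos_part_def space_measure_of sets.space_closed)

text \<open>The set function in the definition of \<open>pos_part\<close> is indeed countably additive:\<close>

lemma emeasure_pos_part:
  assumes \<nu>: "\<nu> \<in> signed_measures M" and A: "A \<in> sets M"
  shows "emeasure (pos_part M \<nu>) A = (SUP B\<in>{B \<in> sets M. B \<subseteq> A}. ennreal (\<nu> B))"
proof -
  define p where "p A = (SUP B\<in>{B \<in> sets M. B \<subseteq> A}. ennreal (\<nu> B))" for A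
  have sums: "(\<lambda>i. \<nu> (B i)) sums \<nu> (\<Union>i. B i)"
    if "range B \<subseteq> sets M" "disjoint_family B" for B :: "nat \<Rightarrow> 'a set"
    using \<nu> that by (auto simp: signed_measures_def)
  have emp: "\<nu> {} = 0"
    using sums[of "\<lambda>_. {}"] sums_unique2[OF _ sums_zero, of "\<nu> {}"]
      summable_const_iff[of "\<nu> {}"] by (auto simp: disjoint_family_on_def sums_iff)
  have add: "\<nu> (B \<union> C) = \<nu> B + \<nu> C" if "B \<in> sets M" "C \<in> sets M" "B \<inter> C = {}" for B C
  proof -
    have "(\<lambda>i. \<nu> (binaryset B C i)) sums \<nu> (\<Union>i. binaryset B C i)"
    proof (rule sums)
      show "range (binaryset B C) \<subseteq> sets M" using that by (auto simp: binaryset_def)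
      show "disjoint_family (binaryset B C)"
        using that by (auto simp: binaryset_def disjoint_family_on_def)
    qed
    then show ?thesis
      using binaryset_sums[of \<nu> B C] emp sums_unique2 by (fastforce simp: UN_binaryset_eq)
  qed
  have p_upper: "ennreal (\<nu> B) \<le> p A" if "B \<in> sets M" "B \<subseteq> A" for A B
    unfolding p_def by (rule SUP_upper) (use that in auto)
  have p_mono: "p A \<le> p B" if "A \<subseteq> B" for A B
    unfolding p_def by (rule SUP_subset_mono) (use that in auto)
  have p_add: "p A1 + p A2 \<le> p (A1 \<union> A2)" if A12: "A1 \<inter> A2 = {}" for A1 A2
  proof -
    have *: "ennreal (\<nu> B1) + ennreal (\<nu> B2) \<le> p (A1 \<union> A2)"
      if B1: "B1 \<in> sets M" "B1 \<subseteq> A1" and B2: "B2 \<in> sets M" "B2 \<subseteq> A2" for B1 B2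
    proof -
      have 1: "ennreal (\<nu> B1) \<le> p (A1 \<union> A2)" "ennreal (\<nu> B2) \<le> p (A1 \<union> A2)"
        using p_upper B1 B2 by (auto simp: le_supI1 le_supI2)
      have "B1 \<inter> B2 = {}" using A12 B1 B2 by blast
      then have "ennreal (\<nu> B1 + \<nu> B2) \<le> p (A1 \<union> A2)"
        using p_upper[of "B1 \<union> B2" "A1 \<union> A2"] add[OF B1(1) B2(1)] B1 B2 by auto
      with 1 show ?thesis
        by (cases "\<nu> B1 \<ge> 0"; cases "\<nu> B2 \<ge> 0") (auto simp: ennreal_neg ennreal_plus[symmetric] simp del: ennreal_plus)
    qed
    have ne: "{B \<in> sets M. B \<subseteq> A} \<noteq> {}" for A by blast
    have "p A1 + ennreal (\<nu> B2) \<le> p (A1 \<union> A2)" if "B2 \<in> sets M" "B2 \<subseteq> A2" for B2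
    proof -
      have "p A1 + ennreal (\<nu> B2) = (SUP B\<in>{B \<in> sets M. B \<subseteq> A1}. ennreal (\<nu> B) + ennreal (\<nu> B2))"
        unfolding p_def by (subst ennreal_SUP_add_left) (use ne in auto)
      also have "\<dots> \<le> p (A1 \<union> A2)" by (rule SUP_least) (use * that in auto)
      finally show ?thesis .
    qed
    moreover have "p A1 + p A2 = (SUP B\<in>{B \<in> sets M. B \<subseteq> A2}. p A1 + ennreal (\<nu> B))"
      unfolding p_def[of A2] by (subst ennreal_SUP_add_right) (use ne in auto)
    ultimately show ?thesis by (auto intro!: SUP_least)
  qed
  have pos: "positive (sets M) p"
    by (simp add: positive_def p_def emp cong: conj_cong)
  have "countably_additive (sets M) p"
  proof (rule countably_additiveI)
    fix E :: "nat \<Rightarrow> 'a set"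
    assume E: "range E \<subseteq> sets M" "disjoint_family E"
    have "ennreal (\<nu> B) \<le> (\<Sum>i. p (E i))" if B: "B \<in> sets M" "B \<subseteq> (\<Union>i. E i)" for B
    proof -
      have "(\<lambda>i. \<nu> (B \<inter> E i)) sums \<nu> (\<Union>i. B \<inter> E i)"
      proof (rule sums)
        show "range (\<lambda>i. B \<inter> E i) \<subseteq> sets M" using B E(1) by auto
        show "disjoint_family (\<lambda>i. B \<inter> E i)"
          by (rule disjoint_family_subset[OF E(2)]) simp
      qed
      moreover have "(\<Union>i. B \<inter> E i) = B" using B by blast
      ultimately have "(\<lambda>n. ennreal (\<Sum>i<n. \<nu> (B \<inter> E i))) \<longlonglongrightarrow> ennreal (\<nu> B)"
        by (auto simp: sums_def intro: tendsto_ennrealI)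
      moreover have "ennreal (\<Sum>i<n. \<nu> (B \<inter> E i)) \<le> (\<Sum>i. p (E i))" for n
      proof -
        have "ennreal (\<Sum>i<n. \<nu> (B \<inter> E i)) \<le> ennreal (\<Sum>i<n. max 0 (\<nu> (B \<inter> E i)))"
          by (intro ennreal_leI sum_mono) simp
        also have "\<dots> = (\<Sum>i<n. ennreal (max 0 (\<nu> (B \<inter> E i))))"
          by (subst sum_ennreal) auto
        also have "\<dots> \<le> (\<Sum>i<n. p (E i))"
        proof (rule sum_mono)
          fix i
          have "ennreal (\<nu> (B \<inter> E i)) \<le> p (E i)" by (rule p_upper) (use B E in auto)
          then show "ennreal (max 0 (\<nu> (B \<inter> E i))) \<le> p (E i)" by (simp add: max_def)
        qed
        also have "\<dots> \<le> (\<Sum>i. p (E i))" by (rule sum_le_suminf) auto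
        finally show ?thesis .
      qed
      ultimately show ?thesis by (intro LIMSEQ_le_const2) blast+
    qed
    then have le: "p (\<Union>i. E i) \<le> (\<Sum>i. p (E i))"
      unfolding p_def[of "\<Union>i. E i"] by (intro SUP_least) auto
    have fin: "(\<Sum>i<n. p (E i)) \<le> p (\<Union>i<n. E i)" for n
    proof (induction n)
      case (Suc n)
      have "E i \<inter> E n = {}" if "i < n" for i
        using disjoint_family_onD[OF E(2), of i n] that by simp
      then have "(\<Union>i<n. E i) \<inter> E n = {}" by blast
      then have "p (\<Union>i<n. E i) + p (E n) \<le> p ((\<Union>i<n. E i) \<union> E n)" by (rule p_add)
      moreover have "(\<Union>i<n. E i) \<union> E n = (\<Union>i<Suc n. E i)" by (auto simp: less_Suc_eq)
      ultimately show ?case using Suc by (auto intro: order_trans add_right_mono)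
    qed simp
    have "(\<Sum>i. p (E i)) \<le> p (\<Union>i. E i)"
    proof (rule suminf_le_const)
      fix n
      have "p (\<Union>i<n. E i) \<le> p (\<Union>i. E i)" by (rule p_mono) blast
      then show "(\<Sum>i<n. p (E i)) \<le> p (\<Union>i. E i)" using fin[of n] by (rule order_trans[rotated])
    qed simp
    with le show "(\<Sum>i. p (E i)) = p (\<Union>i. E i)" by (rule antisym[rotated])
  qed
  then have "emeasure (measure_of (space M) (sets M) p) A = p A"
    by (rule emeasure_measure_of_sigma[OF sets.sigma_algebra_axioms pos _ A])
  then show ?thesis by (simp add: pos_part_def p_def[abs_def])
qed

definition neg_part :: "'a measure \<Rightarrow> ('a set \<Rightarrow> real) \<Rightarrow> 'a measure" where
  "neg_part M \<nu> = pos_part M (\<lambda>A. - \<nu> A)"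

definition total_variation :: "'a measure \<Rightarrow> ('a set \<Rightarrow> real) \<Rightarrow> 'a set \<Rightarrow> ennreal" where
  "total_variation M \<nu> A = emeasure (pos_part M \<nu>) A + emeasure (neg_part M \<nu>) A"

definition tv_norm :: "'a measure \<Rightarrow> ('a set \<Rightarrow> real) \<Rightarrow> ennreal" where
  "tv_norm M \<nu> = total_variation M \<nu> (space M)"

definition pairing :: "'a measure \<Rightarrow> ('a set \<Rightarrow> real) \<Rightarrow> ('a \<Rightarrow> real) \<Rightarrow> real" where
  "pairing M \<nu> f = (\<integral>x. f x \<partial>pos_part M \<nu>) - (\<integral>x. f x \<partial>neg_part M \<nu>)"

text \<open>Absolute continuity with respect to a measure \<open>\<mu> \<ge> 0\<close>.\<close>

definition abs_cont :: "'a measure \<Rightarrow> ('a set \<Rightarrow> real) \<Rightarrow> ('a set \<Rightarrow> real) \<Rightarrow> bool" where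
  "abs_cont M \<nu> \<mu> \<longleftrightarrow> (\<forall>A\<in>sets M. \<mu> A = 0 \<longrightarrow> \<nu> A = 0)"

subsection \<open>Bounded measurable functions\<close>

definition Bb :: "'a measure \<Rightarrow> ('a \<Rightarrow> real) set" where
  "Bb M = {f \<in> borel_measurable M. bounded (f ` space M)}"

definition sup_norm :: "'a measure \<Rightarrow> ('a \<Rightarrow> real) \<Rightarrow> ennreal" where
  "sup_norm M f = (SUP x\<in>space M. ennreal \<bar>f x\<bar>)"

definition op_norm :: "'a measure \<Rightarrow> (('a \<Rightarrow> real) \<Rightarrow> 'a \<Rightarrow> real) \<Rightarrow> ennreal" where
  "op_norm M T = (SUP f\<in>{f \<in> Bb M. sup_norm M f \<le> 1}. sup_norm M (T f))"

text \<open>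
  The topology \<open>\<sigma>(Bb, signed_measures)\<close>: the initial topology of the maps
  \<open>f \<mapsto> pairing M \<nu> f\<close>, \<open>\<nu>\<close> ranging over the signed measures.
\<close>

definition weak_topology :: "'a measure \<Rightarrow> ('a \<Rightarrow> real) topology" where
  "weak_topology M = pullback_topology (Bb M) (\<lambda>f. \<lambda>\<nu>\<in>signed_measures M. pairing M \<nu> f)
     (product_topology (\<lambda>_. euclideanreal) (signed_measures M))"

lemma limitin_pullback_topology:
  assumes f: "\<And>x. x \<in> A \<Longrightarrow> f x \<in> topspace P"
  shows "limitin (pullback_topology A f P) F g X \<longleftrightarrow>
     g \<in> A \<and> eventually (\<lambda>t. F t \<in> A) X \<and> limitin P (\<lambda>t. f (F t)) (f g) X" (is "?L \<longleftrightarrow> ?R")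
proof
  have top: "topspace (pullback_topology A f P) = A"
    using f by (auto simp: topspace_pullback_topology)
  assume L: ?L
  then have g: "g \<in> A" by (simp add: limitin_def top)
  have nbh: "eventually (\<lambda>t. F t \<in> f -` V \<inter> A) X" if "openin P V" "f g \<in> V" for V
  proof -
    have "openin (pullback_topology A f P) (f -` V \<inter> A)"
      using that(1) by (auto simp: openin_pullback_topology)
    moreover have "g \<in> f -` V \<inter> A" using g that(2) by simp
    ultimately show ?thesis using L unfolding limitin_def by blast
  qed
  have "eventually (\<lambda>t. F t \<in> A) X"
    using nbh[OF openin_topspace f[OF g]] by (rule eventually_mono) simp
  moreover have "eventually (\<lambda>t. f (F t) \<in> V) X" if "openin P V" "f g \<in> V" for V
    using nbh[OF that] by (rule eventually_mono) simp
  ultimately show ?R using g f[OF g] by (simp add: limitin_def)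
next
  have top: "topspace (pullback_topology A f P) = A"
    using f by (auto simp: topspace_pullback_topology)
  assume R: ?R
  have "eventually (\<lambda>t. F t \<in> U) X" if U: "openin (pullback_topology A f P) U" "g \<in> U" for U
  proof -
    obtain V where V: "openin P V" "U = f -` V \<inter> A"
      using U(1) unfolding openin_pullback_topology by blast
    then have "f g \<in> V" using U(2) by simp
    then have "eventually (\<lambda>t. f (F t) \<in> V) X" using R V(1) by (simp add: limitin_def)
    moreover have "eventually (\<lambda>t. F t \<in> A) X" using R by simp
    ultimately show ?thesis unfolding V(2) by eventually_elim simp
  qed
  then show ?L using R by (simp add: limitin_def top)
qed

lemma limitin_weak_topology:
  "limitin (weak_topology M) F g X \<longleftrightarrow>
     g \<in> Bb M \<and> eventually (\<lambda>t. F t \<in> Bb M) X \<and>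
     (\<forall>\<nu>\<in>signed_measures M. ((\<lambda>t. pairing M \<nu> (F t)) \<longlongrightarrow> pairing M \<nu> g) X)"
proof -
  have "limitin (weak_topology M) F g X \<longleftrightarrow>
      g \<in> Bb M \<and> eventually (\<lambda>t. F t \<in> Bb M) X \<and>
      limitin (product_topology (\<lambda>_. euclideanreal) (signed_measures M))
        (\<lambda>t. \<lambda>\<nu>\<in>signed_measures M. pairing M \<nu> (F t))
        (\<lambda>\<nu>\<in>signed_measures M. pairing M \<nu> g) X"
    unfolding weak_topology_def by (rule limitin_pullback_topology) simp
  then show ?thesis
    unfolding limitin_componentwise limitin_canonical_iff by simp
qed

subsection \<open>Kernels and kernel operators\<close>

definition bounded_kernel :: "'a measure \<Rightarrow> ('a \<Rightarrow> 'a set \<Rightarrow> real) \<Rightarrow> bool" where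
  "bounded_kernel M k \<longleftrightarrow>
     (\<forall>A\<in>sets M. (\<lambda>x. k x A) \<in> borel_measurable M) \<and>
     (\<forall>x\<in>space M. k x \<in> signed_measures M) \<and>
     (SUP x\<in>space M. total_variation M (k x) (space M)) < \<infinity>"

definition kernel_operator ::
    "'a measure \<Rightarrow> ('a \<Rightarrow> 'a set \<Rightarrow> real) \<Rightarrow> (('a \<Rightarrow> real) \<Rightarrow> 'a \<Rightarrow> real) \<Rightarrow> bool" where
  "kernel_operator M k T \<longleftrightarrow>
     bounded_kernel M k \<and>
     (\<forall>f\<in>Bb M. T f \<in> Bb M \<and> (\<forall>x\<in>space M. T f x = pairing M (k x) f))"

definition positive_operator :: "'a measure \<Rightarrow> (('a \<Rightarrow> real) \<Rightarrow> 'a \<Rightarrow> real) \<Rightarrow> bool" where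
  "positive_operator M T \<longleftrightarrow>
     (\<forall>f\<in>Bb M. (\<forall>x\<in>space M. 0 \<le> f x) \<longrightarrow> (\<forall>x\<in>space M. 0 \<le> T f x))"

definition dual_operator ::
    "'a measure \<Rightarrow> ('a \<Rightarrow> 'a set \<Rightarrow> real) \<Rightarrow> ('a set \<Rightarrow> real) \<Rightarrow> 'a set \<Rightarrow> real" where
  "dual_operator M k \<nu> A = pairing M \<nu> (\<lambda>x. k x A)"

subsection \<open>Semigroups\<close>

text \<open>Families are indexed by \<^typ>\<open>real\<close>, but only the members with index \<open>t > 0\<close> matter.\<close>

definition operator_semigroup ::
    "'a measure \<Rightarrow> (real \<Rightarrow> ('a \<Rightarrow> real) \<Rightarrow> 'a \<Rightarrow> real) \<Rightarrow> bool" where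
  "operator_semigroup M T \<longleftrightarrow>
     (\<forall>t>0. \<forall>s>0. \<forall>f\<in>Bb M. \<forall>x\<in>space M. T (t + s) f x = T t (T s f) x)"

definition bounded_semigroup ::
    "'a measure \<Rightarrow> (real \<Rightarrow> ('a \<Rightarrow> real) \<Rightarrow> 'a \<Rightarrow> real) \<Rightarrow> bool" where
  "bounded_semigroup M T \<longleftrightarrow>
     operator_semigroup M T \<and> (SUP t\<in>{0<..}. op_norm M (T t)) < \<infinity>"

definition fix_functions ::
    "'a measure \<Rightarrow> (real \<Rightarrow> ('a \<Rightarrow> real) \<Rightarrow> 'a \<Rightarrow> real) \<Rightarrow> ('a \<Rightarrow> real) set" where
  "fix_functions M T = {f \<in> Bb M. \<forall>t>0. \<forall>x\<in>space M. T t f x = f x}"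

definition fix_measures ::
    "'a measure \<Rightarrow> (real \<Rightarrow> ('a set \<Rightarrow> real) \<Rightarrow> 'a set \<Rightarrow> real) \<Rightarrow> ('a set \<Rightarrow> real) set" where
  "fix_measures M S = {\<nu> \<in> signed_measures M. \<forall>t>0. \<forall>A\<in>sets M. S t \<nu> A = \<nu> A}"

definition separates ::
    "'a measure \<Rightarrow> ('a set \<Rightarrow> real) set \<Rightarrow> ('a \<Rightarrow> real) set \<Rightarrow> bool" where
  "separates M N F \<longleftrightarrow>
     (\<forall>f\<in>F. (\<exists>x\<in>space M. f x \<noteq> 0) \<longrightarrow> (\<exists>\<nu>\<in>N. pairing M \<nu> f \<noteq> 0))"

end

theory Submission
  imports Defs "HOL-Complex_Analysis.Great_Picard"
begin

text \<open>
  Everything is reduced to the action of \<open>T t\<close> on bounded functions. A signed measure is a difference of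
  two finite measures (\<open>Jordan_decomposition\<close>), and its total variation norm is comparable to the supremum of its
  absolute values over measurable sets (\<open>tv_norm_le\<close>). Hence (ii) says that, for each finite measure \<open>N\<close>,
  the integrals of \<open>T t (indicator A)\<close> with respect to \<open>N\<close> converge as \<open>t \<rightarrow> \<infinity>\<close> uniformly in \<open>A\<close>. The implication from
  (ii) to (i) follows by testing with Dirac measures. From (i) to (iii), the transition measures
  started at a point where a fixed function does not vanish converge setwise; by Nikodym's theorem
  (\<open>setwise_limit_is_measure\<close>) the limit is a measure, it is fixed, and it does not annihilate the function.

  The substance is the implication from (iii) to (ii). All invariant measures have densities with respect to \<open>\<mu>\<close>,
  so one of them, \<open>N0\<close>, dominates all the others (\<open>maximal_invariant_measure\<close>). Let \<open>C\<close> be its support.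
  The essential limit superior of the orbit of the indicator of the complement of \<open>C\<close> is majorised by a fixed
  function that all invariant measures annihilate (\<open>dominating_fixed_function\<close>); by (iii) this
  function is zero. So each orbit of measures loses its mass outside \<open>C\<close>, and it remains to prove convergence on
  \<open>C\<close> (\<open>Cauchy_if_separated\<close>).

  On \<open>C\<close>, the same lemma applied to the constant 1 yields a fixed function \<open>f \<ge> 0\<close> that asymptotically
  dominates every orbit, and \<open>u \<mapsto> T t (f u) / f\<close> is a Markov semigroup that preserves the measure \<open>f N0\<close>.
  For such a semigroup the heart of the matter is \<open>rigid_fixed\<close>: a function whose \<open>L\<^sup>2\<close> norm never
  decreases along its orbit is fixed. Such a function is measurable with respect to the deterministic
  sets, whose indicators are mapped to indicators. A deterministic set that contains no atom would be covered by arbitrarily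
  small deterministic sets, against the absolute continuity of the kernel at time \<open>t0\<close>. An atom has only boundedly many
  disjoint images of equal measure, so a bounded multiple of every time brings it back to itself; as times can be
  divided by the factorial of that bound, the atom is fixed. So the divisibility of the time parameter is what rules out
  periodic behaviour.

  Finally, the time-\<open>t0\<close> operator is compact in the sense that it maps bounded sequences to sequences with
  pointwise convergent subsequences (\<open>T_compactness\<close>). Compactness provides limit points of orbits,
  which are rigid and hence fixed, so that orbits of functions converge in \<open>L\<^sup>1\<close> (\<open>L1_convergence\<close>,
  \<open>L1_Cauchy\<close>); and it makes this convergence uniform over all indicators
  (\<open>L1_Cauchy_uniform\<close>), which is convergence of measures in total variation.
\<close>

section \<open>Bounded measurable functions and finite measures\<close>

definition finite_measures :: "'a measure \<Rightarrow> 'a measure set" where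
  "finite_measures M = {N. finite_measure N \<and> sets N = sets M}"

lemma finite_measuresI: "finite_measure N \<Longrightarrow> sets N = sets M \<Longrightarrow> N \<in> finite_measures M"
  by (simp add: finite_measures_def)

lemma finite_measuresD:
  assumes "N \<in> finite_measures M"
  shows "finite_measure N" "sets N = sets M" "space N = space M"
  using assms sets_eq_imp_space_eq by (auto simp: finite_measures_def)

lemma BbI:
  assumes "u \<in> borel_measurable M" "\<And>x. x \<in> space M \<Longrightarrow> \<bar>u x\<bar> \<le> c"
  shows "u \<in> Bb M"
  using assms by (auto simp: Bb_def bounded_iff)

lemma Bb_measurable [measurable_dest]: "u \<in> Bb M \<Longrightarrow> u \<in> borel_measurable M"
  by (simp add: Bb_def)

lemma BbE:
  assumes "u \<in> Bb M"
  obtains c where "0 \<le> c" "\<And>x. x \<in> space M \<Longrightarrow> \<bar>u x\<bar> \<le> c"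
proof -
  obtain c where "\<And>x. x \<in> space M \<Longrightarrow> \<bar>u x\<bar> \<le> c"
    using assms by (auto simp: Bb_def bounded_iff)
  then have "\<And>x. x \<in> space M \<Longrightarrow> \<bar>u x\<bar> \<le> max 0 c" by fastforce
  then show ?thesis using that[of "max 0 c"] by simp
qed

lemma Bb_const: "(\<lambda>x. c) \<in> Bb M"
  by (rule BbI[of _ _ "\<bar>c\<bar>"]) auto

lemma Bb_indicator: "A \<in> sets M \<Longrightarrow> (indicator A :: _ \<Rightarrow> real) \<in> Bb M"
  by (rule BbI[of _ _ 1]) (auto simp: indicator_def)

lemma Bb_add:
  assumes "u \<in> Bb M" "v \<in> Bb M"
  shows "(\<lambda>x. u x + v x) \<in> Bb M"
proof -
  obtain c where c: "\<And>x. x \<in> space M \<Longrightarrow> \<bar>u x\<bar> \<le> c" using assms(1) by (rule BbE) blast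
  obtain d where d: "\<And>x. x \<in> space M \<Longrightarrow> \<bar>v x\<bar> \<le> d" using assms(2) by (rule BbE) blast
  show ?thesis
    by (rule BbI[of _ _ "c + d"])
      (use assms[THEN Bb_measurable] c d in \<open>auto intro: order_trans[OF abs_triangle_ineq] add_mono\<close>)
qed

lemma Bb_mult:
  assumes "u \<in> Bb M" "v \<in> Bb M"
  shows "(\<lambda>x. u x * v x) \<in> Bb M"
proof -
  obtain c where c: "0 \<le> c" "\<And>x. x \<in> space M \<Longrightarrow> \<bar>u x\<bar> \<le> c" using assms(1) by (rule BbE) blast
  obtain d where d: "\<And>x. x \<in> space M \<Longrightarrow> \<bar>v x\<bar> \<le> d" using assms(2) by (rule BbE) blast
  show ?thesis
    by (rule BbI[of _ _ "c * d"])
      (use assms[THEN Bb_measurable] c d in \<open>auto simp: abs_mult intro: mult_mono\<close>)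
qed

lemma Bb_minus: "u \<in> Bb M \<Longrightarrow> (\<lambda>x. - u x) \<in> Bb M"
  using Bb_mult[of "\<lambda>_. -1" M u] Bb_const[of "-1" M] by simp

lemma Bb_diff: "u \<in> Bb M \<Longrightarrow> v \<in> Bb M \<Longrightarrow> (\<lambda>x. u x - v x) \<in> Bb M"
  using Bb_add[of u M "\<lambda>x. - v x"] Bb_minus[of v M] by simp

lemma Bb_abs: 
  assumes "u \<in> Bb M"
  shows "(\<lambda>x. \<bar>u x\<bar>) \<in> Bb M"
proof -
  obtain c where c: "0 \<le> c" "\<And>x. x \<in> space M \<Longrightarrow> \<bar>u x\<bar> \<le> c" using assms(1) by (rule BbE) blast
  show ?thesis
    by (rule BbI[of _ _ c]) (use assms[THEN Bb_measurable] c in auto)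
qed

lemma Bb_max:
  assumes "u \<in> Bb M" "v \<in> Bb M"
  shows "(\<lambda>x. max (u x) (v x)) \<in> Bb M"
proof -
  have "(\<lambda>x. (1/2) * (u x + v x + \<bar>u x - v x\<bar>)) \<in> Bb M"
    using assms by (intro Bb_mult Bb_add Bb_abs Bb_diff Bb_const)
  moreover have "(\<lambda>x. (1/2) * (u x + v x + \<bar>u x - v x\<bar>)) = (\<lambda>x. max (u x) (v x))"
    by (auto simp: fun_eq_iff max_def)
  ultimately show ?thesis by simp
qed

lemma Bb_min:
  assumes "u \<in> Bb M" "v \<in> Bb M"
  shows "(\<lambda>x. min (u x) (v x)) \<in> Bb M"
proof -
  have "(\<lambda>x. - max (- u x) (- v x)) \<in> Bb M" using assms by (intro Bb_minus Bb_max)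
  then show ?thesis by (simp add: minus_max_eq_min)
qed

lemma Bb_power2: "u \<in> Bb M \<Longrightarrow> (\<lambda>x. (u x)\<^sup>2) \<in> Bb M"
  using Bb_mult[of u M u] by (simp add: power2_eq_square)

lemmas Bb_intros = Bb_const Bb_indicator Bb_add Bb_mult Bb_minus Bb_diff Bb_abs Bb_max Bb_min Bb_power2

lemma Bb_limit:
  assumes "\<And>n. u n \<in> Bb M" "\<And>n x. x \<in> space M \<Longrightarrow> \<bar>u n x\<bar> \<le> c"
    and "\<And>x. x \<in> space M \<Longrightarrow> (\<lambda>n. u n x) \<longlonglongrightarrow> v x"
  shows "v \<in> Bb M"
proof (rule BbI)
  show "v \<in> borel_measurable M"
    by (rule borel_measurable_LIMSEQ_real[of M u]) (use assms in auto)
  show "\<bar>v x\<bar> \<le> c" if "x \<in> space M" for x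
    using tendsto_rabs[OF assms(3)[OF that]] assms(2)[OF that]
    by (intro LIMSEQ_le_const2[of "\<lambda>n. \<bar>u n x\<bar>"]) auto
qed

lemma Bb_cong: "(\<And>x. x \<in> space M \<Longrightarrow> u x = v x) \<Longrightarrow> u \<in> Bb M \<longleftrightarrow> v \<in> Bb M"
  unfolding Bb_def by (auto simp: cong: measurable_cong image_cong)

lemma Bb_integrable:
  assumes "N \<in> finite_measures M" "u \<in> Bb M"
  shows "integrable N u"
proof -
  obtain c where c: "\<And>x. x \<in> space M \<Longrightarrow> \<bar>u x\<bar> \<le> c" using assms(2) by (rule BbE) blast
  interpret finite_measure N using finite_measuresD[OF assms(1)] by simp
  have "u \<in> borel_measurable N"
    using Bb_measurable[OF assms(2)]
    by (subst measurable_cong_sets[OF finite_measuresD(2)[OF assms(1)] refl])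
  moreover have "AE x in N. norm (u x) \<le> c"
    by (rule AE_I2) (simp add: c finite_measuresD(3)[OF assms(1)])
  ultimately show ?thesis by (intro integrable_const_bound[of _ c])
qed

lemma Bb_dominated_convergence:
  assumes N: "N \<in> finite_measures M" and "\<And>n. u n \<in> Bb M"
    and bd: "\<And>n x. x \<in> space M \<Longrightarrow> \<bar>u n x\<bar> \<le> c"
    and lim: "AE x in N. (\<lambda>n. u n x) \<longlonglongrightarrow> v x" and v: "v \<in> Bb M"
  shows "(\<lambda>n. \<integral>x. u n x \<partial>N) \<longlonglongrightarrow> (\<integral>x. v x \<partial>N)"
proof -
  have 1: "v \<in> borel_measurable N" by (rule borel_measurable_integrable[OF Bb_integrable[OF N v]])
  have 2: "u n \<in> borel_measurable N" for n
    by (rule borel_measurable_integrable[OF Bb_integrable[OF N assms(2)]])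
  have 3: "integrable N (\<lambda>_. c)" by (rule Bb_integrable[OF N Bb_const])
  have 4: "AE x in N. norm (u n x) \<le> c" for n
    by (rule AE_I2) (simp add: bd finite_measuresD(3)[OF N])
  show ?thesis by (rule integral_dominated_convergence[OF 1 2 3 lim 4])
qed

lemma Bb_L1_limit:
  assumes N: "N \<in> finite_measures M" and u: "\<And>n. u n \<in> Bb M"
    and bd: "\<And>n x. x \<in> space M \<Longrightarrow> \<bar>u n x\<bar> \<le> c"
    and lim: "AE x in N. (\<lambda>n. u n x) \<longlonglongrightarrow> v x" and v: "v \<in> Bb M"
  shows "(\<lambda>n. \<integral>x. \<bar>u n x - v x\<bar> \<partial>N) \<longlonglongrightarrow> 0"
proof -
  obtain d where d: "\<And>x. x \<in> space M \<Longrightarrow> \<bar>v x\<bar> \<le> d" using BbE[OF v] by blast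
  have "(\<lambda>n. \<integral>x. \<bar>u n x - v x\<bar> \<partial>N) \<longlonglongrightarrow> (\<integral>x. 0 \<partial>N)"
  proof (rule Bb_dominated_convergence[OF N, where c="c + d"])
    show "(\<lambda>x. \<bar>u n x - v x\<bar>) \<in> Bb M" for n by (intro Bb_intros u v)
    show "\<bar>\<bar>u n x - v x\<bar>\<bar> \<le> c + d" if "x \<in> space M" for n x
      using bd[OF that, of n] d[OF that] by linarith
    show "AE x in N. (\<lambda>n. \<bar>u n x - v x\<bar>) \<longlonglongrightarrow> 0"
      using lim by eventually_elim (intro tendsto_rabs_zero LIM_zero)
  qed (rule Bb_const)
  then show ?thesis by simp
qed

lemma Bb_integral_mono:
  assumes "N \<in> finite_measures M" "u \<in> Bb M" "v \<in> Bb M" "\<And>x. x \<in> space M \<Longrightarrow> u x \<le> v x"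
  shows "(\<integral>x. u x \<partial>N) \<le> (\<integral>x. v x \<partial>N)"
  by (rule integral_mono[OF Bb_integrable[OF assms(1,2)] Bb_integrable[OF assms(1,3)]])
    (simp add: assms(4) finite_measuresD(3)[OF assms(1)])

text \<open>
  A monotone class argument: identities between linear functionals that respect bounded pointwise
  limits need only be checked on indicators.
\<close>

lemma Bb_induct [consumes 1, case_names indicator add scale limit]:
  assumes u: "u \<in> Bb M"
    and ind: "\<And>A. A \<in> sets M \<Longrightarrow> P (indicator A :: _ \<Rightarrow> real)"
    and add: "\<And>u v. u \<in> Bb M \<Longrightarrow> v \<in> Bb M \<Longrightarrow> P u \<Longrightarrow> P v \<Longrightarrow> P (\<lambda>x. u x + v x)"
    and scale: "\<And>u a. u \<in> Bb M \<Longrightarrow> P u \<Longrightarrow> P (\<lambda>x. a * u x)"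
    and lim: "\<And>U u c. (\<And>i. U i \<in> Bb M) \<Longrightarrow> (\<And>i x. x \<in> space M \<Longrightarrow> \<bar>U i x\<bar> \<le> c) \<Longrightarrow>
      (\<And>i::nat. P (U i)) \<Longrightarrow> (\<And>x. x \<in> space M \<Longrightarrow> (\<lambda>i. U i x) \<longlonglongrightarrow> u x) \<Longrightarrow> u \<in> Bb M \<Longrightarrow> P u"
  shows "P u"
proof -
  have pos: "\<forall>c. (\<forall>x\<in>space M. w x \<le> c) \<longrightarrow> P w"
    if "w \<in> borel_measurable M" "\<And>x. 0 \<le> w x" for w
    using that
  proof (induction rule: borel_measurable_induct_real)
    case (set A)
    then show ?case using ind by simp
  next
    case (mult w a)
    show ?case
    proof (intro allI impI)
      fix c assume c: "\<forall>x\<in>space M. a * w x \<le> c"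
      show "P (\<lambda>x. a * w x)"
      proof (cases "a = 0")
        case True
        then show ?thesis using ind[of "{}"] by (simp add: indicator_def[abs_def])
      next
        case False
        then have w: "\<forall>x\<in>space M. w x \<le> c / a" using c mult.hyps(1) by (simp add: field_simps)
        have "w \<in> Bb M" by (rule BbI[of _ _ "c / a"]) (use w mult in auto)
        then show ?thesis using scale w mult.IH by blast
      qed
    qed
  next
    case (add w v)
    show ?case
    proof (intro allI impI)
      fix c assume c: "\<forall>x\<in>space M. v x + w x \<le> c"
      have w: "\<forall>x\<in>space M. w x \<le> c" and v: "\<forall>x\<in>space M. v x \<le> c"
        using c add.hyps(2,4) by (smt (verit))+
      have "w \<in> Bb M" "v \<in> Bb M" by (rule BbI[of _ _ "c"], use w v add.hyps in auto)+
      then show "P (\<lambda>x. v x + w x)" using assms(3) w v add.IH by blast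
    qed
  next
    case (seq U)
    show ?case
    proof (intro allI impI)
      fix c assume c: "\<forall>x\<in>space M. w x \<le> c"
      have U: "U i x \<le> c" if "x \<in> space M" for i x
      proof -
        have "U i x \<le> w x"
          using seq.hyps(3,4) that by (intro incseq_le[of "\<lambda>i. U i x"]) (auto simp: incseq_def le_fun_def)
        then show ?thesis using c that by force
      qed
      show "P w"
      proof (rule lim[of U c])
        show "w \<in> Bb M" by (rule BbI[of _ _ c]) (use c that in auto)
        show "U i \<in> Bb M" for i by (rule BbI[of _ _ c]) (use U seq.hyps in auto)
        show "\<bar>U i x\<bar> \<le> c" if "x \<in> space M" for i x using U[OF that] seq.hyps(2)[of i x] by simp
        show "P (U i)" for i using U seq.IH by blast
      qed (use seq.hyps in auto)
    qed
  qed
  obtain c where c: "0 \<le> c" "\<And>x. x \<in> space M \<Longrightarrow> \<bar>u x\<bar> \<le> c" using u by (rule BbE) blast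
  \<comment> \<open>The negative part of \<open>u\<close> is removed by adding a constant; off the space \<open>u\<close> is reset to 0.\<close>
  define w where "w x = indicator (space M) x * (u x + c)" for x
  have w: "w \<in> Bb M" unfolding w_def by (intro Bb_intros sets.top u)
  have "P w"
  proof -
    have "0 \<le> w x" for x using c(2)[of x] by (auto simp: w_def indicator_def)
    moreover have "\<forall>x\<in>space M. w x \<le> c + c" using c by (force simp: w_def)
    ultimately show ?thesis using pos Bb_measurable[OF w] by blast
  qed
  moreover have "P (\<lambda>x. - c * indicator (space M) x)" by (rule scale[OF Bb_indicator[OF sets.top] ind[OF sets.top]])
  ultimately have "P (\<lambda>x. w x + - c * indicator (space M) x)"
    using add[OF w Bb_mult[OF Bb_const Bb_indicator[OF sets.top]]] by blast
  moreover have "(\<lambda>x. w x + - c * indicator (space M) x) \<in> Bb M"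
    by (rule Bb_add[OF w Bb_mult[OF Bb_const Bb_indicator[OF sets.top]]])
  ultimately show ?thesis
    using lim[of "\<lambda>_ x. w x + - c * indicator (space M) x" c u] u c by (auto simp: w_def)
qed

section \<open>Jordan decomposition\<close>

lemma signed_measures_sums:
  "\<nu> \<in> signed_measures M \<Longrightarrow> range A \<subseteq> sets M \<Longrightarrow> disjoint_family A \<Longrightarrow> (\<lambda>i::nat. \<nu> (A i)) sums \<nu> (\<Union>i. A i)"
  by (auto simp: signed_measures_def)

lemma signed_measures_empty:
  assumes "\<nu> \<in> signed_measures M" shows "\<nu> {} = 0"
proof -
  have "(\<lambda>i::nat. \<nu> {}) sums \<nu> {}"
    using signed_measures_sums[OF assms, of "\<lambda>_. {}"] by (simp add: disjoint_family_on_def)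
  then show ?thesis using summable_const_iff[of "\<nu> {}"] by (simp add: sums_iff)
qed

lemma signed_measures_union:
  assumes "\<nu> \<in> signed_measures M" "B \<in> sets M" "C \<in> sets M" "B \<inter> C = {}"
  shows "\<nu> (B \<union> C) = \<nu> B + \<nu> C"
proof -
  have "(\<lambda>i. \<nu> (binaryset B C i)) sums \<nu> (\<Union>i. binaryset B C i)"
    by (rule signed_measures_sums[OF assms(1)])
      (use assms in \<open>auto simp: binaryset_def disjoint_family_on_def\<close>)
  then show ?thesis
    using binaryset_sums[of \<nu> B C] signed_measures_empty[OF assms(1)] sums_unique2
    by (fastforce simp: UN_binaryset_eq)
qed

lemma signed_measures_Diff:
  assumes "\<nu> \<in> signed_measures M" "B \<in> sets M" "C \<in> sets M" "B \<subseteq> C"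
  shows "\<nu> (C - B) = \<nu> C - \<nu> B"
  using signed_measures_union[OF assms(1,2), of "C - B"] assms Un_absorb1[of B C] by auto

lemma signed_measures_decseq:
  assumes \<nu>: "\<nu> \<in> signed_measures M" and E: "\<And>n. E n \<in> sets M" "decseq E"
  shows "(\<lambda>n. \<nu> (E n)) \<longlonglongrightarrow> \<nu> (\<Inter>n. E n)"
proof -
  have sub: "E (Suc i) \<subseteq> E i" for i using E(2) by (simp add: decseq_Suc_iff)
  have "(\<lambda>i. \<nu> (E i - E (Suc i))) sums \<nu> (\<Union>i. E i - E (Suc i))"
  proof (rule signed_measures_sums[OF \<nu>])
    show "disjoint_family (\<lambda>i. E i - E (Suc i))"
      unfolding disjoint_family_on_def
    proof (intro ballI impI)
      fix m n :: nat assume "m \<noteq> n"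
      then consider "Suc m \<le> n" | "Suc n \<le> m" by linarith
      then show "(E m - E (Suc m)) \<inter> (E n - E (Suc n)) = {}"
        by cases (use E(2) in \<open>auto simp: decseq_def\<close>)
    qed
  qed (use E in auto)
  moreover have "(\<Sum>i<n. \<nu> (E i - E (Suc i))) = \<nu> (E 0) - \<nu> (E n)" for n
    by (induction n) (auto simp: signed_measures_Diff[OF \<nu> E(1) E(1) sub])
  moreover have "(\<Union>i. E i - E (Suc i)) = E 0 - (\<Inter>n. E n)"
  proof (intro equalityI subsetI)
    fix x assume x: "x \<in> E 0 - (\<Inter>n. E n)"
    then obtain n where n: "x \<notin> E n" by blast
    have "\<exists>i. x \<in> E i \<and> x \<notin> E (Suc i)"
      using n x by (induction n) auto
    then show "x \<in> (\<Union>i. E i - E (Suc i))" by blast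
  next
    fix x assume "x \<in> (\<Union>i. E i - E (Suc i))"
    moreover have "E i \<subseteq> E 0" for i using E(2) by (simp add: decseq_def)
    ultimately show "x \<in> E 0 - (\<Inter>n. E n)" by blast
  qed
  moreover have "\<nu> (E 0 - (\<Inter>n. E n)) = \<nu> (E 0) - \<nu> (\<Inter>n. E n)"
    by (rule signed_measures_Diff[OF \<nu>]) (use E in auto)
  ultimately have "(\<lambda>n. \<nu> (E 0) - \<nu> (E n)) \<longlonglongrightarrow> \<nu> (E 0) - \<nu> (\<Inter>n. E n)"
    by (simp add: sums_def)
  from tendsto_diff[OF tendsto_const[of "\<nu> (E 0)"] this] show ?thesis by simp
qed

lemma signed_measures_uminus: "\<nu> \<in> signed_measures M \<Longrightarrow> (\<lambda>A. - \<nu> A) \<in> signed_measures M"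
  by (auto simp: signed_measures_def intro: sums_minus)

lemma signed_measures_diff:
  "\<nu> \<in> signed_measures M \<Longrightarrow> \<rho> \<in> signed_measures M \<Longrightarrow> (\<lambda>A. \<nu> A - \<rho> A) \<in> signed_measures M"
  by (auto simp: signed_measures_def intro: sums_diff)

lemma signed_measures_cong:
  assumes "\<nu> \<in> signed_measures M" "\<And>A. A \<in> sets M \<Longrightarrow> \<nu> A = \<rho> A"
  shows "\<rho> \<in> signed_measures M"
  unfolding signed_measures_def
proof (intro CollectI allI impI)
  fix A :: "nat \<Rightarrow> 'a set" assume A: "range A \<subseteq> sets M" "disjoint_family A"
  then have "\<nu> (A i) = \<rho> (A i)" "\<nu> (\<Union>i. A i) = \<rho> (\<Union>i. A i)" for i
    using assms(2) by auto
  then show "(\<lambda>i. \<rho> (A i)) sums \<rho> (\<Union>i. A i)"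
    using signed_measures_sums[OF assms(1) A] by simp
qed

lemma measure_in_signed_measures:
  assumes "N \<in> finite_measures M" shows "measure N \<in> signed_measures M"
proof -
  interpret finite_measure N using finite_measuresD[OF assms] by simp
  show ?thesis
    unfolding signed_measures_def
    using finite_measure_UNION finite_measuresD[OF assms] by auto
qed

text \<open>
  If the positive part were infinite on the whole space, then each set on which it is infinite would
  split into two pieces on which \<open>\<nu>\<close> is large in absolute value, and one of these pieces would again
  have infinite positive part. Iterating produces a decreasing sequence of sets along which \<open>\<nu>\<close> diverges.
\<close>

lemma pos_part_finite:
  assumes \<nu>: "\<nu> \<in> signed_measures M"
  shows "pos_part M \<nu> \<in> finite_measures M"
proof (rule finite_measuresI)
  let ?p = "emeasure (pos_part M \<nu>)"
  have "?p (space M) \<noteq> \<infinity>"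
  proof
    assume inf: "?p (space M) = \<infinity>"
    have step: "\<exists>B\<in>sets M. B \<subseteq> E \<and> ?p B = \<infinity> \<and> K \<le> \<bar>\<nu> B\<bar>"
      if E: "E \<in> sets M" "?p E = \<infinity>" for E K
    proof -
      have "ennreal (max 0 (K + \<bar>\<nu> E\<bar>)) < (SUP B\<in>{B \<in> sets M. B \<subseteq> E}. ennreal (\<nu> B))"
        using E by (simp add: emeasure_pos_part[OF \<nu>, symmetric])
      then obtain B where B: "B \<in> sets M" "B \<subseteq> E" "ennreal (max 0 (K + \<bar>\<nu> E\<bar>)) < ennreal (\<nu> B)"
        unfolding less_SUP_iff by blast
      then have B': "K + \<bar>\<nu> E\<bar> < \<nu> B" by (simp add: ennreal_less_iff)
      have "\<nu> (E - B) = \<nu> E - \<nu> B" by (rule signed_measures_Diff[OF \<nu>]) (use B E in auto)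
      then have K: "K \<le> \<bar>\<nu> B\<bar>" "K \<le> \<bar>\<nu> (E - B)\<bar>" using B' by linarith+
      have "?p B + ?p (E - B) = ?p E"
        using B E plus_emeasure[of B "pos_part M \<nu>" "E - B"] Un_absorb1[of B E] by simp
      then have "?p B = \<infinity> \<or> ?p (E - B) = \<infinity>" using E by (simp add: ennreal_add_eq_top)
      then show ?thesis using K B E by blast
    qed
    have "\<exists>E. \<forall>n. (E n \<in> sets M \<and> ?p (E n) = \<infinity>) \<and> (E (Suc n) \<subseteq> E n \<and> real n \<le> \<bar>\<nu> (E (Suc n))\<bar>)"
    proof (rule dependent_nat_choice)
      show "\<exists>E. E \<in> sets M \<and> ?p E = \<infinity>" using inf by blast
      show "\<exists>B. (B \<in> sets M \<and> ?p B = \<infinity>) \<and> (B \<subseteq> E \<and> real n \<le> \<bar>\<nu> B\<bar>)"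
        if "E \<in> sets M \<and> ?p E = \<infinity>" for E n
        using step[of E "real n"] that by blast
    qed
    then obtain E where E: "\<And>n. E n \<in> sets M" "\<And>n. E (Suc n) \<subseteq> E n"
      and big: "\<And>n. real n \<le> \<bar>\<nu> (E (Suc n))\<bar>" by blast
    have "(\<lambda>n. \<nu> (E n)) \<longlonglongrightarrow> \<nu> (\<Inter>n. E n)"
      by (rule signed_measures_decseq[OF \<nu>]) (use E in \<open>auto simp: decseq_Suc_iff\<close>)
    then have "Bseq (\<lambda>n. \<nu> (E n))" by (intro convergent_imp_Bseq convergentI)
    then obtain K where "\<And>n. \<bar>\<nu> (E n)\<bar> \<le> K" by (auto simp: Bseq_def)
    then have "real n \<le> K" for n using big[of n] order_trans by blast
    then show False using reals_Archimedean2[of K] by (metis not_le)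
  qed
  then show "finite_measure (pos_part M \<nu>)" by (intro finite_measureI) auto
qed simp

lemma neg_part_finite: "\<nu> \<in> signed_measures M \<Longrightarrow> neg_part M \<nu> \<in> finite_measures M"
  unfolding neg_part_def by (intro pos_part_finite signed_measures_uminus)

lemma pos_part_le:
  assumes \<nu>: "\<nu> \<in> signed_measures M" and A: "A \<in> sets M" and B: "B \<in> sets M" "B \<subseteq> A"
  shows "\<nu> B \<le> measure (pos_part M \<nu>) A"
proof -
  interpret finite_measure "pos_part M \<nu>" using pos_part_finite[OF \<nu>] by (rule finite_measuresD)
  have "ennreal (\<nu> B) \<le> emeasure (pos_part M \<nu>) A"
    unfolding emeasure_pos_part[OF \<nu> A] using B by (intro SUP_upper) auto
  then show ?thesis
    by (simp add: emeasure_eq_measure ennreal_le_iff)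
qed

lemma pos_part_least:
  assumes \<nu>: "\<nu> \<in> signed_measures M" and A: "A \<in> sets M"
    and b: "\<And>B. B \<in> sets M \<Longrightarrow> B \<subseteq> A \<Longrightarrow> \<nu> B \<le> b"
  shows "measure (pos_part M \<nu>) A \<le> b"
proof -
  interpret finite_measure "pos_part M \<nu>" using pos_part_finite[OF \<nu>] by (rule finite_measuresD)
  have "0 \<le> b" using b[of "{}"] signed_measures_empty[OF \<nu>] by simp
  moreover have "emeasure (pos_part M \<nu>) A \<le> ennreal b"
    unfolding emeasure_pos_part[OF \<nu> A] using b by (intro SUP_least) (auto intro: ennreal_leI)
  ultimately show ?thesis by (simp add: emeasure_eq_measure ennreal_le_iff)
qed

text \<open>
  The complement within \<open>A\<close> of a set that nearly realises the positive part of \<open>A\<close> nearly realises the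
  negative part, because both values add up to \<open>\<nu> A\<close>.
\<close>

lemma Jordan_decomposition:
  assumes \<nu>: "\<nu> \<in> signed_measures M" and A: "A \<in> sets M"
  shows "\<nu> A = measure (pos_part M \<nu>) A - measure (neg_part M \<nu>) A"
proof (rule antisym)
  note m = signed_measures_uminus[OF \<nu>]
  have "measure (neg_part M \<nu>) A \<le> measure (pos_part M \<nu>) A - \<nu> A"
    unfolding neg_part_def
  proof (rule pos_part_least[OF m A])
    fix B assume B: "B \<in> sets M" "B \<subseteq> A"
    have "\<nu> (A - B) = \<nu> A - \<nu> B" by (rule signed_measures_Diff[OF \<nu>]) (use A B in auto)
    then show "- \<nu> B \<le> measure (pos_part M \<nu>) A - \<nu> A"
      using pos_part_le[OF \<nu> A, of "A - B"] A B by auto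
  qed
  then show "\<nu> A \<le> measure (pos_part M \<nu>) A - measure (neg_part M \<nu>) A" by simp
  have "measure (pos_part M \<nu>) A \<le> \<nu> A + measure (neg_part M \<nu>) A"
  proof (rule pos_part_least[OF \<nu> A])
    fix B assume B: "B \<in> sets M" "B \<subseteq> A"
    have "\<nu> (A - B) = \<nu> A - \<nu> B" by (rule signed_measures_Diff[OF \<nu>]) (use A B in auto)
    then show "\<nu> B \<le> \<nu> A + measure (neg_part M \<nu>) A"
      using pos_part_le[OF m A, of "A - B"] A B by (auto simp: neg_part_def)
  qed
  then show "measure (pos_part M \<nu>) A - measure (neg_part M \<nu>) A \<le> \<nu> A" by simp
qed

text \<open>
  The pairing can be computed from whichever pair of finite measures is at hand: two such pairs have
  the same difference, so their integrals agree on indicators.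
\<close>

lemma pairing_eq:
  assumes \<nu>: "\<nu> \<in> signed_measures M" and P: "P \<in> finite_measures M" and N: "N \<in> finite_measures M"
    and dec: "\<And>A. A \<in> sets M \<Longrightarrow> \<nu> A = measure P A - measure N A"
    and f: "f \<in> Bb M"
  shows "pairing M \<nu> f = (\<integral>x. f x \<partial>P) - (\<integral>x. f x \<partial>N)"
  using f unfolding pairing_def
proof (induction rule: Bb_induct)
  case (indicator A)
  then show ?case
    using Jordan_decomposition[OF \<nu>] dec
    by (simp add: finite_measuresD[OF P] finite_measuresD[OF N] neg_part_def Int_absorb2 sets.sets_into_space)
next
  case (add u v)
  note i = Bb_integrable[OF pos_part_finite[OF \<nu>]] Bb_integrable[OF neg_part_finite[OF \<nu>]]
    Bb_integrable[OF P] Bb_integrable[OF N]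
  show ?case using add i by simp
next
  case (scale u a)
  then show ?case by (simp add: right_diff_distrib[symmetric])
next
  case (limit U u c)
  have l: "(\<lambda>n. \<integral>x. U n x \<partial>R) \<longlonglongrightarrow> (\<integral>x. u x \<partial>R)" if "R \<in> finite_measures M" for R
    by (rule Bb_dominated_convergence[OF that, where c=c])
      (use limit finite_measuresD[OF that] in \<open>auto intro: AE_I2\<close>)
  show ?case
    by (rule LIMSEQ_unique[OF tendsto_diff[OF l[OF pos_part_finite[OF \<nu>]] l[OF neg_part_finite[OF \<nu>]]]])
      (use limit.IH tendsto_diff[OF l[OF P] l[OF N]] in simp)
qed

text \<open>
  This reduces convergence in total variation to uniform convergence on the measurable sets.
\<close>

lemma tv_norm_le:
  assumes \<nu>: "\<nu> \<in> signed_measures M" and e: "\<And>A. A \<in> sets M \<Longrightarrow> \<bar>\<nu> A\<bar> \<le> e"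
  shows "tv_norm M \<nu> \<le> ennreal (2 * e)"
proof -
  have "emeasure (pos_part M \<nu>) (space M) \<le> ennreal e" "emeasure (neg_part M \<nu>) (space M) \<le> ennreal e"
    unfolding neg_part_def emeasure_pos_part[OF \<nu> sets.top]
      emeasure_pos_part[OF signed_measures_uminus[OF \<nu>] sets.top]
    using e by (force intro!: SUP_least ennreal_leI)+
  moreover have "0 \<le> e" using e[of "{}"] by simp
  ultimately show ?thesis
    unfolding tv_norm_def total_variation_def
    by (metis add_mono ennreal_plus mult_2)
qed

section \<open>Compactness, exhaustion and setwise limits\<close>

text \<open>
  All limit measures and adjoints below are first found as set functions and turned into measures here.
\<close>

lemma finite_measure_exists:
  assumes pos: "\<And>A. A \<in> sets M \<Longrightarrow> 0 \<le> \<nu> A"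
    and add: "\<And>A B. A \<in> sets M \<Longrightarrow> B \<in> sets M \<Longrightarrow> A \<inter> B = {} \<Longrightarrow> \<nu> (A \<union> B) = \<nu> A + \<nu> B"
    and cont: "\<And>A. (\<And>n::nat. A n \<in> sets M) \<Longrightarrow> decseq A \<Longrightarrow> (\<Inter>n. A n) = {} \<Longrightarrow> (\<lambda>n. \<nu> (A n)) \<longlonglongrightarrow> (0::real)"
  shows "\<exists>N\<in>finite_measures M. \<forall>A\<in>sets M. measure N A = \<nu> A"
proof -
  define N where "N = measure_of (space M) (sets M) (\<lambda>A. ennreal (\<nu> A))"
  have emp: "\<nu> {} = 0" using add[of "{}" "{}"] by simp
  have p: "positive (sets M) (\<lambda>A. ennreal (\<nu> A))" by (simp add: positive_def emp)
  have "countably_additive (sets M) (\<lambda>A. ennreal (\<nu> A))"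
  proof (rule sets.empty_continuous_imp_countably_additive[OF p])
    show "additive (sets M) (\<lambda>A. ennreal (\<nu> A))"
      using add pos by (simp add: additive_def)
    show "(\<lambda>i. ennreal (\<nu> (A i))) \<longlonglongrightarrow> 0"
      if "range A \<subseteq> sets M" "decseq A" "(\<Inter>i. A i) = {}" for A
      using tendsto_ennrealI[OF cont[of A]] that by (simp add: range_subsetD)
  qed simp
  then have em: "emeasure N A = ennreal (\<nu> A)" if "A \<in> sets M" for A
    unfolding N_def using that p sets.sigma_algebra_axioms by (intro emeasure_measure_of_sigma)
  have s: "sets N = sets M" "space N = space M"
    by (simp_all add: N_def sets.space_closed sets.sigma_sets_eq space_measure_of)
  have "N \<in> finite_measures M"
    by (intro finite_measuresI finite_measureI) (use s em in auto)
  then show ?thesis using em pos by (intro bexI[of _ N]) (auto simp: measure_def)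
qed

lemma integrable_mult_Bb:
  assumes \<mu>: "\<mu> \<in> finite_measures M" and h: "integrable \<mu> h" and z: "z \<in> Bb M"
  shows "integrable \<mu> (\<lambda>x. h x * z x)"
proof -
  obtain k where k: "0 \<le> k" "\<And>x. x \<in> space M \<Longrightarrow> \<bar>z x\<bar> \<le> k" using BbE[OF z] by blast
  have zm: "z \<in> borel_measurable \<mu>"
    by (rule borel_measurable_integrable[OF Bb_integrable[OF \<mu> z]])
  show ?thesis
  proof (rule Bochner_Integration.integrable_bound[OF integrable_mult_right[OF h, of k]])
    show "(\<lambda>x. h x * z x) \<in> borel_measurable \<mu>"
      using borel_measurable_integrable[OF h] zm by measurable
    show "AE x in \<mu>. norm (h x * z x) \<le> norm (k * h x)"
    proof (rule AE_I2)
      fix x assume "x \<in> space \<mu>"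
      then have "\<bar>z x\<bar> \<le> k" using k(2) finite_measuresD(3)[OF \<mu>] by simp
      then show "norm (h x * z x) \<le> norm (k * h x)"
        using k(1) mult_left_mono[of "\<bar>z x\<bar>" k "\<bar>h x\<bar>"] by (simp add: abs_mult mult.commute)
    qed
  qed
qed

lemma emeasure_finite_measures: "N \<in> finite_measures M \<Longrightarrow> emeasure N A = ennreal (measure N A)"
  using finite_measure.emeasure_eq_measure finite_measuresD(1) by blast

lemma null_iff: "N \<in> finite_measures M \<Longrightarrow> A \<in> sets M \<Longrightarrow> A \<in> null_sets N \<longleftrightarrow> measure N A = 0"
  by (simp add: null_sets_def emeasure_finite_measures finite_measuresD(2))

lemma absolutely_continuous_iff:
  assumes "\<mu> \<in> finite_measures M" "N \<in> finite_measures M"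
  shows "absolutely_continuous \<mu> N \<longleftrightarrow> (\<forall>A\<in>sets M. measure \<mu> A = 0 \<longrightarrow> measure N A = 0)"
proof -
  have "A \<in> sets M" if "A \<in> null_sets \<mu>" for A
    using that finite_measuresD(2)[OF assms(1)] by auto
  then show ?thesis
    unfolding absolutely_continuous_def using null_iff[OF assms(1)] null_iff[OF assms(2)] by blast
qed

lemma real_density:
  assumes "\<mu> \<in> finite_measures M" "N \<in> finite_measures M" "absolutely_continuous \<mu> N"
  obtains D where "D \<in> borel_measurable M" "\<And>x. 0 \<le> D x" "integrable \<mu> D" "density \<mu> D = N"
    "\<And>u. u \<in> Bb M \<Longrightarrow> (\<integral>x. u x \<partial>N) = (\<integral>x. D x * u x \<partial>\<mu>)"
proof -
  note sm = finite_measuresD[OF assms(1)] finite_measuresD[OF assms(2)]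
  interpret m: finite_measure \<mu> by (rule sm)
  obtain D where D: "D \<in> borel_measurable \<mu>" "AE x in \<mu>. RN_deriv \<mu> N x = ennreal (D x)" "\<And>x. 0 \<le> D x"
    using m.real_RN_deriv[OF sm(4) assms(3)] sm by metis
  have "density \<mu> D = density \<mu> (RN_deriv \<mu> N)"
    by (rule density_cong) (use D in auto)
  also have "\<dots> = N" using m.density_RN_deriv assms(3) sm by simp
  finally have dens: "density \<mu> D = N" .
  have "integrable N (\<lambda>_. 1 :: real)" by (rule Bb_integrable[OF assms(2) Bb_const])
  then have int: "integrable \<mu> D"
    using integrable_real_density[of D \<mu> "\<lambda>_. 1"] D unfolding dens by simp
  have Dm: "D \<in> borel_measurable M"
    using D(1) by (simp add: measurable_cong_sets[OF sm(2) refl])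
  have "(\<integral>x. u x \<partial>N) = (\<integral>x. D x * u x \<partial>\<mu>)" if "u \<in> Bb M" for u
  proof -
    have "u \<in> borel_measurable \<mu>" by (rule borel_measurable_integrable[OF Bb_integrable[OF assms(1) that]])
    then show ?thesis
      unfolding dens[symmetric] using D by (intro integral_real_density) auto
  qed
  then show ?thesis using that[OF Dm D(3) int dens] by blast
qed

text \<open>
  The density exceeds \<open>c\<close> only on a null set, since \<open>N - c \<mu>\<close> would be positive there; truncating it
  at \<open>c\<close> gives a version that is bounded everywhere.
\<close>

lemma bounded_Radon_Nikodym:
  assumes \<mu>: "\<mu> \<in> finite_measures M" and N: "N \<in> finite_measures M" and c: "0 \<le> c"
    and le: "\<And>A. A \<in> sets M \<Longrightarrow> measure N A \<le> c * measure \<mu> A"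
  shows "\<exists>v\<in>Bb M. (\<forall>x. 0 \<le> v x \<and> v x \<le> c) \<and> (\<forall>A\<in>sets M. measure N A = (\<integral>x. indicator A x * v x \<partial>\<mu>))"
proof -
  note sm = finite_measuresD[OF \<mu>] finite_measuresD[OF N]
  have "absolutely_continuous \<mu> N"
    unfolding absolutely_continuous_iff[OF \<mu> N] using le by (fastforce simp: measure_le_0_iff)
  then obtain D where Dm: "D \<in> borel_measurable M" and Dpos: "\<And>x. 0 \<le> D x" and int: "integrable \<mu> D"
    and DN: "\<And>u. u \<in> Bb M \<Longrightarrow> (\<integral>x. u x \<partial>N) = (\<integral>x. D x * u x \<partial>\<mu>)"
    by (rule real_density[OF \<mu> N]) blast
  note D = borel_measurable_integrable[OF int]
  have eq: "measure N A = (\<integral>x. indicator A x * D x \<partial>\<mu>)" if "A \<in> sets M" for A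
    using DN[OF Bb_indicator[OF that]] that sm sets.sets_into_space[OF that] by (simp add: mult.commute Int_absorb2)
  define A where "A = {x \<in> space \<mu>. c < D x}"
  have A: "A \<in> sets M" unfolding sm(2)[symmetric] A_def using D by measurable
  have int1: "integrable \<mu> (\<lambda>x. D x * indicator A x)" and int2: "integrable \<mu> (\<lambda>x. c * indicator A x)"
    by (rule integrable_mult_Bb[OF \<mu> int Bb_indicator[OF A]], rule integrable_mult_Bb[OF \<mu> Bb_integrable[OF \<mu> Bb_const] Bb_indicator[OF A]])
  have decomp: "indicator A x * (D x - c) = D x * indicator A x - c * indicator A x" for x
    by (simp add: algebra_simps)
  have intA: "integrable \<mu> (\<lambda>x. indicator A x * (D x - c))"
    unfolding decomp using int1 int2 by (rule Bochner_Integration.integrable_diff)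
  have "(\<integral>x. indicator A x * (D x - c) \<partial>\<mu>) = measure N A - c * measure \<mu> A"
    unfolding decomp Bochner_Integration.integral_diff[OF int1 int2]
    using eq[OF A] A sm by (simp add: mult.commute)
  then have "(\<integral>x. indicator A x * (D x - c) \<partial>\<mu>) \<le> 0" using le[OF A] by simp
  moreover have nn: "0 \<le> indicator A x * (D x - c)" for x by (auto simp: A_def indicator_def)
  ultimately have "(\<integral>x. indicator A x * (D x - c) \<partial>\<mu>) = 0"
    by (intro antisym integral_nonneg_AE) auto
  then have "AE x in \<mu>. indicator A x * (D x - c) = 0"
    using integral_nonneg_eq_0_iff_AE[OF intA] nn by auto
  then have ae: "AE x in \<mu>. min (D x) c = D x"
    by (rule AE_mp) (auto simp: A_def indicator_def intro!: AE_I2)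
  show ?thesis
  proof (intro bexI[of _ "\<lambda>x. min (D x) c"] conjI allI ballI)
    show "(\<lambda>x. min (D x) c) \<in> Bb M"
      by (rule BbI[of _ _ c]) (use Dm Dpos c in auto)
    fix B assume B: "B \<in> sets M"
    have "(\<integral>x. indicator B x * D x \<partial>\<mu>) = (\<integral>x. indicator B x * min (D x) c \<partial>\<mu>)"
      by (rule integral_cong_AE) (use D B sm ae in auto)
    then show "measure N B = (\<integral>x. indicator B x * min (D x) c \<partial>\<mu>)" using eq[OF B] by simp
  qed (use Dpos c in auto)
qed

lemma tendsto_approx:
  fixes a :: "nat \<Rightarrow> real"
  assumes "\<And>e. 0 < e \<Longrightarrow> \<exists>b l'. b \<longlonglongrightarrow> l' \<and> (\<forall>n. \<bar>a n - b n\<bar> \<le> e) \<and> \<bar>l - l'\<bar> \<le> e"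
  shows "a \<longlonglongrightarrow> l"
proof (rule LIMSEQ_I)
  fix e :: real assume "0 < e"
  then obtain b l' where b: "b \<longlonglongrightarrow> l'" "\<And>n. \<bar>a n - b n\<bar> \<le> e/4" "\<bar>l - l'\<bar> \<le> e/4"
    using assms[of "e/4"] by auto
  obtain n0 where n0: "\<And>n. n0 \<le> n \<Longrightarrow> \<bar>b n - l'\<bar> < e/4"
    using LIMSEQ_D[OF b(1), of "e/4"] \<open>0 < e\<close> by auto
  have "norm (a n - l) < e" if "n0 \<le> n" for n
    using b(2)[of n] b(3) n0[OF that] \<open>0 < e\<close> unfolding real_norm_def abs_le_iff abs_less_iff by linarith
  then show "\<exists>no. \<forall>n\<ge>no. norm (a n - l) < e" by blast
qed

lemma convergent_approx:
  fixes a :: "nat \<Rightarrow> real"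
  assumes "\<And>e. 0 < e \<Longrightarrow> \<exists>b. convergent b \<and> (\<forall>n. \<bar>a n - b n\<bar> \<le> e)"
  shows "convergent a"
proof -
  have "Cauchy a"
  proof (rule CauchyI)
    fix e :: real assume e: "0 < e"
    then obtain b where b: "convergent b" "\<And>n. \<bar>a n - b n\<bar> \<le> e/4"
      using assms[of "e/4"] by auto
    obtain n0 where n0: "\<And>m n. n0 \<le> m \<Longrightarrow> n0 \<le> n \<Longrightarrow> \<bar>b m - b n\<bar> < e/4"
      using CauchyD[OF convergent_Cauchy[OF b(1)], of "e/4"] e by auto
    have "norm (a m - a n) < e" if "n0 \<le> m" "n0 \<le> n" for m n
      using b(2)[of n] b(2)[of m] n0[OF that] e unfolding real_norm_def abs_le_iff abs_less_iff by linarith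
    then show "\<exists>no. \<forall>m\<ge>no. \<forall>n\<ge>no. norm (a m - a n) < e" by blast
  qed
  then show ?thesis by (simp add: Cauchy_convergent_iff)
qed

text \<open>
  Sequential weak-star compactness of balls in \<open>L\<^sup>\<infinity>(\<mu>)\<close>. A diagonal subsequence makes the integrals
  converge over a countable generating \<open>\<pi>\<close>-system; the sets over which they converge form a Dynkin
  system because the boundedness of the \<open>u n\<close> makes tails uniformly small. The limit set function
  is dominated by \<open>\<mu>\<close>, so it has a bounded density.
\<close>

lemma weak_star_compactness:
  assumes cg: "countably_generated M" and \<mu>: "\<mu> \<in> finite_measures M"
    and u: "\<And>n. u n \<in> Bb M" and bd: "\<And>n x. x \<in> space M \<Longrightarrow> \<bar>u n x\<bar> \<le> c"
  obtains r v where "strict_mono (r :: nat \<Rightarrow> nat)" "v \<in> Bb M" "\<And>x. x \<in> space M \<Longrightarrow> \<bar>v x\<bar> \<le> c"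
    "\<And>h. integrable \<mu> h \<Longrightarrow> (\<lambda>n. \<integral>x. h x * u (r n) x \<partial>\<mu>) \<longlonglongrightarrow> (\<integral>x. h x * v x \<partial>\<mu>)"
proof (cases "space M = {}")
  case True
  then have "(\<integral>x. f x \<partial>\<mu>) = (0::real)" for f
    using Bochner_Integration.integral_cong[OF refl, of \<mu> f "\<lambda>_. 0"] finite_measuresD(3)[OF \<mu>] by simp
  then show ?thesis using that[of id "\<lambda>_. 0"] True Bb_const by (auto simp: strict_mono_def)
next
  case False
  then have c: "0 \<le> c" using bd by fastforce
  note sm = finite_measuresD[OF \<mu>]
  interpret m: finite_measure \<mu> by (rule sm)
  obtain C where C: "countable C" "C \<subseteq> Pow (space M)" "sets M = sigma_sets (space M) C"
    using cg by (auto simp: countably_generated_def)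
  define G where "G = (\<lambda>F. space M \<inter> \<Inter>F) ` {F. finite F \<and> F \<subseteq> C}"
  have Gc: "countable G" unfolding G_def using C(1) by (intro countable_image countable_Collect_finite_subset)
  have GP: "G \<subseteq> Pow (space M)" by (auto simp: G_def)
  have Gi: "Int_stable G"
  proof (rule Int_stableI)
    fix A B assume "A \<in> G" "B \<in> G"
    then obtain F H where "finite F" "F \<subseteq> C" "A = space M \<inter> \<Inter>F" "finite H" "H \<subseteq> C" "B = space M \<inter> \<Inter>H"
      by (auto simp: G_def)
    then show "A \<inter> B \<in> G" unfolding G_def by (intro image_eqI[of _ _ "F \<union> H"]) auto
  qed
  have Gs: "sigma_sets (space M) G = sets M"
  proof
    have "space M \<inter> \<Inter>F \<in> sets M" if "finite F" "F \<subseteq> C" for F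
      using that
    proof (induction F)
      case (insert A F)
      have "A \<in> sets M" using insert C by auto
      then have "A \<inter> (space M \<inter> \<Inter>F) \<in> sets M" using insert by auto
      then show ?case by (simp add: Int_left_commute)
    qed simp
    then have "G \<subseteq> sets M" by (auto simp: G_def)
    then show "sigma_sets (space M) G \<subseteq> sets M" by (rule sets.sigma_sets_subset)
    have "A \<in> G" if "A \<in> C" for A
      unfolding G_def using that C by (intro image_eqI[of _ _ "{A}"]) auto
    then show "sets M \<subseteq> sigma_sets (space M) G" unfolding C(3) by (intro sigma_sets_mono') auto
  qed
  have spG: "space M \<in> G" unfolding G_def by (intro image_eqI[of _ _ "{}"]) auto
  define a where "a n A = (\<integral>x. indicator A x * u n x \<partial>\<mu>)" for n A
  have ii: "integrable \<mu> (\<lambda>x. indicator A x * u n x)" if "A \<in> sets M" for A n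
    using that u by (intro Bb_integrable[OF \<mu>] Bb_mult Bb_indicator)
  have abd: "\<bar>a n A\<bar> \<le> c * measure \<mu> A" if "A \<in> sets M" for n A
  proof -
    have "\<bar>a n A\<bar> \<le> (\<integral>x. \<bar>indicator A x * u n x\<bar> \<partial>\<mu>)"
      unfolding a_def by (rule integral_abs_bound)
    also have "\<dots> \<le> (\<integral>x. c * indicator A x \<partial>\<mu>)"
    proof (rule Bb_integral_mono[OF \<mu>])
      show "(\<lambda>x. \<bar>indicator A x * u n x\<bar>) \<in> Bb M"
        by (intro Bb_abs Bb_mult Bb_indicator that u)
      show "(\<lambda>x. c * indicator A x) \<in> Bb M"
        by (intro Bb_mult Bb_indicator Bb_const that)
    qed (use bd in \<open>auto simp: indicator_def\<close>)
    also have "\<dots> = c * measure \<mu> A" using that sm by simp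
    finally show ?thesis .
  qed
  have aU: "a n (A \<union> B) = a n A + a n B" if "A \<in> sets M" "B \<in> sets M" "A \<inter> B = {}" for n A B
  proof -
    have "indicator (A \<union> B) x = indicator A x + (indicator B x :: real)" for x
      using that by (auto simp: indicator_def)
    then have "a n (A \<union> B) = (\<integral>x. indicator A x * u n x + indicator B x * u n x \<partial>\<mu>)"
      by (simp add: a_def distrib_right)
    then show ?thesis using ii[OF that(1)] ii[OF that(2)] by (simp add: a_def)
  qed
  have GM: "G \<subseteq> sets M" using Gs by auto
  obtain r where r: "strict_mono (r :: nat \<Rightarrow> nat)" and rG: "\<And>A. A \<in> G \<Longrightarrow> \<exists>l. (\<lambda>n. a (r n) A) \<longlonglongrightarrow> l"
  proof (rule function_convergent_subsequence[OF Gc, of a "c * measure \<mu> (space \<mu>)"])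
    show "norm (a n A) \<le> c * measure \<mu> (space \<mu>)" if "A \<in> G" for n A
    proof -
      have "c * measure \<mu> A \<le> c * measure \<mu> (space \<mu>)"
        by (intro mult_left_mono c m.bounded_measure)
      then show ?thesis using abd[of A n] that GM by auto
    qed
  qed blast
  have conv: "convergent (\<lambda>n. a (r n) A)" if "A \<in> sets M" for A
    using that unfolding Gs[symmetric]
  proof (induction rule: sigma_sets_induct_disjoint[OF Gi GP, consumes 1, case_names basic empty compl union])
    case (basic A)
    then show ?case using rG by (auto simp: convergent_def)
  next
    case empty
    then show ?case by (simp add: a_def convergent_const)
  next
    case (compl A)
    have A: "A \<in> sets M" using compl Gs by simp
    have "a n (space M - A) = a n (space M) - a n A" for n
    proof -
      have "A \<union> (space M - A) = space M" using A sets.sets_into_space by blast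
      then show ?thesis using aU[of A "space M - A" n] A by auto
    qed
    moreover have "convergent (\<lambda>n. a (r n) (space M))" using rG[OF spG] by (auto simp: convergent_def)
    ultimately show ?case using compl.IH by (simp add: convergent_diff)
  next
    case (union A)
    have A: "\<And>i. A i \<in> sets M" using union.hyps(2) unfolding Gs by blast
    have fin: "a n (\<Union>i<k. A i) = (\<Sum>i<k. a n (A i))" for n k
    proof (induction k)
      case (Suc k)
      have "A i \<inter> A k = {}" if "i < k" for i
        using disjoint_family_onD[OF union.hyps(1), of i k] that by simp
      then have "(\<Union>i<k. A i) \<inter> A k = {}" by blast
      then have "a n ((\<Union>i<k. A i) \<union> A k) = a n (\<Union>i<k. A i) + a n (A k)"
        using A by (intro aU) auto
      moreover have "(\<Union>i<k. A i) \<union> A k = (\<Union>i<Suc k. A i)" by (auto simp: less_Suc_eq)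
      ultimately show ?case using Suc by simp
    qed (simp add: a_def)
    define R where "R k = (\<Union>i. A i) - (\<Union>i<k. A i)" for k
    have R: "R k \<in> sets M" for k using A by (auto simp: R_def)
    have "(\<lambda>k. measure \<mu> (R k)) \<longlonglongrightarrow> measure \<mu> (\<Inter>k. R k)"
    proof (rule m.finite_Lim_measure_decseq)
      show "range R \<subseteq> sets \<mu>" using R sm by auto
      show "decseq R" by (auto simp: decseq_def R_def)
    qed
    moreover have "(\<Inter>k. R k) = {}" by (auto simp: R_def)
    ultimately have "(\<lambda>k. c * measure \<mu> (R k)) \<longlonglongrightarrow> c * 0" by (intro tendsto_mult_left) simp
    then have Rk: "(\<lambda>k. c * measure \<mu> (R k)) \<longlonglongrightarrow> 0" by simp
    show ?case
    proof (rule convergent_approx)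
      fix e :: real assume "0 < e"
      then obtain k where k: "c * measure \<mu> (R k) < e"
        using order_tendstoD(2)[OF Rk] by (auto simp: eventually_sequentially)
      have "\<bar>a n (\<Union>i. A i) - (\<Sum>i<k. a n (A i))\<bar> \<le> e" for n
      proof -
        have "a n ((\<Union>i<k. A i) \<union> R k) = a n (\<Union>i<k. A i) + a n (R k)"
          using A R by (intro aU) (auto simp: R_def)
        moreover have "(\<Union>i<k. A i) \<union> R k = (\<Union>i. A i)" by (auto simp: R_def)
        ultimately show ?thesis using fin abd[OF R, of n k] k by simp
      qed
      moreover have "convergent (\<lambda>n. \<Sum>i<k. a (r n) (A i))"
        using union.IH by (intro convergent_sum) auto
      ultimately show "\<exists>b. convergent b \<and> (\<forall>n. \<bar>a (r n) (\<Union>i. A i) - b n\<bar> \<le> e)" by blast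
    qed
  qed
  \<comment> \<open>Shifting by \<open>c\<close> turns the limit of the integrals into a positive set function below \<open>2 c \<mu>\<close>.\<close>
  define \<nu> where "\<nu> A = lim (\<lambda>n. a (r n) A) + c * measure \<mu> A" for A
  have al: "(\<lambda>n. a (r n) A) \<longlonglongrightarrow> lim (\<lambda>n. a (r n) A)" if "A \<in> sets M" for A
    using conv[OF that] by (simp add: convergent_LIMSEQ_iff)
  have lb: "\<bar>lim (\<lambda>n. a (r n) A)\<bar> \<le> c * measure \<mu> A" if "A \<in> sets M" for A
    using tendsto_rabs[OF al[OF that]] abd[OF that] by (intro LIMSEQ_le_const2) auto
  have \<nu>b: "0 \<le> \<nu> A \<and> \<nu> A \<le> 2 * c * measure \<mu> A" if "A \<in> sets M" for A
    using lb[OF that] unfolding \<nu>_def abs_le_iff by linarith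
  have "\<exists>N\<in>finite_measures M. \<forall>A\<in>sets M. measure N A = \<nu> A"
  proof (rule finite_measure_exists)
    show "0 \<le> \<nu> A" if "A \<in> sets M" for A using \<nu>b that by blast
    show "\<nu> (A \<union> B) = \<nu> A + \<nu> B" if "A \<in> sets M" "B \<in> sets M" "A \<inter> B = {}" for A B
    proof -
      have "lim (\<lambda>n. a (r n) (A \<union> B)) = lim (\<lambda>n. a (r n) A) + lim (\<lambda>n. a (r n) B)"
        by (rule limI) (use tendsto_add[OF al[OF that(1)] al[OF that(2)]] aU[OF that] in simp)
      moreover have "measure \<mu> (A \<union> B) = measure \<mu> A + measure \<mu> B"
        using that sm by (intro m.finite_measure_Union) auto
      ultimately show ?thesis by (simp add: \<nu>_def distrib_left)
    qed
    fix A :: "nat \<Rightarrow> 'a set" assume A: "\<And>n. A n \<in> sets M" "decseq A" "(\<Inter>n. A n) = {}"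
    have "(\<lambda>k. measure \<mu> (A k)) \<longlonglongrightarrow> measure \<mu> (\<Inter>k. A k)"
      by (rule m.finite_Lim_measure_decseq) (use A(1,2) sm in auto)
    then have "(\<lambda>k. 2 * c * measure \<mu> (A k)) \<longlonglongrightarrow> 2 * c * 0" using A(3) by (intro tendsto_mult_left) simp
    then show "(\<lambda>n. \<nu> (A n)) \<longlonglongrightarrow> 0"
      by (intro tendsto_sandwich[of "\<lambda>_. 0" "\<lambda>n. \<nu> (A n)" sequentially "\<lambda>k. 2 * c * measure \<mu> (A k)"])
        (use \<nu>b A(1) in auto)
  qed
  then obtain N where N: "N \<in> finite_measures M" "\<And>A. A \<in> sets M \<Longrightarrow> measure N A = \<nu> A" by blast
  then obtain w where w: "w \<in> Bb M" "\<And>x. 0 \<le> w x \<and> w x \<le> 2 * c"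
      "\<And>A. A \<in> sets M \<Longrightarrow> \<nu> A = (\<integral>x. indicator A x * w x \<partial>\<mu>)"
    using bounded_Radon_Nikodym[OF \<mu> N(1), of "2 * c"] c \<nu>b by auto
  define v where "v x = w x - c" for x
  have v: "v \<in> Bb M" unfolding v_def using w by (intro Bb_intros)
  have vb: "\<bar>v x\<bar> \<le> c" for x using w(2)[of x] by (auto simp: v_def abs_le_iff)
  have lim: "(\<lambda>n. \<integral>x. h x * u (r n) x \<partial>\<mu>) \<longlonglongrightarrow> (\<integral>x. h x * v x \<partial>\<mu>)" if "integrable \<mu> h" for h
    using that
  proof (induction rule: integrable_induct)
    case (base A d)
    have A: "A \<in> sets M" using base sm by simp
    have "(\<integral>x. indicator A x * v x \<partial>\<mu>) = \<nu> A - c * measure \<mu> A"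
    proof -
      have "(\<integral>x. indicator A x * v x \<partial>\<mu>) = (\<integral>x. indicator A x * w x - c * indicator A x \<partial>\<mu>)"
        by (simp add: v_def algebra_simps)
      also have "\<dots> = (\<integral>x. indicator A x * w x \<partial>\<mu>) - (\<integral>x. c * indicator A x \<partial>\<mu>)"
        using A w(1) by (intro Bochner_Integration.integral_diff Bb_integrable[OF \<mu>] Bb_mult Bb_indicator Bb_const)
      finally show ?thesis using w(3)[OF A] A sm by simp
    qed
    then have "(\<lambda>n. a (r n) A) \<longlonglongrightarrow> (\<integral>x. indicator A x * v x \<partial>\<mu>)"
      using al[OF A] by (simp add: \<nu>_def)
    then have "(\<lambda>n. d * a (r n) A) \<longlonglongrightarrow> d * (\<integral>x. indicator A x * v x \<partial>\<mu>)"
      by (rule tendsto_mult_left)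
    moreover have "d * (\<integral>x. indicator A x * f x \<partial>\<mu>) = (\<integral>x. indicator A x *\<^sub>R d * f x \<partial>\<mu>)" for f
      unfolding integral_mult_right_zero[symmetric] by (intro Bochner_Integration.integral_cong) auto
    ultimately show ?case by (simp add: a_def)
  next
    case (add f g)
    note i = integrable_mult_Bb[OF \<mu>]
    show ?case
      using tendsto_add[OF add.IH] i[OF add.hyps(1) v] i[OF add.hyps(2) v] i[OF add.hyps(1) u] i[OF add.hyps(2) u]
      by (simp add: distrib_right)
  next
    case (lim f s)
    have "(\<lambda>i. \<integral>x. \<bar>f x - s i x\<bar> \<partial>\<mu>) \<longlonglongrightarrow> (\<integral>x. 0 \<partial>\<mu>)"
    proof (rule integral_dominated_convergence[where w="\<lambda>x. 3 * \<bar>f x\<bar>"])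
      show "AE x in \<mu>. (\<lambda>i. \<bar>f x - s i x\<bar>) \<longlonglongrightarrow> 0"
      proof (intro AE_I2 tendsto_rabs_zero)
        fix x assume "x \<in> space \<mu>"
        from tendsto_diff[OF tendsto_const[of "f x"] lim.hyps(2)[OF this]]
        show "(\<lambda>i. f x - s i x) \<longlonglongrightarrow> 0" by simp
      qed
      show "AE x in \<mu>. norm \<bar>f x - s i x\<bar> \<le> 3 * \<bar>f x\<bar>" for i
      proof (rule AE_I2)
        fix x assume "x \<in> space \<mu>"
        from lim.hyps(3)[OF this, of i] show "norm \<bar>f x - s i x\<bar> \<le> 3 * \<bar>f x\<bar>"
          by simp
      qed
    qed (use lim.hyps in auto)
    then have L: "(\<lambda>i. c * (\<integral>x. \<bar>f x - s i x\<bar> \<partial>\<mu>)) \<longlonglongrightarrow> 0"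
      using tendsto_mult_left[of _ 0 sequentially c] by simp
    have diff: "\<bar>(\<integral>x. f x * z x \<partial>\<mu>) - (\<integral>x. s i x * z x \<partial>\<mu>)\<bar> \<le> c * (\<integral>x. \<bar>f x - s i x\<bar> \<partial>\<mu>)"
      if z: "z \<in> Bb M" "\<And>x. x \<in> space M \<Longrightarrow> \<bar>z x\<bar> \<le> c" for i z
    proof -
      note j = integrable_mult_Bb[OF \<mu> _ z(1)]
      have "\<bar>(\<integral>x. f x * z x \<partial>\<mu>) - (\<integral>x. s i x * z x \<partial>\<mu>)\<bar> = \<bar>\<integral>x. (f x - s i x) * z x \<partial>\<mu>\<bar>"
        using j lim.hyps by (simp add: left_diff_distrib)
      also have "\<dots> \<le> (\<integral>x. \<bar>(f x - s i x) * z x\<bar> \<partial>\<mu>)" by (rule integral_abs_bound)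
      also have "\<dots> \<le> (\<integral>x. c * \<bar>f x - s i x\<bar> \<partial>\<mu>)"
      proof (rule integral_mono)
        show "integrable \<mu> (\<lambda>x. \<bar>(f x - s i x) * z x\<bar>)"
          using lim.hyps by (intro integrable_abs j) auto
        show "integrable \<mu> (\<lambda>x. c * \<bar>f x - s i x\<bar>)" using lim.hyps by auto
        show "\<bar>(f x - s i x) * z x\<bar> \<le> c * \<bar>f x - s i x\<bar>" if "x \<in> space \<mu>" for x
          using z(2)[of x] that sm by (simp add: abs_mult mult.commute mult_right_mono)
      qed
      finally show ?thesis by simp
    qed
    show ?case
    proof (rule tendsto_approx)
      fix e :: real assume "0 < e"
      then obtain i where i: "c * (\<integral>x. \<bar>f x - s i x\<bar> \<partial>\<mu>) < e"
        using order_tendstoD(2)[OF L] by (auto simp: eventually_sequentially)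
      show "\<exists>b l'. b \<longlonglongrightarrow> l' \<and> (\<forall>n. \<bar>(\<integral>x. f x * u (r n) x \<partial>\<mu>) - b n\<bar> \<le> e) \<and> \<bar>(\<integral>x. f x * v x \<partial>\<mu>) - l'\<bar> \<le> e"
      proof (intro exI conjI allI)
        show "(\<lambda>n. \<integral>x. s i x * u (r n) x \<partial>\<mu>) \<longlonglongrightarrow> (\<integral>x. s i x * v x \<partial>\<mu>)" by (rule lim.IH)
        show "\<bar>(\<integral>x. f x * u (r n) x \<partial>\<mu>) - (\<integral>x. s i x * u (r n) x \<partial>\<mu>)\<bar> \<le> e" for n
          using diff[OF u bd, of "r n" i] i by linarith
        show "\<bar>(\<integral>x. f x * v x \<partial>\<mu>) - (\<integral>x. s i x * v x \<partial>\<mu>)\<bar> \<le> e"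
          using diff[OF v vb, of i] i by linarith
      qed
    qed
  qed
  show ?thesis using that[OF r v vb lim] by blast
qed

text \<open>
  A countable union of members whose measure is as large as possible cannot be enlarged by a further
  member.
\<close>

lemma countable_exhaustion:
  assumes \<mu>: "\<mu> \<in> finite_measures M" and G: "\<And>i. i \<in> I \<Longrightarrow> G i \<in> sets M"
  obtains J where "countable J" "J \<subseteq> I" "\<And>i. i \<in> I \<Longrightarrow> measure \<mu> (G i - (\<Union>j\<in>J. G j)) = 0"
proof -
  note sm = finite_measuresD[OF \<mu>]
  interpret m: finite_measure \<mu> by (rule sm)
  define V where "V = {measure \<mu> (\<Union>j\<in>J. G j) | J. countable J \<and> J \<subseteq> I}"
  have bdd: "bdd_above V" unfolding V_def by (auto intro!: bdd_aboveI m.bounded_measure)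
  have ne: "V \<noteq> {}" unfolding V_def by blast
  have "\<exists>J. countable J \<and> J \<subseteq> I \<and> Sup V - 1 / real (Suc n) < measure \<mu> (\<Union>j\<in>J. G j)" for n :: nat
  proof -
    have "Sup V - 1 / real (Suc n) < Sup V" by simp
    then obtain y where "y \<in> V" "Sup V - 1 / real (Suc n) < y" using less_cSupD[OF ne] by blast
    then show ?thesis unfolding V_def by blast
  qed
  then obtain F where F: "\<And>n. countable (F n)" "\<And>n. F n \<subseteq> I"
      "\<And>n::nat. Sup V - 1 / real (Suc n) < measure \<mu> (\<Union>j\<in>F n. G j)"
    by metis
  define J where "J = (\<Union>n. F n)"
  have J: "countable J" "J \<subseteq> I" using F by (auto simp: J_def)
  have meas: "(\<Union>j\<in>K. G j) \<in> sets \<mu>" if "countable K" "K \<subseteq> I" for K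
    using that G sm by (intro sets.countable_UN'') auto
  have "Sup V \<le> measure \<mu> (\<Union>j\<in>J. G j)"
  proof (rule field_le_epsilon)
    fix e :: real assume "0 < e"
    then obtain n :: nat where n: "1 / real (Suc n) < e" using nat_approx_posE by blast
    have "measure \<mu> (\<Union>j\<in>F n. G j) \<le> measure \<mu> (\<Union>j\<in>J. G j)"
      using meas[OF J] by (intro m.finite_measure_mono) (auto simp: J_def)
    then show "Sup V \<le> measure \<mu> (\<Union>j\<in>J. G j) + e" using F(3)[of n] n by linarith
  qed
  moreover have "measure \<mu> (G i - (\<Union>j\<in>J. G j)) + measure \<mu> (\<Union>j\<in>J. G j) \<le> Sup V" if "i \<in> I" for i
  proof -
    have "measure \<mu> ((G i - (\<Union>j\<in>J. G j)) \<union> (\<Union>j\<in>J. G j))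
        = measure \<mu> (G i - (\<Union>j\<in>J. G j)) + measure \<mu> (\<Union>j\<in>J. G j)"
      using meas[OF J] G[OF that] sm by (intro m.finite_measure_Union) auto
    moreover have "(G i - (\<Union>j\<in>J. G j)) \<union> (\<Union>j\<in>J. G j) = (\<Union>j\<in>insert i J. G j)" by blast
    moreover have "measure \<mu> (\<Union>j\<in>insert i J. G j) \<le> Sup V"
      by (rule cSup_upper[OF _ bdd]) (use J that in \<open>auto simp: V_def intro!: exI[of _ "insert i J"]\<close>)
    ultimately show ?thesis by simp
  qed
  ultimately have "measure \<mu> (G i - (\<Union>j\<in>J. G j)) = 0" if "i \<in> I" for i
    using that measure_nonneg[of \<mu> "G i - (\<Union>j\<in>J. G j)"] by (smt (verit))
  then show ?thesis using that J by blast
qed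

text \<open>
  Nikodym's theorem that a setwise limit of finite measures is a measure, by a gliding hump. If the
  limit \<open>\<rho>\<close> decreases to \<open>\<epsilon> > 0\<close> along sets \<open>A j\<close> that shrink to the empty set, then blocks
  \<open>A (j i) - A (j (i + 1))\<close> carry almost the mass \<open>\<epsilon>\<close> of a suitable member of the sequence, which puts little
  mass elsewhere. The union of every other block then has masses that oscillate.
\<close>

lemma setwise_limit_vanishes:
  assumes \<nu>: "\<And>n::nat. \<nu> n \<in> finite_measures M"
    and lim: "\<And>A. A \<in> sets M \<Longrightarrow> (\<lambda>n. measure (\<nu> n) A) \<longlonglongrightarrow> \<rho> A"
    and A: "\<And>j::nat. A j \<in> sets M" "decseq A" "(\<Inter>j. A j) = {}"
  shows "(\<lambda>j. \<rho> (A j)) \<longlonglongrightarrow> 0"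
proof -
  note sm = finite_measuresD[OF \<nu>]
  have fin: "finite_measure (\<nu> n)" for n by (rule sm)
  have pos: "0 \<le> \<rho> B" if "B \<in> sets M" for B
    using lim[OF that] by (rule LIMSEQ_le_const) auto
  have mono: "\<rho> (A j) \<le> \<rho> (A i)" if "i \<le> j" for i j
  proof (rule LIMSEQ_le[OF lim[OF A(1)] lim[OF A(1)]])
    show "\<exists>N. \<forall>n\<ge>N. measure (\<nu> n) (A j) \<le> measure (\<nu> n) (A i)"
      using that A(1,2) sm(2) by (intro exI[of _ 0] allI impI finite_measure.finite_measure_mono[OF fin]) (auto simp: decseq_def)
  qed
  have "decseq (\<lambda>j. \<rho> (A j))" using mono by (auto simp: decseq_def)
  then obtain \<epsilon> where \<epsilon>: "(\<lambda>j. \<rho> (A j)) \<longlonglongrightarrow> \<epsilon>" "\<And>j. \<epsilon> \<le> \<rho> (A j)"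
    using decseq_convergent[of "\<lambda>j. \<rho> (A j)" 0] pos A(1) by blast
  have "\<epsilon> \<ge> 0" using \<epsilon>(1) pos A(1) by (intro LIMSEQ_le_const[OF \<epsilon>(1)]) auto
  moreover have False if e: "\<epsilon> > 0"
  proof -
    obtain J where J: "\<And>j. J \<le> j \<Longrightarrow> \<rho> (A j) < \<epsilon> + \<epsilon> / 8"
      using order_tendstoD(2)[OF \<epsilon>(1), of "\<epsilon> + \<epsilon>/8"] e by (auto simp: eventually_sequentially)
    have diff: "measure (\<nu> n) (A J - A j) = measure (\<nu> n) (A J) - measure (\<nu> n) (A j)" if "J \<le> j" for n j
      using that A(1,2) sm(2) by (intro finite_measure.finite_measure_Diff[OF fin]) (auto simp: decseq_def)
    \<comment> \<open>With these constants the union \<open>D\<close> of the even blocks has mass at least \<open>3 \<epsilon> / 4\<close> along even indices and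
      at most \<open>3 \<epsilon> / 8\<close> along odd ones.\<close>
    have step: "\<exists>n j'. i \<le> n \<and> j < j' \<and> \<epsilon> - \<epsilon>/8 < measure (\<nu> n) (A j) \<and>
        measure (\<nu> n) (A J - A j) < \<epsilon>/4 \<and> measure (\<nu> n) (A j') < \<epsilon>/8" if j: "J \<le> j" for i j :: nat
    proof -
      have "(\<lambda>n. measure (\<nu> n) (A J - A j)) \<longlonglongrightarrow> \<rho> (A J) - \<rho> (A j)"
        unfolding diff[OF j] by (intro tendsto_diff lim A)
      moreover have "\<rho> (A J) - \<rho> (A j) < \<epsilon>/4" using J[of J] \<epsilon>(2)[of j] e by simp
      ultimately have "eventually (\<lambda>n. measure (\<nu> n) (A J - A j) < \<epsilon>/4) sequentially"
        by (rule order_tendstoD)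
      moreover have "eventually (\<lambda>n. \<epsilon> - \<epsilon>/8 < measure (\<nu> n) (A j)) sequentially"
        by (rule order_tendstoD[OF lim[OF A(1)]]) (use \<epsilon>(2)[of j] e in simp)
      moreover have "eventually (\<lambda>n. i \<le> n) sequentially" by (rule eventually_ge_at_top)
      ultimately have "eventually (\<lambda>n. i \<le> n \<and> \<epsilon> - \<epsilon>/8 < measure (\<nu> n) (A j) \<and>
          measure (\<nu> n) (A J - A j) < \<epsilon>/4) sequentially" by eventually_elim simp
      from eventually_happens'[OF sequentially_bot this]
      obtain n where n: "i \<le> n" "\<epsilon> - \<epsilon>/8 < measure (\<nu> n) (A j)" "measure (\<nu> n) (A J - A j) < \<epsilon>/4"
        by blast
      have "(\<lambda>j. measure (\<nu> n) (A j)) \<longlonglongrightarrow> measure (\<nu> n) (\<Inter>j. A j)"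
        by (rule finite_measure.finite_Lim_measure_decseq[OF fin]) (use A(1,2) sm(2) in auto)
      then have "(\<lambda>j. measure (\<nu> n) (A j)) \<longlonglongrightarrow> 0" using A(3) by simp
      then have "eventually (\<lambda>j. measure (\<nu> n) (A j) < \<epsilon>/8) sequentially"
        by (rule order_tendstoD) (use e in simp)
      moreover have "eventually (\<lambda>j'. j < j') sequentially" by (rule eventually_gt_at_top)
      ultimately have "eventually (\<lambda>j'. j < j' \<and> measure (\<nu> n) (A j') < \<epsilon>/8) sequentially"
        by eventually_elim simp
      from eventually_happens'[OF sequentially_bot this]
      obtain j' where "j < j'" "measure (\<nu> n) (A j') < \<epsilon>/8" by blast
      then show ?thesis using n by blast
    qed
    have "\<exists>j. \<forall>i. J \<le> j i \<and> (j i < j (Suc i) \<and> (\<exists>n\<ge>i. \<epsilon> - \<epsilon>/8 < measure (\<nu> n) (A (j i)) \<and>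
        measure (\<nu> n) (A J - A (j i)) < \<epsilon>/4 \<and> measure (\<nu> n) (A (j (Suc i))) < \<epsilon>/8))"
    proof (rule dependent_nat_choice)
      show "\<exists>j'. J \<le> j' \<and> (j < j' \<and> (\<exists>n\<ge>i. \<epsilon> - \<epsilon>/8 < measure (\<nu> n) (A j) \<and>
        measure (\<nu> n) (A J - A j) < \<epsilon>/4 \<and> measure (\<nu> n) (A j') < \<epsilon>/8))" if "J \<le> j" for j i
        using step[OF that, of i] that by (meson less_imp_le order_trans)
    qed blast
    then obtain j where j: "\<And>i. J \<le> j i" "\<And>i. j i < j (Suc i)"
      and ex: "\<forall>i. \<exists>n. i \<le> n \<and> \<epsilon> - \<epsilon>/8 < measure (\<nu> n) (A (j i)) \<and>
        measure (\<nu> n) (A J - A (j i)) < \<epsilon>/4 \<and> measure (\<nu> n) (A (j (Suc i))) < \<epsilon>/8"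
      by blast
    from choice[OF ex] obtain n where nn: "\<forall>i. i \<le> n i \<and> \<epsilon> - \<epsilon>/8 < measure (\<nu> (n i)) (A (j i)) \<and>
        measure (\<nu> (n i)) (A J - A (j i)) < \<epsilon>/4 \<and> measure (\<nu> (n i)) (A (j (Suc i))) < \<epsilon>/8" ..
    note n = spec[OF nn, THEN conjunct1] spec[OF nn, THEN conjunct2, THEN conjunct1]
      spec[OF nn, THEN conjunct2, THEN conjunct2, THEN conjunct1] spec[OF nn, THEN conjunct2, THEN conjunct2, THEN conjunct2]
    have jmono: "j a \<le> j b" if "a \<le> b" for a b
      by (rule lift_Suc_mono_le[of j, OF less_imp_le[OF j(2)] that])
    have Aj: "A (j b) \<subseteq> A (j a)" if "a \<le> b" for a b
      using A(2) jmono[OF that] by (simp add: decseq_def)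
    define D where "D = (\<Union>i\<in>{i. even i}. A (j i) - A (j (Suc i)))"
    have D: "D \<in> sets M" unfolding D_def by (intro sets.countable_UN'') (use A(1) in auto)
    have even: "\<epsilon> * 3/4 \<le> measure (\<nu> (n i)) D" if "even i" for i
    proof -
      have "measure (\<nu> (n i)) (A (j i) - A (j (Suc i))) = measure (\<nu> (n i)) (A (j i)) - measure (\<nu> (n i)) (A (j (Suc i)))"
        using Aj[of i "Suc i"] A(1) sm(2) by (intro finite_measure.finite_measure_Diff[OF fin]) auto
      moreover have "measure (\<nu> (n i)) (A (j i) - A (j (Suc i))) \<le> measure (\<nu> (n i)) D"
        using that D sm(2) by (intro finite_measure.finite_measure_mono[OF fin]) (auto simp: D_def)
      ultimately show ?thesis using n(2)[of i] n(4)[of i] by simp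
    qed
    have odd: "measure (\<nu> (n i)) D \<le> \<epsilon> * 3/8" if "odd i" for i
    proof -
      have "D \<subseteq> (A J - A (j i)) \<union> A (j (Suc i))"
      proof
        fix x assume "x \<in> D"
        then obtain l where l: "even l" "x \<in> A (j l)" "x \<notin> A (j (Suc l))" by (auto simp: D_def)
        have "x \<in> A J" using l(2) A(2) j(1)[of l] by (auto simp: decseq_def)
        have "l \<noteq> i" using l(1) \<open>odd i\<close> by blast
        then consider "Suc l \<le> i" | "Suc i \<le> l" by linarith
        then show "x \<in> (A J - A (j i)) \<union> A (j (Suc i))"
        proof cases
          case 1
          then show ?thesis using Aj[OF 1] l(3) \<open>x \<in> A J\<close> by blast
        next
          case 2
          then show ?thesis using Aj[OF 2] l(2) by blast
        qed
      qed
      then have "measure (\<nu> (n i)) D \<le> measure (\<nu> (n i)) ((A J - A (j i)) \<union> A (j (Suc i)))"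
        using A(1) sm(2) by (intro finite_measure.finite_measure_mono[OF fin]) auto
      also have "\<dots> \<le> measure (\<nu> (n i)) (A J - A (j i)) + measure (\<nu> (n i)) (A (j (Suc i)))"
        using A(1) sm(2) by (intro measure_Un_le) auto
      finally show ?thesis using n(3,4)[of i] by simp
    qed
    have ninf: "filterlim (\<lambda>i. n (f i)) sequentially sequentially" if "\<And>i. i \<le> f i" for f :: "nat \<Rightarrow> nat"
      unfolding filterlim_at_top
    proof
      fix Z
      show "\<forall>\<^sub>F i in sequentially. Z \<le> n (f i)"
        using eventually_ge_at_top[of Z]
      proof eventually_elim
        case (elim i)
        then show ?case using that[of i] n(1)[of "f i"] by linarith
      qed
    qed
    have "(\<lambda>i. measure (\<nu> (n (2 * i))) D) \<longlonglongrightarrow> \<rho> D"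
      by (rule filterlim_compose[OF lim[OF D] ninf]) simp
    then have "\<epsilon> * 3/4 \<le> \<rho> D" by (rule LIMSEQ_le_const) (use even in auto)
    moreover have "(\<lambda>i. measure (\<nu> (n (2 * i + 1))) D) \<longlonglongrightarrow> \<rho> D"
      by (rule filterlim_compose[OF lim[OF D] ninf]) simp
    then have "\<rho> D \<le> \<epsilon> * 3/8" by (rule LIMSEQ_le_const2) (use odd in auto)
    ultimately show False using e by simp
  qed
  ultimately have "\<epsilon> = 0" by force
  then show ?thesis using \<epsilon>(1) by simp
qed

lemma setwise_limit_is_measure:
  assumes \<nu>: "\<And>n::nat. \<nu> n \<in> finite_measures M"
    and lim: "\<And>A. A \<in> sets M \<Longrightarrow> (\<lambda>n. measure (\<nu> n) A) \<longlonglongrightarrow> \<rho> A"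
  shows "\<exists>N\<in>finite_measures M. \<forall>A\<in>sets M. measure N A = \<rho> A"
proof (rule finite_measure_exists)
  note sm = finite_measuresD[OF \<nu>]
  show "0 \<le> \<rho> B" if "B \<in> sets M" for B
    using lim[OF that] by (rule LIMSEQ_le_const) auto
  show "\<rho> (A \<union> B) = \<rho> A + \<rho> B" if "A \<in> sets M" "B \<in> sets M" "A \<inter> B = {}" for A B
  proof (rule LIMSEQ_unique[OF lim])
    have "measure (\<nu> n) (A \<union> B) = measure (\<nu> n) A + measure (\<nu> n) B" for n
      using that sm by (intro finite_measure.finite_measure_Union) auto
    then show "(\<lambda>n. measure (\<nu> n) (A \<union> B)) \<longlonglongrightarrow> \<rho> A + \<rho> B"
      using tendsto_add[OF lim[OF that(1)] lim[OF that(2)]] by simp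
  qed (use that in auto)
  show "(\<lambda>n. \<rho> (A n)) \<longlonglongrightarrow> 0" if "\<And>n. A n \<in> sets M" "decseq A" "(\<Inter>n. A n) = {}" for A :: "nat \<Rightarrow> _"
    using setwise_limit_vanishes[OF \<nu> lim that] .
qed

section \<open>Rigidity of Markov semigroups\<close>

text \<open>
  The operators act on genuine functions rather than on classes modulo null sets, and they may lose mass on a null set
  (\<open>P_one_le\<close>); \<open>P_inv\<close> implies that they preserve constants almost everywhere.
\<close>

locale markov_semigroup =
  fixes \<pi> :: "'a measure" and P :: "real \<Rightarrow> ('a \<Rightarrow> real) \<Rightarrow> 'a \<Rightarrow> real"
  assumes finite_pi: "finite_measure \<pi>"
    and P_Bb: "0 < t \<Longrightarrow> u \<in> Bb \<pi> \<Longrightarrow> P t u \<in> Bb \<pi>"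
    and P_lin: "0 < t \<Longrightarrow> u \<in> Bb \<pi> \<Longrightarrow> v \<in> Bb \<pi> \<Longrightarrow> x \<in> space \<pi> \<Longrightarrow>
      P t (\<lambda>y. a * u y + b * v y) x = a * P t u x + b * P t v x"
    and P_pos: "0 < t \<Longrightarrow> u \<in> Bb \<pi> \<Longrightarrow> (\<And>y. y \<in> space \<pi> \<Longrightarrow> 0 \<le> u y) \<Longrightarrow> x \<in> space \<pi> \<Longrightarrow> 0 \<le> P t u x"
    and P_one_le: "0 < t \<Longrightarrow> x \<in> space \<pi> \<Longrightarrow> P t (\<lambda>_. 1) x \<le> 1"
    and P_inv: "0 < t \<Longrightarrow> u \<in> Bb \<pi> \<Longrightarrow> (\<integral>x. P t u x \<partial>\<pi>) = (\<integral>x. u x \<partial>\<pi>)"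
    and P_semigroup: "0 < t \<Longrightarrow> 0 < s \<Longrightarrow> u \<in> Bb \<pi> \<Longrightarrow> x \<in> space \<pi> \<Longrightarrow> P (t + s) u x = P t (P s u) x"
begin

lemma fm: "\<pi> \<in> finite_measures \<pi>"
  using finite_pi by (simp add: finite_measures_def)

sublocale finite_measure \<pi> by (rule finite_pi)

lemmas integrable_pi = Bb_integrable[OF fm]

lemma P_add: "0 < t \<Longrightarrow> u \<in> Bb \<pi> \<Longrightarrow> v \<in> Bb \<pi> \<Longrightarrow> x \<in> space \<pi> \<Longrightarrow> P t (\<lambda>y. u y + v y) x = P t u x + P t v x"
  using P_lin[of t u v x 1 1] by simp

lemma P_diff: "0 < t \<Longrightarrow> u \<in> Bb \<pi> \<Longrightarrow> v \<in> Bb \<pi> \<Longrightarrow> x \<in> space \<pi> \<Longrightarrow> P t (\<lambda>y. u y - v y) x = P t u x - P t v x"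
  using P_lin[of t u v x 1 "-1"] by simp

lemma P_scale: "0 < t \<Longrightarrow> u \<in> Bb \<pi> \<Longrightarrow> x \<in> space \<pi> \<Longrightarrow> P t (\<lambda>y. a * u y) x = a * P t u x"
  using P_lin[of t u u x a 0] by simp

lemma P_mono:
  assumes "0 < t" "u \<in> Bb \<pi>" "v \<in> Bb \<pi>" "\<And>y. y \<in> space \<pi> \<Longrightarrow> u y \<le> v y" "x \<in> space \<pi>"
  shows "P t u x \<le> P t v x"
  using P_pos[OF assms(1) Bb_diff[OF assms(3,2)], of x] P_diff[OF assms(1,3,2,5)] assms(4,5) by simp

lemma P_cong:
  assumes "0 < t" "u \<in> Bb \<pi>" "\<And>y. y \<in> space \<pi> \<Longrightarrow> u y = v y" "x \<in> space \<pi>"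
  shows "P t u x = P t v x"
proof -
  have v: "v \<in> Bb \<pi>" using assms(2) Bb_cong[of \<pi> u v] assms(3) by blast
  show ?thesis
    by (rule antisym; rule P_mono[OF assms(1)]) (use assms v in auto)
qed

lemma P_abs: 
  assumes "0 < t" "u \<in> Bb \<pi>" "x \<in> space \<pi>" shows "\<bar>P t u x\<bar> \<le> P t (\<lambda>y. \<bar>u y\<bar>) x"
proof -
  have "P t u x \<le> P t (\<lambda>y. \<bar>u y\<bar>) x"
    by (rule P_mono) (use assms in \<open>auto intro: Bb_abs\<close>)
  moreover have "P t (\<lambda>y. (-1) * u y) x \<le> P t (\<lambda>y. \<bar>u y\<bar>) x"
    by (rule P_mono[OF assms(1) Bb_mult[OF Bb_const assms(2)] Bb_abs[OF assms(2)] _ assms(3)]) auto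
  ultimately show ?thesis using P_scale[OF assms, of "-1"] by simp
qed

lemma P_bounded:
  assumes "0 < t" "u \<in> Bb \<pi>" "\<And>y. y \<in> space \<pi> \<Longrightarrow> \<bar>u y\<bar> \<le> c" "x \<in> space \<pi>"
  shows "\<bar>P t u x\<bar> \<le> c"
proof -
  have "0 \<le> c" using assms(3,4) by fastforce
  have "\<bar>P t u x\<bar> \<le> P t (\<lambda>y. \<bar>u y\<bar>) x" by (rule P_abs[OF assms(1,2,4)])
  also have "\<dots> \<le> P t (\<lambda>y. c * 1) x"
    by (rule P_mono[OF assms(1) Bb_abs[OF assms(2)] Bb_const _ assms(4)]) (use assms(3) in simp)
  also have "\<dots> = c * P t (\<lambda>_. 1) x" by (rule P_scale[OF assms(1) Bb_const assms(4)])
  also have "\<dots> \<le> c" using mult_left_mono[OF P_one_le[OF assms(1,4)] \<open>0 \<le> c\<close>] by simp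
  finally show ?thesis .
qed

lemma AE_zero_if_integral_zero:
  assumes "u \<in> Bb \<pi>" "AE x in \<pi>. 0 \<le> u x" "(\<integral>x. u x \<partial>\<pi>) \<le> 0"
  shows "AE x in \<pi>. u x = 0"
proof -
  have "(\<integral>x. u x \<partial>\<pi>) = 0" using assms by (intro antisym integral_nonneg_AE) auto
  then show ?thesis using integral_nonneg_eq_0_iff_AE[OF integrable_pi[OF assms(1)] assms(2)] by simp
qed

lemma P_one: "0 < t \<Longrightarrow> AE x in \<pi>. P t (\<lambda>_. 1) x = 1"
proof -
  assume t: "0 < t"
  have "AE x in \<pi>. 1 - P t (\<lambda>_. 1) x = 0"
  proof (rule AE_zero_if_integral_zero)
    show "(\<lambda>x. 1 - P t (\<lambda>_. 1) x) \<in> Bb \<pi>" by (intro Bb_intros P_Bb t)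
    show "AE x in \<pi>. 0 \<le> 1 - P t (\<lambda>_. 1) x" using P_one_le[OF t] by (intro AE_I2) simp
    show "(\<integral>x. 1 - P t (\<lambda>_. 1) x \<partial>\<pi>) \<le> 0"
      using P_inv[OF t Bb_const[of 1]] integrable_pi[OF P_Bb[OF t Bb_const[of 1]]] by simp
  qed
  then show ?thesis by (rule AE_mp) (auto intro!: AE_I2)
qed

lemma P_L1:
  assumes "0 < t" "u \<in> Bb \<pi>" "v \<in> Bb \<pi>"
  shows "(\<integral>x. \<bar>P t u x - P t v x\<bar> \<partial>\<pi>) \<le> (\<integral>x. \<bar>u x - v x\<bar> \<partial>\<pi>)"
proof -
  have d: "(\<lambda>x. u x - v x) \<in> Bb \<pi>" "(\<lambda>x. \<bar>u x - v x\<bar>) \<in> Bb \<pi>" by (intro Bb_intros assms)+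
  have "(\<integral>x. \<bar>P t u x - P t v x\<bar> \<partial>\<pi>) \<le> (\<integral>x. P t (\<lambda>y. \<bar>u y - v y\<bar>) x \<partial>\<pi>)"
  proof (rule Bb_integral_mono[OF fm])
    show "(\<lambda>x. \<bar>P t u x - P t v x\<bar>) \<in> Bb \<pi>" by (intro Bb_intros P_Bb assms)
    show "P t (\<lambda>y. \<bar>u y - v y\<bar>) \<in> Bb \<pi>" by (intro P_Bb assms d)
    show "\<bar>P t u x - P t v x\<bar> \<le> P t (\<lambda>y. \<bar>u y - v y\<bar>) x" if "x \<in> space \<pi>" for x
      using P_abs[OF assms(1) d(1) that] P_diff[OF assms that] by simp
  qed
  then show ?thesis using P_inv[OF assms(1) d(2)] by simp
qed

lemma P_cong_AE:
  assumes "0 < t" "u \<in> Bb \<pi>" "v \<in> Bb \<pi>" "AE x in \<pi>. u x = v x"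
  shows "AE x in \<pi>. P t u x = P t v x"
proof -
  have "(\<integral>x. \<bar>u x - v x\<bar> \<partial>\<pi>) = (\<integral>x. 0 \<partial>\<pi>)"
    by (rule integral_cong_AE) (use assms integrable_pi[OF assms(2)] integrable_pi[OF assms(3)] in auto)
  then have "(\<integral>x. \<bar>P t u x - P t v x\<bar> \<partial>\<pi>) \<le> 0" using P_L1[OF assms(1-3)] by simp
  then have "AE x in \<pi>. \<bar>P t u x - P t v x\<bar> = 0"
    by (intro AE_zero_if_integral_zero Bb_intros P_Bb assms) auto
  then show ?thesis by (rule AE_mp) (auto intro!: AE_I2)
qed

lemma P_Jensen:
  assumes "0 < t" "u \<in> Bb \<pi>" "x \<in> space \<pi>" "P t (\<lambda>_. 1) x = 1"
  shows "P t (\<lambda>y. (u y - a)\<^sup>2) x = P t (\<lambda>y. (u y)\<^sup>2) x - 2 * a * P t u x + a\<^sup>2"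
    and "(P t u x)\<^sup>2 \<le> P t (\<lambda>y. (u y)\<^sup>2) x"
proof -
  show *: "P t (\<lambda>y. (u y - a)\<^sup>2) x = P t (\<lambda>y. (u y)\<^sup>2) x - 2 * a * P t u x + a\<^sup>2" for a
  proof -
    have "P t (\<lambda>y. (u y - a)\<^sup>2) x = P t (\<lambda>y. (1 * (u y)\<^sup>2 + (- 2 * a) * u y) + a\<^sup>2 * 1) x"
      by (simp add: power2_diff algebra_simps)
    also have "\<dots> = P t (\<lambda>y. 1 * (u y)\<^sup>2 + (- 2 * a) * u y) x + P t (\<lambda>y. a\<^sup>2 * 1) x"
      by (rule P_add) (intro assms Bb_intros)+
    also have "P t (\<lambda>y. 1 * (u y)\<^sup>2 + (- 2 * a) * u y) x = 1 * P t (\<lambda>y. (u y)\<^sup>2) x + (- 2 * a) * P t u x"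
      by (rule P_lin) (intro assms Bb_intros)+
    also have "P t (\<lambda>y. a\<^sup>2 * 1) x = a\<^sup>2 * P t (\<lambda>_. 1) x"
      by (rule P_scale) (intro assms Bb_intros)+
    finally show ?thesis using assms(4) by simp
  qed
  have "0 \<le> P t (\<lambda>y. (u y - P t u x)\<^sup>2) x"
    by (rule P_pos[OF assms(1) _ _ assms(3)]) (intro Bb_intros assms, simp)
  then show "(P t u x)\<^sup>2 \<le> P t (\<lambda>y. (u y)\<^sup>2) x"
    unfolding * by (simp add: power2_eq_square)
qed

lemma P_L2:
  assumes "0 < t" "u \<in> Bb \<pi>"
  shows "(\<integral>x. (P t u x)\<^sup>2 \<partial>\<pi>) \<le> (\<integral>x. (u x)\<^sup>2 \<partial>\<pi>)"
proof -
  have "(\<integral>x. (P t u x)\<^sup>2 \<partial>\<pi>) \<le> (\<integral>x. P t (\<lambda>y. (u y)\<^sup>2) x \<partial>\<pi>)"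
  proof (rule integral_mono_AE)
    show "integrable \<pi> (\<lambda>x. (P t u x)\<^sup>2)" by (intro integrable_pi Bb_intros P_Bb assms)
    show "integrable \<pi> (P t (\<lambda>y. (u y)\<^sup>2))" by (intro integrable_pi P_Bb Bb_intros assms)
    show "AE x in \<pi>. (P t u x)\<^sup>2 \<le> P t (\<lambda>y. (u y)\<^sup>2) x"
      using P_one[OF assms(1)] AE_space by eventually_elim (rule P_Jensen(2)[OF assms])
  qed
  then show ?thesis using P_inv[OF assms(1) Bb_power2[OF assms(2)]] by simp
qed

definition rigid :: "('a \<Rightarrow> real) \<Rightarrow> bool" where
  "rigid g \<longleftrightarrow> g \<in> Bb \<pi> \<and> (\<forall>t>0. (\<integral>x. (P t g x)\<^sup>2 \<partial>\<pi>) = (\<integral>x. (g x)\<^sup>2 \<partial>\<pi>))"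

text \<open>
  The defect in Jensen's inequality, which is the variance of \<open>g\<close> under the transition law from \<open>x\<close>, has
  integral zero. So the transitions are deterministic as far as \<open>g\<close> can see.
\<close>

lemma rigid_variance_zero:
  assumes "rigid g" "0 < t"
  shows "AE x in \<pi>. P t (\<lambda>_. 1) x = 1 \<and> P t (\<lambda>y. (g y - P t g x)\<^sup>2) x = 0"
proof -
  have g: "g \<in> Bb \<pi>" using assms by (simp add: rigid_def)
  have "AE x in \<pi>. P t (\<lambda>y. (g y)\<^sup>2) x - (P t g x)\<^sup>2 = 0"
  proof (rule AE_zero_if_integral_zero)
    show "(\<lambda>x. P t (\<lambda>y. (g y)\<^sup>2) x - (P t g x)\<^sup>2) \<in> Bb \<pi>" by (intro Bb_intros P_Bb assms g)
    show "AE x in \<pi>. 0 \<le> P t (\<lambda>y. (g y)\<^sup>2) x - (P t g x)\<^sup>2"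
      using P_one[OF assms(2)] AE_space by eventually_elim (use P_Jensen(2)[OF assms(2) g] in simp)
    have "integrable \<pi> (P t (\<lambda>y. (g y)\<^sup>2))" "integrable \<pi> (\<lambda>x. (P t g x)\<^sup>2)"
      by (intro integrable_pi P_Bb Bb_intros assms g)+
    then show "(\<integral>x. P t (\<lambda>y. (g y)\<^sup>2) x - (P t g x)\<^sup>2 \<partial>\<pi>) \<le> 0"
      using P_inv[OF assms(2) Bb_power2[OF g]] assms by (simp add: rigid_def)
  qed
  then show ?thesis
    using P_one[OF assms(2)] AE_space
  proof eventually_elim
    case (elim x)
    then show ?case using P_Jensen(1)[OF assms(2) g elim(3,2), of "P t g x"] by (simp add: power2_eq_square)
  qed
qed

lemma rigid_Lipschitz:
  assumes "rigid g" "0 < t" and \<phi>: "(\<lambda>x. \<phi> (g x)) \<in> Bb \<pi>" "\<And>a b. \<bar>\<phi> a - \<phi> b\<bar> \<le> L * \<bar>a - b :: real\<bar>"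
  shows "AE x in \<pi>. P t (\<lambda>y. \<phi> (g y)) x = \<phi> (P t g x)"
  using rigid_variance_zero[OF assms(1,2)] AE_space
proof eventually_elim
  case (elim x)
  have g: "g \<in> Bb \<pi>" using assms by (simp add: rigid_def)
  let ?w = "\<lambda>y. \<phi> (g y) - \<phi> (P t g x)"
  have w: "?w \<in> Bb \<pi>" by (intro Bb_intros \<phi>)
  have "(P t ?w x)\<^sup>2 \<le> P t (\<lambda>y. (?w y)\<^sup>2) x"
    by (rule P_Jensen(2)[OF assms(2) w elim(2)]) (use elim in simp)
  also have "\<dots> \<le> P t (\<lambda>y. L\<^sup>2 * (g y - P t g x)\<^sup>2) x"
  proof (rule P_mono[OF assms(2) Bb_power2[OF w] _ _ elim(2)])
    show "(\<lambda>y. L\<^sup>2 * (g y - P t g x)\<^sup>2) \<in> Bb \<pi>" by (intro Bb_intros g)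
    show "(?w y)\<^sup>2 \<le> L\<^sup>2 * (g y - P t g x)\<^sup>2" for y
      using power_mono[OF \<phi>(2)[of "g y" "P t g x"] abs_ge_zero, of 2] by (simp add: power_mult_distrib)
  qed
  also have "\<dots> = L\<^sup>2 * P t (\<lambda>y. (g y - P t g x)\<^sup>2) x"
    by (rule P_scale[OF assms(2) _ elim(2)]) (intro Bb_intros g)
  also have "\<dots> = 0" using elim by simp
  finally have "P t ?w x = 0" by simp
  moreover have "P t ?w x = P t (\<lambda>y. \<phi> (g y)) x - P t (\<lambda>y. \<phi> (P t g x) * 1) x"
    using P_diff[OF assms(2) \<phi>(1) Bb_const[of "\<phi> (P t g x)"] elim(2)] by simp
  moreover have "P t (\<lambda>y. \<phi> (P t g x) * 1) x = \<phi> (P t g x) * P t (\<lambda>_. 1) x"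
    by (rule P_scale[OF assms(2) Bb_const elim(2)])
  ultimately show ?case using elim by simp
qed

text \<open>
  Indicators of half-lines are bounded limits of Lipschitz functions, which commute with \<open>P t\<close> along \<open>g\<close>.
\<close>

lemma rigid_superlevel:
  assumes "rigid g" and t: "0 < t"
  shows "AE x in \<pi>. P t (indicator {y \<in> space \<pi>. c < g y}) x = indicator {y \<in> space \<pi>. c < P t g y} x"
proof -
  have g: "g \<in> Bb \<pi>" using assms by (simp add: rigid_def)
  have gm: "g \<in> borel_measurable \<pi>" "P t g \<in> borel_measurable \<pi>"
    using g P_Bb[OF t g] by (auto dest: Bb_measurable)
  let ?B = "{y \<in> space \<pi>. c < g y}" and ?B' = "{y \<in> space \<pi>. c < P t g y}"
  have B: "?B \<in> sets \<pi>" "?B' \<in> sets \<pi>" using gm by measurable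
  define \<phi> where "\<phi> n s = min 1 (max 0 (real n * (s - c)))" for n s
  have \<phi>_Bb: "(\<lambda>x. \<phi> n (h x)) \<in> Bb \<pi>" if "h \<in> Bb \<pi>" for h n
    unfolding \<phi>_def by (intro Bb_intros that)
  have \<phi>_lim: "(\<lambda>n. \<phi> n s) \<longlonglongrightarrow> (if c < s then 1 else 0)" for s
  proof (cases "c < s")
    case True
    then obtain k :: nat where k: "1 / (s - c) < real k" using reals_Archimedean2 by blast
    have "\<phi> n s = 1" if "k \<le> n" for n
    proof -
      have "1 / (s - c) \<le> real n" using k that by linarith
      then have "1 \<le> real n * (s - c)" using True by (simp add: field_simps)
      then show ?thesis by (simp add: \<phi>_def)
    qed
    then have "eventually (\<lambda>n. \<phi> n s = 1) sequentially" by (auto simp: eventually_sequentially)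
    then show ?thesis using True by (simp add: tendsto_eventually)
  next
    case False
    then have "real n * (s - c) \<le> 0" for n by (intro mult_nonneg_nonpos) auto
    then have "max 0 (real n * (s - c)) = 0" for n by (simp add: max_absorb1)
    then have "\<phi> n s = 0" for n by (simp add: \<phi>_def)
    then show ?thesis using False by simp
  qed
  have \<phi>_bd: "\<bar>\<phi> n s\<bar> \<le> 1" for n s by (auto simp: \<phi>_def)
  have \<phi>_Lip: "\<bar>\<phi> n a - \<phi> n b\<bar> \<le> real n * \<bar>a - b\<bar>" for n a b
  proof -
    have "\<bar>\<phi> n a - \<phi> n b\<bar> \<le> \<bar>real n * (a - c) - real n * (b - c)\<bar>"
      by (auto simp: \<phi>_def min_def max_def)
    then show ?thesis by (simp add: right_diff_distrib[symmetric] abs_mult)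
  qed
  have conv: "(\<lambda>n. \<integral>x. \<bar>\<phi> n (h x) - indicator {y \<in> space \<pi>. c < h y} x\<bar> \<partial>\<pi>) \<longlonglongrightarrow> 0"
    if h: "h \<in> Bb \<pi>" for h
  proof -
    have H: "{y \<in> space \<pi>. c < h y} \<in> sets \<pi>" using Bb_measurable[OF h] by measurable
    show ?thesis
    proof (rule Bb_L1_limit[OF fm \<phi>_Bb[OF h] \<phi>_bd _ Bb_indicator[OF H]])
      show "AE x in \<pi>. (\<lambda>n. \<phi> n (h x)) \<longlonglongrightarrow> indicator {y \<in> space \<pi>. c < h y} x"
      proof (rule AE_I2)
        fix x assume "x \<in> space \<pi>"
        then show "(\<lambda>n. \<phi> n (h x)) \<longlonglongrightarrow> indicator {y \<in> space \<pi>. c < h y} x"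
          using \<phi>_lim[of "h x"] by (cases "c < h x") (simp_all add: indicator_def)
      qed
    qed
  qed
  have bound: "(\<integral>x. \<bar>P t (indicator ?B) x - indicator ?B' x\<bar> \<partial>\<pi>)
      \<le> (\<integral>x. \<bar>\<phi> n (g x) - indicator ?B x\<bar> \<partial>\<pi>) + (\<integral>x. \<bar>\<phi> n (P t g x) - indicator ?B' x\<bar> \<partial>\<pi>)" for n
  proof -
    let ?a = "P t (\<lambda>y. \<phi> n (g y))"
    have a: "?a \<in> Bb \<pi>" by (intro P_Bb t \<phi>_Bb g)
    have i1: "integrable \<pi> (\<lambda>x. \<bar>?a x - P t (indicator ?B) x\<bar>)"
      by (intro integrable_pi Bb_abs Bb_diff a P_Bb t Bb_indicator B)
    have i2: "integrable \<pi> (\<lambda>x. \<bar>\<phi> n (P t g x) - indicator ?B' x\<bar>)"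
      by (intro integrable_pi Bb_abs Bb_diff \<phi>_Bb P_Bb t g Bb_indicator B)
    have "(\<integral>x. \<bar>P t (indicator ?B) x - indicator ?B' x\<bar> \<partial>\<pi>)
       \<le> (\<integral>x. \<bar>?a x - P t (indicator ?B) x\<bar> + \<bar>\<phi> n (P t g x) - indicator ?B' x\<bar> \<partial>\<pi>)"
    proof (rule integral_mono_AE)
      show "integrable \<pi> (\<lambda>x. \<bar>P t (indicator ?B) x - indicator ?B' x\<bar>)"
        by (intro integrable_pi Bb_abs Bb_diff P_Bb t Bb_indicator B)
      show "AE x in \<pi>. \<bar>P t (indicator ?B) x - indicator ?B' x\<bar>
          \<le> \<bar>?a x - P t (indicator ?B) x\<bar> + \<bar>\<phi> n (P t g x) - indicator ?B' x\<bar>"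
        using rigid_Lipschitz[OF assms(1) t \<phi>_Bb[OF g] \<phi>_Lip, of n] by eventually_elim linarith
    qed (intro Bochner_Integration.integrable_add i1 i2)
    also have "\<dots> = (\<integral>x. \<bar>?a x - P t (indicator ?B) x\<bar> \<partial>\<pi>) + (\<integral>x. \<bar>\<phi> n (P t g x) - indicator ?B' x\<bar> \<partial>\<pi>)"
      by (rule Bochner_Integration.integral_add[OF i1 i2])
    also have "(\<integral>x. \<bar>?a x - P t (indicator ?B) x\<bar> \<partial>\<pi>) \<le> (\<integral>x. \<bar>\<phi> n (g x) - indicator ?B x\<bar> \<partial>\<pi>)"
      by (rule P_L1[OF t \<phi>_Bb[OF g] Bb_indicator[OF B(1)]])
    finally show ?thesis by simp
  qed
  have "(\<integral>x. \<bar>P t (indicator ?B) x - indicator ?B' x\<bar> \<partial>\<pi>) \<le> 0"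
    using tendsto_add[OF conv[OF g] conv[OF P_Bb[OF t g]]] bound
    by (intro LIMSEQ_le_const[where X="\<lambda>n. (\<integral>x. \<bar>\<phi> n (g x) - indicator ?B x\<bar> \<partial>\<pi>) + (\<integral>x. \<bar>\<phi> n (P t g x) - indicator ?B' x\<bar> \<partial>\<pi>)"]) auto
  then have "AE x in \<pi>. \<bar>P t (indicator ?B) x - indicator ?B' x\<bar> = 0"
    by (intro AE_zero_if_integral_zero Bb_abs Bb_diff P_Bb t Bb_indicator B) auto
  then show ?thesis by (rule AE_mp) (auto intro!: AE_I2)
qed

subsection \<open>Deterministic sets\<close>

text \<open>
  These sets form a \<open>\<sigma>\<close>-algebra on which the semigroup acts by endomorphisms of the measure algebra, given by
  \<open>preimage\<close>.
\<close>

definition deterministic :: "'a set \<Rightarrow> bool" where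
  "deterministic B \<longleftrightarrow> B \<in> sets \<pi> \<and> (\<forall>t>0. AE x in \<pi>. P t (indicator B) x = 0 \<or> P t (indicator B) x = 1)"

definition preimage :: "real \<Rightarrow> 'a set \<Rightarrow> 'a set" where
  "preimage t B = {x \<in> space \<pi>. P t (indicator B) x = 1}"

lemma ind_Bb: "deterministic B \<Longrightarrow> indicator B \<in> Bb \<pi>"
  by (simp add: deterministic_def Bb_indicator)

lemma preimage_sets: "0 < t \<Longrightarrow> deterministic B \<Longrightarrow> preimage t B \<in> sets \<pi>"
  unfolding preimage_def using Bb_measurable[OF P_Bb[OF _ ind_Bb]] by measurable

lemma P_indicator:
  assumes "0 < t" "deterministic B"
  shows "AE x in \<pi>. P t (indicator B) x = indicator (preimage t B) x"
proof -
  have "AE x in \<pi>. P t (indicator B) x = 0 \<or> P t (indicator B) x = 1"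
    using assms by (simp add: deterministic_def)
  then show ?thesis
    using AE_space by eventually_elim (auto simp: preimage_def indicator_def)
qed

lemma measure_preimage:
  assumes "0 < t" "deterministic B"
  shows "measure \<pi> (preimage t B) = measure \<pi> B"
proof -
  have "(\<integral>x. P t (indicator B) x \<partial>\<pi>) = (\<integral>x. indicator (preimage t B) x \<partial>\<pi>)"
    by (rule integral_cong_AE)
      (use P_indicator[OF assms] preimage_sets[OF assms] Bb_measurable[OF P_Bb[OF assms(1) ind_Bb[OF assms(2)]]] in auto)
  then show ?thesis
    using P_inv[OF assms(1) ind_Bb[OF assms(2)]] preimage_sets[OF assms] assms(2)
    by (simp add: deterministic_def)
qed

lemma P_preimage:
  assumes "0 < t" "0 < s" "deterministic B"
  shows "AE x in \<pi>. P t (indicator (preimage s B)) x = P (t + s) (indicator B) x"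
proof -
  have "AE x in \<pi>. P t (P s (indicator B)) x = P t (indicator (preimage s B)) x"
    by (intro P_cong_AE P_indicator assms P_Bb ind_Bb Bb_indicator preimage_sets)
  then show ?thesis
    using AE_space by eventually_elim (use P_semigroup[OF assms(1,2) ind_Bb[OF assms(3)]] in simp)
qed

lemma deterministic_preimage:
  assumes "0 < s" "deterministic B" shows "deterministic (preimage s B)"
  unfolding deterministic_def
proof (intro conjI allI impI preimage_sets assms)
  fix t :: real assume t: "0 < t"
  have "AE x in \<pi>. P (t + s) (indicator B) x = 0 \<or> P (t + s) (indicator B) x = 1"
    using assms t by (simp add: deterministic_def)
  with P_preimage[OF t assms]
  show "AE x in \<pi>. P t (indicator (preimage s B)) x = 0 \<or> P t (indicator (preimage s B)) x = 1"
    by eventually_elim simp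
qed

lemma deterministic_space: "deterministic (space \<pi>)"
  unfolding deterministic_def
proof (intro conjI allI impI)
  fix t :: real assume t: "0 < t"
  show "AE x in \<pi>. P t (indicator (space \<pi>)) x = 0 \<or> P t (indicator (space \<pi>)) x = 1"
    using P_one[OF t] AE_space
  proof eventually_elim
    case (elim x)
    have "P t (\<lambda>_. 1) x = P t (indicator (space \<pi>)) x"
      by (rule P_cong[OF t Bb_const _ elim(2)]) simp
    then show ?case using elim by simp
  qed
qed simp

lemma deterministic_compl:
  assumes "deterministic B" shows "deterministic (space \<pi> - B)"
  unfolding deterministic_def
proof (intro conjI allI impI)
  show "space \<pi> - B \<in> sets \<pi>" using assms by (auto simp: deterministic_def)
  fix t :: real assume t: "0 < t"
  have "AE x in \<pi>. P t (indicator B) x = 0 \<or> P t (indicator B) x = 1"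
    using assms t by (simp add: deterministic_def)
  then show "AE x in \<pi>. P t (indicator (space \<pi> - B)) x = 0 \<or> P t (indicator (space \<pi> - B)) x = 1"
    using P_one[OF t] AE_space
  proof eventually_elim
    case (elim x)
    have "P t (\<lambda>y. 1 - indicator B y) x = P t (indicator (space \<pi> - B)) x"
      by (rule P_cong[OF t Bb_diff[OF Bb_const ind_Bb[OF assms]] _ elim(3)]) (simp add: indicator_def)
    then show ?case using elim P_diff[OF t Bb_const[of 1] ind_Bb[OF assms] elim(3)] by auto
  qed
qed

lemma deterministic_Int:
  assumes "deterministic B" "deterministic C"
  shows "deterministic (B \<inter> C)"
    and "0 < t \<Longrightarrow> AE x in \<pi>. P t (indicator (B \<inter> C)) x = P t (indicator B) x * P t (indicator C) x"
proof -
  have BC: "(indicator (B \<inter> C) :: _ \<Rightarrow> real) \<in> Bb \<pi>" using assms by (auto simp: deterministic_def intro: Bb_indicator)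
  note b = ind_Bb[OF assms(1)] and c = ind_Bb[OF assms(2)]
  have *: "AE x in \<pi>. (P t (indicator (B \<inter> C)) x = 0 \<or> P t (indicator (B \<inter> C)) x = 1) \<and>
      P t (indicator (B \<inter> C)) x = P t (indicator B) x * P t (indicator C) x" if t: "0 < t" for t
  proof -
    have "AE x in \<pi>. P t (indicator B) x = 0 \<or> P t (indicator B) x = 1"
      "AE x in \<pi>. P t (indicator C) x = 0 \<or> P t (indicator C) x = 1"
      using assms t by (simp_all add: deterministic_def)
    then show ?thesis
      using P_one[OF t] AE_space
    proof eventually_elim
      case (elim x)
      have "P t (indicator (B \<inter> C)) x \<le> P t (indicator B) x" "P t (indicator (B \<inter> C)) x \<le> P t (indicator C) x"
        by (rule P_mono[OF t BC b _ elim(4)], simp add: indicator_def)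
          (rule P_mono[OF t BC c _ elim(4)], simp add: indicator_def)
      moreover have "0 \<le> P t (indicator (B \<inter> C)) x"
        by (rule P_pos[OF t BC _ elim(4)]) simp
      moreover have "P t (\<lambda>y. indicator B y + indicator C y - 1) x \<le> P t (indicator (B \<inter> C)) x"
        by (rule P_mono[OF t _ BC _ elim(4)]) (intro Bb_diff Bb_add b c Bb_const, simp add: indicator_def)
      moreover have "P t (\<lambda>y. indicator B y + indicator C y - 1) x = P t (indicator B) x + P t (indicator C) x - 1"
        using P_diff[OF t Bb_add[OF b c] Bb_const[of 1] elim(4)] P_add[OF t b c elim(4)] elim(3) by simp
      ultimately show ?case using elim(1,2) by auto
    qed
  qed
  show "deterministic (B \<inter> C)"
    unfolding deterministic_def
  proof (intro conjI allI impI)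
    show "B \<inter> C \<in> sets \<pi>" using assms by (auto simp: deterministic_def)
    show "AE x in \<pi>. P t (indicator (B \<inter> C)) x = 0 \<or> P t (indicator (B \<inter> C)) x = 1" if "0 < t" for t
      using *[OF that] by eventually_elim (rule conjunct1)
  qed
  show "AE x in \<pi>. P t (indicator (B \<inter> C)) x = P t (indicator B) x * P t (indicator C) x" if "0 < t"
    using *[OF that] by eventually_elim (rule conjunct2)
qed

lemma deterministic_Diff:
  assumes "deterministic B" "deterministic C" shows "deterministic (B - C)"
proof -
  have "B - C = B \<inter> (space \<pi> - C)"
    using assms sets.sets_into_space by (auto simp: deterministic_def)
  then show ?thesis using deterministic_Int(1)[OF assms(1) deterministic_compl[OF assms(2)]] by simp
qed

lemma deterministic_Un:
  assumes "deterministic B" "deterministic C" shows "deterministic (B \<union> C)"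
proof -
  have "B \<union> C = space \<pi> - ((space \<pi> - B) - C)"
    using assms[unfolded deterministic_def] sets.sets_into_space by blast
  then show ?thesis using assms by (simp add: deterministic_compl deterministic_Diff)
qed

lemma deterministic_empty: "deterministic {}"
  using deterministic_compl[OF deterministic_space] by simp

text \<open>
  For \<open>0 \<le> y \<le> 1\<close> the number \<open>y (1 - y)\<close> is at most the distance from \<open>y\<close> to either of 0 and 1. Applied to
  \<open>y = P t 1\<close> of the union, it is bounded in \<open>L\<^sup>1\<close> by the distance to the finite unions, hence vanishes.
\<close>

lemma deterministic_UN:
  assumes B: "\<And>n::nat. deterministic (B n)"
  shows "deterministic (\<Union>n. B n)"
  unfolding deterministic_def
proof (intro conjI allI impI)
  have Bs: "B n \<in> sets \<pi>" for n using B by (simp add: deterministic_def)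
  then show U: "(\<Union>n. B n) \<in> sets \<pi>" by blast
  fix t :: real assume t: "0 < t"
  define C where "C n = (\<Union>i<n. B i)" for n
  have C: "deterministic (C n)" for n
    unfolding C_def by (induction n) (auto simp: deterministic_empty lessThan_Suc intro: deterministic_Un B)
  have Cs: "C n \<in> sets \<pi>" for n using C by (simp add: deterministic_def)
  let ?u = "P t (indicator (\<Union>n. B n))"
  have u: "?u \<in> Bb \<pi>" by (intro P_Bb t Bb_indicator U)
  have "(\<lambda>n. \<integral>x. \<bar>indicator (C n) x - indicator (\<Union>n. B n) x :: real\<bar> \<partial>\<pi>) \<longlonglongrightarrow> 0"
  proof (rule Bb_L1_limit[OF fm Bb_indicator[OF Cs], where c=1])
    show "indicator (\<Union>n. B n) \<in> Bb \<pi>" by (rule Bb_indicator[OF U])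
    have "incseq C" by (auto simp: C_def incseq_def) force
    moreover have "(\<Union>n. C n) = (\<Union>n. B n)" by (auto simp: C_def)
    ultimately show "AE x in \<pi>. (\<lambda>n. indicator (C n) x :: real) \<longlonglongrightarrow> indicator (\<Union>n. B n) x"
      using LIMSEQ_indicator_incseq[of C] by (intro AE_I2) simp
  qed (auto simp: indicator_def)
  then have L: "(\<lambda>n. \<integral>x. \<bar>indicator (\<Union>n. B n) x - indicator (C n) x :: real\<bar> \<partial>\<pi>) \<longlonglongrightarrow> 0"
    by (simp add: abs_minus_commute)
  have "(\<integral>x. ?u x * (1 - ?u x) \<partial>\<pi>) \<le> (\<integral>x. \<bar>indicator (\<Union>n. B n) x - indicator (C n) x\<bar> \<partial>\<pi>)" for n
  proof -
    have "(\<integral>x. ?u x * (1 - ?u x) \<partial>\<pi>) \<le> (\<integral>x. \<bar>?u x - P t (indicator (C n)) x\<bar> \<partial>\<pi>)"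
    proof (rule integral_mono_AE)
      show "integrable \<pi> (\<lambda>x. ?u x * (1 - ?u x))" by (intro integrable_pi Bb_mult Bb_diff Bb_const u)
      show "integrable \<pi> (\<lambda>x. \<bar>?u x - P t (indicator (C n)) x\<bar>)"
        by (intro integrable_pi Bb_abs Bb_diff u P_Bb t Bb_indicator Cs)
      have "AE x in \<pi>. P t (indicator (C n)) x = 0 \<or> P t (indicator (C n)) x = 1"
        using C[of n] t by (simp add: deterministic_def)
      then show "AE x in \<pi>. ?u x * (1 - ?u x) \<le> \<bar>?u x - P t (indicator (C n)) x\<bar>"
        using AE_space
      proof eventually_elim
        case (elim x)
        have "0 \<le> ?u x" by (rule P_pos[OF t Bb_indicator[OF U] _ elim(2)]) simp
        moreover have "\<bar>?u x\<bar> \<le> 1" by (rule P_bounded[OF t Bb_indicator[OF U] _ elim(2)]) simp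
        ultimately have "?u x * (1 - ?u x) \<le> ?u x" "?u x * (1 - ?u x) \<le> 1 - ?u x"
          using mult_left_mono[of "1 - ?u x" 1 "?u x"] mult_right_mono[of "?u x" 1 "1 - ?u x"] by auto
        then show ?case using elim(1) by auto
      qed
    qed
    also have "\<dots> \<le> (\<integral>x. \<bar>indicator (\<Union>n. B n) x - indicator (C n) x\<bar> \<partial>\<pi>)"
      by (rule P_L1[OF t Bb_indicator[OF U] Bb_indicator[OF Cs]])
    finally show ?thesis .
  qed
  then have "(\<integral>x. ?u x * (1 - ?u x) \<partial>\<pi>) \<le> 0" by (intro LIMSEQ_le_const[OF L]) auto
  then have "AE x in \<pi>. ?u x * (1 - ?u x) = 0"
  proof (rule AE_zero_if_integral_zero[rotated 2])
    show "(\<lambda>x. ?u x * (1 - ?u x)) \<in> Bb \<pi>" by (intro Bb_mult Bb_diff Bb_const u)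
    show "AE x in \<pi>. 0 \<le> ?u x * (1 - ?u x)"
    proof (rule AE_I2)
      fix x assume x: "x \<in> space \<pi>"
      have "0 \<le> ?u x" by (rule P_pos[OF t Bb_indicator[OF U] _ x]) simp
      moreover have "\<bar>?u x\<bar> \<le> 1" by (rule P_bounded[OF t Bb_indicator[OF U] _ x]) simp
      ultimately show "0 \<le> ?u x * (1 - ?u x)" by simp
    qed
  qed
  then show "AE x in \<pi>. ?u x = 0 \<or> ?u x = 1" by (rule AE_mp) (auto intro!: AE_I2)
qed

lemma deterministic_countable_Union:
  assumes "countable J" "\<And>B. B \<in> J \<Longrightarrow> deterministic B"
  shows "deterministic (\<Union>J)"
proof (cases "J = {}")
  case False
  then have "deterministic (\<Union>n. from_nat_into J n)"
    by (intro deterministic_UN assms from_nat_into)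
  moreover have "(\<Union>n. from_nat_into J n) = \<Union>J"
    using range_from_nat_into[OF False assms(1)] by auto
  ultimately show ?thesis by simp
qed (simp add: deterministic_empty)

definition atom :: "'a set \<Rightarrow> bool" where
  "atom B \<longleftrightarrow> deterministic B \<and> 0 < measure \<pi> B \<and>
    (\<forall>C. deterministic C \<longrightarrow> C \<subseteq> B \<longrightarrow> measure \<pi> C = 0 \<or> measure \<pi> C = measure \<pi> B)"

lemma AE_eq_indicator:
  assumes "B \<in> sets \<pi>" "C \<in> sets \<pi>" "measure \<pi> (B \<inter> C) = measure \<pi> B" "measure \<pi> C = measure \<pi> B"
  shows "AE x in \<pi>. indicator B x = (indicator C x :: real)"
proof -
  have n: "B - B \<inter> C \<in> null_sets \<pi>" "C - B \<inter> C \<in> null_sets \<pi>"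
    using assms finite_measure_Diff[of B "B \<inter> C"] finite_measure_Diff[of C "B \<inter> C"]
    by (auto simp: null_sets_def emeasure_eq_measure)
  show ?thesis using AE_not_in[OF n(1)] AE_not_in[OF n(2)] by eventually_elim (auto simp: indicator_def)
qed

lemma P_fixed_multiple:
  assumes "0 < s" "u \<in> Bb \<pi>" "AE x in \<pi>. P s u x = u x"
  shows "AE x in \<pi>. P (real (Suc m) * s) u x = u x"
proof (induction m)
  case (Suc m)
  have ms: "0 < real (Suc m) * s" using assms(1) by simp
  have "AE x in \<pi>. P s (P (real (Suc m) * s) u) x = P s u x"
    by (rule P_cong_AE) (intro assms Suc.IH P_Bb ms)+
  then show ?case
    using assms(3) AE_space
  proof eventually_elim
    case (elim x)
    have "real (Suc (Suc m)) * s = s + real (Suc m) * s" by (simp add: algebra_simps)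
    then show ?case using P_semigroup[OF assms(1) ms assms(2) elim(3)] elim by simp
  qed
qed (use assms in simp)

text \<open>
  The images of an atom under the times \<open>s, 2s, \<dots>, Ns\<close> have equal measure, so two of them meet once
  \<open>N\<close> exceeds the ratio of total mass and mass of the atom. Hence the atom returns to itself after \<open>n s\<close>
  with \<open>n \<le> N\<close>, in particular after \<open>N! s\<close>. Since \<open>N\<close> does not depend on \<open>s\<close>, the choice \<open>s = t / N!\<close>
  shows that the atom is fixed by every \<open>P t\<close>.
\<close>

lemma atom_recurrence:
  assumes B: "atom B" and s: "0 < s" and N: "measure \<pi> (space \<pi>) < real N * measure \<pi> B"
  shows "\<exists>n\<in>{1..N}. AE x in \<pi>. P (real n * s) (indicator B) x = indicator B x"
proof -
  have dB: "deterministic B" using B by (simp add: atom_def)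
  define A where "A j = preimage (real j * s) B" for j :: nat
  have A: "A j \<in> sets \<pi>" "measure \<pi> (A j) = measure \<pi> B" if "1 \<le> j" for j
    using that s dB by (simp_all add: A_def preimage_sets measure_preimage)
  have "\<exists>i j. 1 \<le> i \<and> i < j \<and> j \<le> N \<and> measure \<pi> (A i \<inter> A j) \<noteq> 0"
  proof (rule ccontr)
    assume "\<not> ?thesis"
    then have z: "measure \<pi> (A i \<inter> A j) = 0" if "1 \<le> i" "i < j" "j \<le> N" for i j using that by blast
    have ae: "AE x in \<pi>. \<forall>i\<in>{1..N}. \<forall>j\<in>{1..N}. i < j \<longrightarrow> x \<notin> A i \<inter> A j"
    proof (intro AE_finite_allI finite_atLeastAtMost)
      fix i j assume ij: "i \<in> {1..N}" "j \<in> {1..N}"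
      show "AE x in \<pi>. i < j \<longrightarrow> x \<notin> A i \<inter> A j"
      proof (cases "i < j")
        case True
        then have "A i \<inter> A j \<in> null_sets \<pi>"
          using ij z[of i j] A by (auto simp: null_sets_def emeasure_eq_measure)
        from AE_not_in[OF this] show ?thesis by eventually_elim simp
      qed simp
    qed
    have "real N * measure \<pi> B = (\<Sum>j\<in>{1..N}. measure \<pi> (A j))" using A by simp
    also have "\<dots> = (\<integral>x. (\<Sum>j\<in>{1..N}. indicator (A j) x) \<partial>\<pi>)"
      using A by (subst Bochner_Integration.integral_sum) (auto intro!: integrable_pi Bb_indicator)
    also have "\<dots> \<le> (\<integral>x. 1 \<partial>\<pi>)"
    proof (rule integral_mono_AE)
      show "integrable \<pi> (\<lambda>x. \<Sum>j\<in>{1..N}. indicator (A j) x :: real)"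
        using A by (intro Bochner_Integration.integrable_sum integrable_pi Bb_indicator) auto
      show "AE x in \<pi>. (\<Sum>j\<in>{1..N}. indicator (A j) x :: real) \<le> 1"
        using ae
      proof eventually_elim
        case (elim x)
        have "(\<Sum>j\<in>{1..N}. indicator (A j) x :: real) = real (card {j\<in>{1..N}. x \<in> A j})"
          by (simp add: indicator_def sum.If_cases Int_def)
        also have "card {j\<in>{1..N}. x \<in> A j} \<le> 1"
        proof (rule card_le_Suc0_iff_eq[THEN iffD2, unfolded One_nat_def[symmetric]])
          show "\<forall>i\<in>{j\<in>{1..N}. x \<in> A j}. \<forall>j\<in>{j\<in>{1..N}. x \<in> A j}. i = j"
            using elim by (metis (mono_tags, lifting) IntI linorder_neqE_nat mem_Collect_eq)
        qed simp
        finally show ?case by simp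
      qed
    qed simp
    finally show False using N by simp
  qed
  then obtain i j where ij: "1 \<le> i" "i < j" "j \<le> N" "measure \<pi> (A i \<inter> A j) \<noteq> 0" by blast
  define n where "n = j - i"
  have n: "n \<in> {1..N}" "0 < real n * s" "0 < real i * s" "real i * s + real n * s = real j * s"
    using ij s by (auto simp: n_def of_nat_diff algebra_simps)
  let ?C = "preimage (real n * s) B"
  have dC: "deterministic ?C" by (rule deterministic_preimage[OF n(2) dB])
  have C: "?C \<in> sets \<pi>" "measure \<pi> ?C = measure \<pi> B"
    using dC measure_preimage[OF n(2) dB] by (simp_all add: deterministic_def)
  have "AE x in \<pi>. P (real i * s) (indicator (B \<inter> ?C)) x = indicator (A i \<inter> A j) x"
  proof -
    have "0 < real j * s" using n by linarith
    note * = deterministic_Int(2)[OF dB dC n(3)] P_indicator[OF n(3) dB] P_indicator[OF this dB] P_preimage[OF n(3,2) dB]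
    show ?thesis using * unfolding n(4)
      by eventually_elim (simp add: A_def indicator_inter_arith)
  qed
  then have "(\<integral>x. P (real i * s) (indicator (B \<inter> ?C)) x \<partial>\<pi>) = (\<integral>x. indicator (A i \<inter> A j) x \<partial>\<pi>)"
    by (intro integral_cong_AE)
      (use A[of i] A[of j] ij Bb_measurable[OF P_Bb[OF n(3) ind_Bb[OF deterministic_Int(1)[OF dB dC]]]] in auto)
  then have "measure \<pi> (B \<inter> ?C) = measure \<pi> (A i \<inter> A j)"
    using P_inv[OF n(3) ind_Bb[OF deterministic_Int(1)[OF dB dC]]] A[of i] A[of j] ij C dB
    by (simp add: deterministic_def sets.Int)
  then have "measure \<pi> (B \<inter> ?C) = measure \<pi> B"
    using B deterministic_Int(1)[OF dB dC] ij by (auto simp: atom_def)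
  then have "AE x in \<pi>. indicator B x = (indicator ?C x :: real)"
    using C dB by (intro AE_eq_indicator) (auto simp: deterministic_def)
  with P_indicator[OF n(2) dB] have "AE x in \<pi>. P (real n * s) (indicator B) x = indicator B x"
    by eventually_elim simp
  then show ?thesis using n(1) by blast
qed

lemma atom_fixed:
  assumes B: "atom B" and t: "0 < t"
  shows "AE x in \<pi>. P t (indicator B) x = indicator B x"
proof -
  have dB: "deterministic B" and pos: "0 < measure \<pi> B" using B by (simp_all add: atom_def)
  obtain N :: nat where "measure \<pi> (space \<pi>) / measure \<pi> B < real N" using reals_Archimedean2 by blast
  then have N: "measure \<pi> (space \<pi>) < real N * measure \<pi> B" using pos by (simp add: field_simps)
  define s where "s = t / fact N"
  have s: "0 < s" using t by (simp add: s_def)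
  obtain n where n: "n \<in> {1..N}" "AE x in \<pi>. P (real n * s) (indicator B) x = indicator B x"
    using atom_recurrence[OF B s N] by blast
  have "n dvd fact N" using n(1) by (intro dvd_fact) auto
  then obtain m where m: "fact N = n * m" by blast
  then have "m \<noteq> 0" using fact_nonzero[of N, where 'a=nat] by (metis mult_0_right)
  then obtain m' where m': "m = Suc m'" by (cases m) auto
  have ns: "0 < real n * s" using n s by simp
  have "real (Suc m') * (real n * s) = t"
  proof -
    have "real (Suc m') * (real n * s) = real (n * m) * s" unfolding m' of_nat_mult by (simp only: mult_ac)
    also have "\<dots> = fact N * s" by (simp add: m[symmetric])
    finally show ?thesis by (simp add: s_def)
  qed
  then show ?thesis using P_fixed_multiple[OF ns ind_Bb[OF dB] n(2), of m'] by simp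
qed

text \<open>
  Deterministic sets of arbitrarily small measure cover any atom-free deterministic set. A point \<open>x\<close>
  of its preimage would be sent by the time-\<open>t0\<close> transition, with probability one, to a set of measure
  at most \<open>1/n\<close> for each \<open>n\<close>, which absolute continuity of the transition law forbids.
\<close>

lemma atom_exists:
  assumes E: "deterministic E" "0 < measure \<pi> E" and t0: "0 < t0"
    and ac: "AE x in \<pi>. \<exists>\<kappa>\<in>finite_measures \<pi>. absolutely_continuous \<pi> \<kappa> \<and>
      (\<forall>B\<in>sets \<pi>. P t0 (indicator B) x = measure \<kappa> B)"
  shows "\<exists>B. atom B \<and> B \<subseteq> E"
proof (rule ccontr)
  assume no: "\<not> ?thesis"
  have ds: "B \<in> sets \<pi>" if "deterministic B" for B using that by (simp add: deterministic_def)
  have half: "\<exists>C. deterministic C \<and> C \<subseteq> B \<and> 0 < measure \<pi> C \<and> measure \<pi> C \<le> measure \<pi> B / 2"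
    if B: "deterministic B" "B \<subseteq> E" "0 < measure \<pi> B" for B
  proof -
    obtain C where C: "deterministic C" "C \<subseteq> B" "measure \<pi> C \<noteq> 0" "measure \<pi> C \<noteq> measure \<pi> B"
      using no B by (auto simp: atom_def)
    have "measure \<pi> (B - C) = measure \<pi> B - measure \<pi> C" by (rule finite_measure_Diff) (use B C ds in auto)
    moreover have "measure \<pi> C \<le> measure \<pi> B" by (rule finite_measure_mono) (use B C ds in auto)
    moreover have "0 < measure \<pi> C" using C(3) by (simp add: zero_less_measure_iff)
    ultimately consider "measure \<pi> C \<le> measure \<pi> B / 2"
      | "0 < measure \<pi> (B - C)" "measure \<pi> (B - C) \<le> measure \<pi> B / 2" using C(4) by linarith
    then show ?thesis
      by cases (use C B \<open>0 < measure \<pi> C\<close> deterministic_Diff[OF B(1) C(1)] in blast)+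
  qed
  have pow: "\<exists>C. deterministic C \<and> C \<subseteq> B \<and> 0 < measure \<pi> C \<and> measure \<pi> C \<le> measure \<pi> B / 2 ^ m"
    if B: "deterministic B" "B \<subseteq> E" "0 < measure \<pi> B" for B and m :: nat
  proof (induction m)
    case (Suc m)
    then obtain C where C: "deterministic C" "C \<subseteq> B" "0 < measure \<pi> C" "measure \<pi> C \<le> measure \<pi> B / 2 ^ m" by blast
    obtain D where D: "deterministic D" "D \<subseteq> C" "0 < measure \<pi> D" "measure \<pi> D \<le> measure \<pi> C / 2"
      using half[of C] C B by blast
    have "measure \<pi> D \<le> measure \<pi> B / 2 ^ Suc m" using D(4) C(4) by simp
    then show ?case using D C by blast
  qed (use B in auto)
  have small: "\<exists>C. deterministic C \<and> C \<subseteq> B \<and> 0 < measure \<pi> C \<and> measure \<pi> C \<le> \<delta>"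
    if B: "deterministic B" "B \<subseteq> E" "0 < measure \<pi> B" and \<delta>: "0 < \<delta>" for B and \<delta> :: real
  proof -
    obtain m where "(1 / 2) ^ m < \<delta> / measure \<pi> B"
      using real_arch_pow_inv[of "\<delta> / measure \<pi> B" "1/2"] B \<delta> by auto
    then have "measure \<pi> B / 2 ^ m \<le> \<delta>" using B by (simp add: field_simps)
    then show ?thesis using pow[OF B, of m] by (meson order_trans)
  qed
  define I where "I n = {C. deterministic C \<and> C \<subseteq> E \<and> measure \<pi> C \<le> 1 / real (Suc n)}" for n
  have "\<exists>J. countable J \<and> J \<subseteq> I n \<and> (\<forall>C\<in>I n. measure \<pi> (C - \<Union>J) = 0)" for n
  proof -
    obtain J where "countable J" "J \<subseteq> I n" "\<And>C. C \<in> I n \<Longrightarrow> measure \<pi> (C - (\<Union>j\<in>J. j)) = 0"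
      by (rule countable_exhaustion[OF fm, of "I n" "\<lambda>C. C"]) (auto simp: I_def ds)
    then show ?thesis by auto
  qed
  then obtain J where J: "\<And>n. countable (J n)" "\<And>n. J n \<subseteq> I n" "\<And>n C. C \<in> I n \<Longrightarrow> measure \<pi> (C - \<Union>(J n)) = 0"
    by metis
  have dJ: "deterministic C" "measure \<pi> C \<le> 1 / real (Suc n)" "C \<subseteq> E" if "C \<in> J n" for C n
    using J(2)[of n] that by (auto simp: I_def)
  have U: "deterministic (\<Union>(J n))" for n by (intro deterministic_countable_Union J dJ)
  have cover: "measure \<pi> (E - \<Union>(J n)) = 0" for n
  proof (rule ccontr)
    assume "measure \<pi> (E - \<Union>(J n)) \<noteq> 0"
    then have "0 < measure \<pi> (E - \<Union>(J n))" by (simp add: zero_less_measure_iff)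
    then obtain C where C: "deterministic C" "C \<subseteq> E - \<Union>(J n)" "0 < measure \<pi> C" "measure \<pi> C \<le> 1 / real (Suc n)"
      using small[of "E - \<Union>(J n)" "1 / real (Suc n)"] deterministic_Diff[OF E(1) U] by auto
    then have "measure \<pi> (C - \<Union>(J n)) = 0" by (intro J(3)) (auto simp: I_def)
    moreover have "C - \<Union>(J n) = C" using C by blast
    ultimately show False using C by simp
  qed
  have eqU: "AE x in \<pi>. P t0 (indicator E) x = P t0 (indicator (\<Union>(J n))) x" for n
  proof (rule P_cong_AE[OF t0 ind_Bb[OF E(1)] ind_Bb[OF U]])
    have sub: "\<Union>(J n) \<subseteq> E" using dJ by blast
    have "E - \<Union>(J n) \<in> null_sets \<pi>"
      using cover[of n] ds[OF E(1)] ds[OF U[of n]] by (auto simp: null_sets_def emeasure_eq_measure)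
    from AE_not_in[OF this] show "AE x in \<pi>. indicator E x = (indicator (\<Union>(J n)) x :: real)"
      by eventually_elim (use sub in \<open>auto simp: indicator_def\<close>)
  qed
  have "AE x in \<pi>. \<forall>n. P t0 (indicator E) x = P t0 (indicator (\<Union>(J n))) x"
    using eqU by (simp add: AE_all_countable)
  moreover have "AE x in \<pi>. \<forall>n. \<forall>C\<in>J n. P t0 (indicator C) x = 0 \<or> P t0 (indicator C) x = 1"
    unfolding AE_all_countable
  proof
    fix n
    have "AE x in \<pi>. P t0 (indicator C) x = 0 \<or> P t0 (indicator C) x = 1" if "C \<in> J n" for C
      using dJ(1)[OF that] t0 by (simp add: deterministic_def)
    then show "AE x in \<pi>. \<forall>C\<in>J n. P t0 (indicator C) x = 0 \<or> P t0 (indicator C) x = 1"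
      using J(1)[of n] by (intro AE_ball_countable[THEN iffD2]) auto
  qed
  moreover have "AE x in \<pi>. P t0 (indicator E) x = 0 \<or> P t0 (indicator E) x = 1"
    using E(1) t0 by (simp add: deterministic_def)
  ultimately have "AE x in \<pi>. P t0 (indicator E) x = 0"
    using ac P_one[OF t0] AE_space
  proof eventually_elim
    case (elim x)
    show ?case
    proof (rule ccontr)
      assume "P t0 (indicator E) x \<noteq> 0"
      then have E1: "P t0 (indicator E) x = 1" using elim by blast
      obtain \<kappa> where \<kappa>: "\<kappa> \<in> finite_measures \<pi>" "absolutely_continuous \<pi> \<kappa>"
        "\<And>B. B \<in> sets \<pi> \<Longrightarrow> P t0 (indicator B) x = measure \<kappa> B" using elim by blast
      interpret k: finite_measure \<kappa> by (rule finite_measuresD[OF \<kappa>(1)])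
      note ks = finite_measuresD(2,3)[OF \<kappa>(1)]
      have k1: "measure \<kappa> (space \<pi>) = 1"
      proof -
        have "P t0 (\<lambda>_. 1) x = P t0 (indicator (space \<pi>)) x"
          by (rule P_cong[OF t0 Bb_const]) (use elim in auto)
        then show ?thesis using elim \<kappa>(3)[of "space \<pi>"] by simp
      qed
      have "\<exists>C\<in>J n. measure \<kappa> C = 1" for n
      proof (rule ccontr)
        assume "\<not> ?thesis"
        then have "measure \<kappa> C = 0" if "C \<in> J n" for C
          using elim(2) \<kappa>(3)[OF ds[OF dJ(1)[OF that]]] that by metis
        then have "\<Union>(J n) \<in> null_sets \<kappa>"
          using J(1)[of n] dJ(1) ds ks
          by (intro null_sets_UN'[of "J n" "\<lambda>C. C", simplified]) (auto simp: null_sets_def k.emeasure_eq_measure)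
        then have "measure \<kappa> (\<Union>(J n)) = 0" by (simp add: null_sets_def measure_def)
        then show False using elim E1 \<kappa>(3)[OF ds[OF U[of n]]] by auto
      qed
      then obtain C where C: "\<And>n. C n \<in> J n" "\<And>n. measure \<kappa> (C n) = 1" by metis
      have Cs: "C n \<in> sets \<pi>" for n using ds[OF dJ(1)[OF C(1)]] .
      have "measure \<pi> (\<Inter>n. C n) = 0"
      proof (rule ccontr)
        assume "measure \<pi> (\<Inter>n. C n) \<noteq> 0"
        then have "0 < measure \<pi> (\<Inter>n. C n)" by (simp add: zero_less_measure_iff)
        then obtain n where n: "1 / real (Suc n) < measure \<pi> (\<Inter>n. C n)" using nat_approx_posE by blast
        have "measure \<pi> (\<Inter>n. C n) \<le> measure \<pi> (C n)"
          using Cs by (intro finite_measure_mono) auto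
        then show False using dJ(2)[OF C(1), of n] n by linarith
      qed
      then have "(\<Inter>n. C n) \<in> null_sets \<pi>" using Cs by (auto simp: null_sets_def emeasure_eq_measure)
      then have N1: "(\<Inter>n. C n) \<in> null_sets \<kappa>" using \<kappa>(2) by (auto simp: absolutely_continuous_def)
      have N2: "(\<Union>n. space \<pi> - C n) \<in> null_sets \<kappa>"
      proof (intro null_sets_UN)
        fix n
        have "measure \<kappa> (space \<kappa> - C n) = measure \<kappa> (space \<kappa>) - measure \<kappa> (C n)"
          using Cs ks by (intro k.finite_measure_compl) auto
        then show "space \<pi> - C n \<in> null_sets \<kappa>"
          using Cs[of n] ks k1 C(2)[of n] by (auto simp: null_sets_def k.emeasure_eq_measure)
      qed
      have "space \<pi> \<subseteq> (\<Inter>n. C n) \<union> (\<Union>n. space \<pi> - C n)" by blast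
      moreover have "(\<Inter>n. C n) \<union> (\<Union>n. space \<pi> - C n) \<in> null_sets \<kappa>" using N1 N2 by blast
      ultimately have "space \<pi> \<in> null_sets \<kappa>" using ks by (intro null_sets_subset[of _ \<kappa> "space \<pi>"]) auto
      then show False using k1 by (simp add: null_sets_def measure_def)
    qed
  qed
  then have "(\<integral>x. P t0 (indicator E) x \<partial>\<pi>) = (\<integral>x. 0 \<partial>\<pi>)"
    by (intro integral_cong_AE) (use Bb_measurable[OF P_Bb[OF t0 ind_Bb[OF E(1)]]] in auto)
  then show False using P_inv[OF t0 ind_Bb[OF E(1)]] E ds by simp
qed

text \<open>
  An atom inside \<open>B\<close> but outside its preimage would be fixed and yet disjoint from the preimage of a
  set that contains it.
\<close>

lemma deterministic_fixed:
  assumes B: "deterministic B" and t: "0 < t" and t0: "0 < t0"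
    and ac: "AE x in \<pi>. \<exists>\<kappa>\<in>finite_measures \<pi>. absolutely_continuous \<pi> \<kappa> \<and>
      (\<forall>B\<in>sets \<pi>. P t0 (indicator B) x = measure \<kappa> B)"
  shows "AE x in \<pi>. P t (indicator B) x = indicator B x"
proof -
  let ?B' = "preimage t B"
  have dB': "deterministic ?B'" by (rule deterministic_preimage[OF t B])
  have s: "B \<in> sets \<pi>" "?B' \<in> sets \<pi>" using B dB' by (simp_all add: deterministic_def)
  have "measure \<pi> (B - ?B') = 0"
  proof (rule ccontr)
    assume "measure \<pi> (B - ?B') \<noteq> 0"
    then obtain A where A: "atom A" "A \<subseteq> B - ?B'"
      using atom_exists[OF deterministic_Diff[OF B dB'] _ t0 ac] by (auto simp: zero_less_measure_iff)
    have dA: "deterministic A" using A by (simp add: atom_def)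
    have "AE x in \<pi>. x \<notin> A"
      using atom_fixed[OF A(1) t] P_indicator[OF t B] AE_space
    proof eventually_elim
      case (elim x)
      have "P t (indicator A) x \<le> P t (indicator B) x"
        by (rule P_mono[OF t ind_Bb[OF dA] ind_Bb[OF B] _ elim(3)]) (use A in \<open>auto simp: indicator_def\<close>)
      then show ?case using elim A(2) by (auto simp: indicator_def split: if_splits)
    qed
    then have "A \<in> null_sets \<pi>"
      using dA AE_iff_null_sets[of A \<pi>] by (simp add: deterministic_def)
    then show False using A(1) by (simp add: atom_def null_sets_def measure_def)
  qed
  moreover have "measure \<pi> B = measure \<pi> (B - ?B') + measure \<pi> (B \<inter> ?B')"
    using finite_measure_Union[of "B - ?B'" "B \<inter> ?B'"] s Un_Diff_Int[of B ?B'] by auto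
  ultimately have "AE x in \<pi>. indicator B x = (indicator ?B' x :: real)"
    by (intro AE_eq_indicator s) (use measure_preimage[OF t B] in auto)
  with P_indicator[OF t B] show ?thesis by eventually_elim simp
qed

text \<open>
  The superlevel sets of \<open>g\<close> are deterministic, hence fixed, and they determine \<open>g\<close>.
\<close>

theorem rigid_fixed:
  assumes g: "rigid g" and t: "0 < t" and t0: "0 < t0"
    and ac: "AE x in \<pi>. \<exists>\<kappa>\<in>finite_measures \<pi>. absolutely_continuous \<pi> \<kappa> \<and>
      (\<forall>B\<in>sets \<pi>. P t0 (indicator B) x = measure \<kappa> B)"
  shows "AE x in \<pi>. P t g x = g x"
proof -
  have gB: "g \<in> Bb \<pi>" using g by (simp add: rigid_def)
  have "AE x in \<pi>. c < P t g x \<longleftrightarrow> c < g x" for c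
  proof -
    let ?B = "{y \<in> space \<pi>. c < g y}"
    have "deterministic ?B"
      unfolding deterministic_def
    proof (intro conjI allI impI)
      show "?B \<in> sets \<pi>" using Bb_measurable[OF gB] by measurable
      show "AE x in \<pi>. P s (indicator ?B) x = 0 \<or> P s (indicator ?B) x = 1" if "0 < s" for s
        using rigid_superlevel[OF g that, of c] by eventually_elim (simp add: indicator_def)
    qed
    from deterministic_fixed[OF this t t0 ac] rigid_superlevel[OF g t, of c] AE_space
    show ?thesis by eventually_elim (auto simp: indicator_def split: if_splits)
  qed
  then have "AE x in \<pi>. \<forall>q::rat. of_rat q < P t g x \<longleftrightarrow> of_rat q < g x"
    by (simp add: AE_all_countable)
  then show ?thesis
  proof eventually_elim
    case (elim x)
    show ?case
    proof (rule ccontr)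
      assume "P t g x \<noteq> g x"
      then obtain q :: rat where "(P t g x < of_rat q \<and> of_rat q < g x) \<or> (g x < of_rat q \<and> of_rat q < P t g x)"
        using of_rat_dense by (metis linorder_neqE_linordered_idom)
      then show False using elim by (metis less_asym')
    qed
  qed
qed

text \<open>
  A limit point \<open>g\<close> of an orbit has an orbit of constant \<open>L\<^sup>2\<close> norm, hence is fixed by the rigidity
  theorem; the \<open>L\<^sup>1\<close> contractivity then turns convergence along a sequence into convergence.
\<close>

theorem L1_convergence:
  assumes u: "u \<in> Bb \<pi>" and t0: "0 < t0"
    and ac: "AE x in \<pi>. \<exists>\<kappa>\<in>finite_measures \<pi>. absolutely_continuous \<pi> \<kappa> \<and>
      (\<forall>B\<in>sets \<pi>. P t0 (indicator B) x = measure \<kappa> B)"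
    and compact: "\<And>w c. (\<And>n::nat. w n \<in> Bb \<pi>) \<Longrightarrow> (\<And>n x. x \<in> space \<pi> \<Longrightarrow> \<bar>w n x\<bar> \<le> c) \<Longrightarrow>
      \<exists>r v. strict_mono (r :: nat \<Rightarrow> nat) \<and> v \<in> Bb \<pi> \<and> (AE x in \<pi>. (\<lambda>n. P t0 (w (r n)) x) \<longlonglongrightarrow> P t0 v x)"
  shows "\<exists>g\<in>Bb \<pi>. ((\<lambda>t. \<integral>x. \<bar>P t u x - g x\<bar> \<partial>\<pi>) \<longlongrightarrow> 0) at_top"
proof -
  obtain c where c: "0 \<le> c" "\<And>x. x \<in> space \<pi> \<Longrightarrow> \<bar>u x\<bar> \<le> c" using BbE[OF u] by blast
  have Pc: "\<bar>P t u x\<bar> \<le> c" if "0 < t" "x \<in> space \<pi>" for t x by (rule P_bounded[OF that(1) u c(2) that(2)])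
  define w where "w n = P (real (Suc n)) u" for n
  have w: "w n \<in> Bb \<pi>" for n by (simp add: w_def P_Bb u)
  obtain r v where r: "strict_mono (r :: nat \<Rightarrow> nat)" and v: "v \<in> Bb \<pi>"
    and lim: "AE x in \<pi>. (\<lambda>n. P t0 (w (r n)) x) \<longlonglongrightarrow> P t0 v x"
    using compact[of w c] w Pc by (auto simp: w_def)
  define s where "s n = t0 + real (Suc (r n))" for n
  define g where "g = P t0 v"
  have g: "g \<in> Bb \<pi>" by (simp add: g_def P_Bb t0 v)
  have s: "0 < s n" for n using t0 by (simp add: s_def)
  have rn: "n \<le> r n" for n using r by (rule strict_mono_imp_increasing)
  have sinf: "\<exists>n. t \<le> s n" for t
  proof -
    obtain n :: nat where "t \<le> real n" using real_arch_simple by blast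
    then show ?thesis using rn[of n] t0 by (intro exI[of _ n]) (simp add: s_def)
  qed
  have PB: "P t u \<in> Bb \<pi>" if "0 < t" for t by (rule P_Bb[OF that u])
  have limg: "AE x in \<pi>. (\<lambda>n. P (s n) u x) \<longlonglongrightarrow> g x"
    using lim AE_space
  proof eventually_elim
    case (elim x)
    then show ?case using P_semigroup[OF t0 _ u elim(2)] by (simp add: s_def g_def w_def)
  qed
  have L1: "(\<lambda>n. \<integral>x. \<bar>P (s n) u x - g x\<bar> \<partial>\<pi>) \<longlonglongrightarrow> 0"
    by (rule Bb_L1_limit[OF fm PB[OF s] Pc[OF s] limg g])
  have gc: "AE x in \<pi>. \<bar>g x\<bar> \<le> c"
    using limg AE_space
  proof eventually_elim
    case (elim x)
    show ?case by (rule LIMSEQ_le_const2[OF tendsto_rabs[OF elim(1)]]) (use Pc[OF s elim(2)] in auto)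
  qed
  define a where "a t = (\<integral>x. (P t u x)\<^sup>2 \<partial>\<pi>)" for t
  have anti: "a (t + t') \<le> a t'" if "0 < t" "0 < t'" for t t'
  proof -
    have "a (t + t') = (\<integral>x. (P t (P t' u) x)\<^sup>2 \<partial>\<pi>)"
      unfolding a_def by (rule Bochner_Integration.integral_cong) (auto simp: P_semigroup[OF that u])
    then show ?thesis using P_L2[OF that(1) PB[OF that(2)]] by (simp add: a_def)
  qed
  \<comment> \<open>Squares are Lipschitz on bounded functions, so \<open>L\<^sup>1\<close> convergence carries over to \<open>L\<^sup>2\<close> norms.\<close>
  have sq: "(\<lambda>n. \<integral>x. (y n x)\<^sup>2 \<partial>\<pi>) \<longlonglongrightarrow> (\<integral>x. (z x)\<^sup>2 \<partial>\<pi>)"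
    if y: "\<And>n. y n \<in> Bb \<pi>" "\<And>n x. x \<in> space \<pi> \<Longrightarrow> \<bar>y n x\<bar> \<le> c" and z: "z \<in> Bb \<pi>" "AE x in \<pi>. \<bar>z x\<bar> \<le> c"
      and l: "(\<lambda>n. \<integral>x. \<bar>y n x - z x\<bar> \<partial>\<pi>) \<longlonglongrightarrow> 0" for y z
  proof (rule LIM_zero_cancel, rule tendsto_rabs_zero_cancel, rule tendsto_sandwich)
    show "\<forall>\<^sub>F n in sequentially. 0 \<le> \<bar>(\<integral>x. (y n x)\<^sup>2 \<partial>\<pi>) - (\<integral>x. (z x)\<^sup>2 \<partial>\<pi>)\<bar>" by simp
    show "\<forall>\<^sub>F n in sequentially. \<bar>(\<integral>x. (y n x)\<^sup>2 \<partial>\<pi>) - (\<integral>x. (z x)\<^sup>2 \<partial>\<pi>)\<bar> \<le> 2 * c * (\<integral>x. \<bar>y n x - z x\<bar> \<partial>\<pi>)"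
    proof (rule always_eventually, rule allI)
      fix n
      have i: "integrable \<pi> (\<lambda>x. (y n x)\<^sup>2)" "integrable \<pi> (\<lambda>x. (z x)\<^sup>2)"
        by (intro integrable_pi Bb_intros y z)+
      have "\<bar>(\<integral>x. (y n x)\<^sup>2 \<partial>\<pi>) - (\<integral>x. (z x)\<^sup>2 \<partial>\<pi>)\<bar> = \<bar>\<integral>x. (y n x)\<^sup>2 - (z x)\<^sup>2 \<partial>\<pi>\<bar>"
        using i by simp
      also have "\<dots> \<le> (\<integral>x. \<bar>(y n x)\<^sup>2 - (z x)\<^sup>2\<bar> \<partial>\<pi>)" by (rule integral_abs_bound)
      also have "\<dots> \<le> (\<integral>x. 2 * c * \<bar>y n x - z x\<bar> \<partial>\<pi>)"
      proof (rule integral_mono_AE)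
        show "integrable \<pi> (\<lambda>x. \<bar>(y n x)\<^sup>2 - (z x)\<^sup>2\<bar>)" "integrable \<pi> (\<lambda>x. 2 * c * \<bar>y n x - z x\<bar>)"
          by (intro integrable_pi Bb_intros y z)+
        show "AE x in \<pi>. \<bar>(y n x)\<^sup>2 - (z x)\<^sup>2\<bar> \<le> 2 * c * \<bar>y n x - z x\<bar>"
          using z(2) AE_space
        proof eventually_elim
          case (elim x)
          have "\<bar>y n x + z x\<bar> \<le> 2 * c" using y(2)[OF elim(2), of n] elim(1) by linarith
          then have "\<bar>y n x + z x\<bar> * \<bar>y n x - z x\<bar> \<le> 2 * c * \<bar>y n x - z x\<bar>" by (rule mult_right_mono) simp
          then show ?case by (simp add: abs_mult[symmetric] power2_eq_square algebra_simps)
        qed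
      qed
      finally show "\<bar>(\<integral>x. (y n x)\<^sup>2 \<partial>\<pi>) - (\<integral>x. (z x)\<^sup>2 \<partial>\<pi>)\<bar> \<le> 2 * c * (\<integral>x. \<bar>y n x - z x\<bar> \<partial>\<pi>)"
        by simp
    qed
    show "(\<lambda>n. 2 * c * (\<integral>x. \<bar>y n x - z x\<bar> \<partial>\<pi>)) \<longlonglongrightarrow> 0" using tendsto_mult_left[OF l, of "2 * c"] by simp
  qed simp
  have ag: "(\<lambda>n. a (s n)) \<longlonglongrightarrow> (\<integral>x. (g x)\<^sup>2 \<partial>\<pi>)"
    unfolding a_def by (rule sq[OF PB[OF s] Pc[OF s] g gc L1])
  have age: "(\<integral>x. (g x)\<^sup>2 \<partial>\<pi>) \<le> a t" if t: "0 < t" for t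
  proof (rule LIMSEQ_le_const2[OF ag])
    obtain N where N: "t + 1 \<le> s N" using sinf by blast
    have "a (s n) \<le> a t" if "N \<le> n" for n
    proof -
      have "s N \<le> s n" using that strict_mono_less_eq[OF r] by (simp add: s_def)
      then show ?thesis using anti[of "s n - t" t] N t by simp
    qed
    then show "\<exists>N. \<forall>n\<ge>N. a (s n) \<le> a t" by blast
  qed
  have "rigid g"
    unfolding rigid_def
  proof (intro conjI allI impI g)
    fix t :: real assume t: "0 < t"
    have "(\<lambda>n. \<integral>x. \<bar>P t (P (s n) u) x - P t g x\<bar> \<partial>\<pi>) \<longlonglongrightarrow> 0"
      by (rule tendsto_sandwich[OF _ _ tendsto_const L1])
        (auto intro!: always_eventually P_L1 t PB s g)
    then have "(\<lambda>n. \<integral>x. (P t (P (s n) u) x)\<^sup>2 \<partial>\<pi>) \<longlonglongrightarrow> (\<integral>x. (P t g x)\<^sup>2 \<partial>\<pi>)"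
    proof (rule sq[rotated 4])
      show "P t (P (s n) u) \<in> Bb \<pi>" for n by (intro P_Bb t PB s)
      show "\<bar>P t (P (s n) u) x\<bar> \<le> c" if "x \<in> space \<pi>" for n x
        by (rule P_bounded[OF t PB[OF s] Pc[OF s] that])
      show "P t g \<in> Bb \<pi>" by (intro P_Bb t g)
      define g' where "g' x = max (- c) (min c (g x))" for x
      have g': "g' \<in> Bb \<pi>" unfolding g'_def by (intro Bb_intros g)
      have "AE x in \<pi>. g x = g' x" using gc by eventually_elim (auto simp: g'_def)
      from P_cong_AE[OF t g g' this] AE_space
      show "AE x in \<pi>. \<bar>P t g x\<bar> \<le> c"
      proof eventually_elim
        case (elim x)
        have "\<bar>P t g' x\<bar> \<le> c" by (rule P_bounded[OF t g' _ elim(2)]) (use c in \<open>auto simp: g'_def\<close>)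
        then show ?case using elim by simp
      qed
    qed
    moreover have "(\<integral>x. (P t (P (s n) u) x)\<^sup>2 \<partial>\<pi>) = a (t + s n)" for n
      unfolding a_def by (rule Bochner_Integration.integral_cong) (auto simp: P_semigroup[OF t s u])
    ultimately have "(\<lambda>n. a (t + s n)) \<longlonglongrightarrow> (\<integral>x. (P t g x)\<^sup>2 \<partial>\<pi>)" by simp
    then have "(\<integral>x. (g x)\<^sup>2 \<partial>\<pi>) \<le> (\<integral>x. (P t g x)\<^sup>2 \<partial>\<pi>)"
      by (rule LIMSEQ_le_const) (use age add_pos_pos[OF t s] in blast)
    then show "(\<integral>x. (P t g x)\<^sup>2 \<partial>\<pi>) = (\<integral>x. (g x)\<^sup>2 \<partial>\<pi>)" using P_L2[OF t g] by simp
  qed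
  have dec: "(\<integral>x. \<bar>P (t + s n) u x - g x\<bar> \<partial>\<pi>) \<le> (\<integral>x. \<bar>P (s n) u x - g x\<bar> \<partial>\<pi>)" if t: "0 < t" for t n
  proof -
    have "(\<integral>x. \<bar>P (t + s n) u x - g x\<bar> \<partial>\<pi>) = (\<integral>x. \<bar>P t (P (s n) u) x - P t g x\<bar> \<partial>\<pi>)"
    proof (rule integral_cong_AE)
      show "(\<lambda>x. \<bar>P (t + s n) u x - g x\<bar>) \<in> borel_measurable \<pi>"
        by (intro Bb_measurable Bb_intros PB g add_pos_pos t s)
      show "(\<lambda>x. \<bar>P t (P (s n) u) x - P t g x\<bar>) \<in> borel_measurable \<pi>"
        by (intro Bb_measurable Bb_intros P_Bb PB g t s)
      show "AE x in \<pi>. \<bar>P (t + s n) u x - g x\<bar> = \<bar>P t (P (s n) u) x - P t g x\<bar>"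
        using rigid_fixed[OF \<open>rigid g\<close> t t0 ac] AE_space
        by eventually_elim (simp add: P_semigroup[OF t s u])
    qed
    then show ?thesis using P_L1[OF t PB[OF s] g] by simp
  qed
  show ?thesis
  proof (rule bexI[OF _ g], rule tendstoI)
    fix e :: real assume "0 < e"
    then obtain n where n: "(\<integral>x. \<bar>P (s n) u x - g x\<bar> \<partial>\<pi>) < e"
      using order_tendstoD(2)[OF L1] by (auto simp: eventually_sequentially)
    show "\<forall>\<^sub>F t in at_top. dist (\<integral>x. \<bar>P t u x - g x\<bar> \<partial>\<pi>) 0 < e"
      using eventually_gt_at_top[of "s n"]
    proof eventually_elim
      case (elim t)
      then show ?case using dec[of "t - s n" n] n by simp
    qed
  qed
qed

end

section \<open>Semigroups of positive kernels\<close>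

locale kernel_semigroup =
  fixes M :: "'a measure" and K :: "real \<Rightarrow> 'a \<Rightarrow> 'a measure" and c :: real
  assumes c_nonneg: "0 \<le> c"
    and K_finite: "0 < t \<Longrightarrow> x \<in> space M \<Longrightarrow> K t x \<in> finite_measures M"
    and K_measurable: "0 < t \<Longrightarrow> A \<in> sets M \<Longrightarrow> (\<lambda>x. measure (K t x) A) \<in> borel_measurable M"
    and K_bounded: "0 < t \<Longrightarrow> x \<in> space M \<Longrightarrow> measure (K t x) (space M) \<le> c"
    and K_semigroup: "0 < t \<Longrightarrow> 0 < s \<Longrightarrow> A \<in> sets M \<Longrightarrow> x \<in> space M \<Longrightarrow>
      measure (K (t + s) x) A = (\<integral>y. measure (K s y) A \<partial>K t x)"
begin

definition T :: "real \<Rightarrow> ('a \<Rightarrow> real) \<Rightarrow> 'a \<Rightarrow> real" where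
  "T t f x = (\<integral>y. f y \<partial>K t x)"

lemma T_indicator:
  assumes "0 < t" "x \<in> space M" "A \<in> sets M"
  shows "T t (indicator A) x = measure (K t x) A"
  using finite_measuresD[OF K_finite[OF assms(1,2)]] assms(3) sets.sets_into_space
  by (simp add: T_def Int_absorb2)

lemma T_add: "0 < t \<Longrightarrow> x \<in> space M \<Longrightarrow> u \<in> Bb M \<Longrightarrow> v \<in> Bb M \<Longrightarrow> T t (\<lambda>y. u y + v y) x = T t u x + T t v x"
  unfolding T_def by (intro Bochner_Integration.integral_add Bb_integrable[OF K_finite])

lemma T_diff: "0 < t \<Longrightarrow> x \<in> space M \<Longrightarrow> u \<in> Bb M \<Longrightarrow> v \<in> Bb M \<Longrightarrow> T t (\<lambda>y. u y - v y) x = T t u x - T t v x"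
  unfolding T_def by (intro Bochner_Integration.integral_diff Bb_integrable[OF K_finite])

lemma T_scale: "T t (\<lambda>y. a * u y) x = a * T t u x"
  unfolding T_def by simp

lemma T_mono:
  assumes "0 < t" "x \<in> space M" "u \<in> Bb M" "v \<in> Bb M" "\<And>y. y \<in> space M \<Longrightarrow> u y \<le> v y"
  shows "T t u x \<le> T t v x"
  unfolding T_def by (rule Bb_integral_mono[OF K_finite]) (use assms in auto)

lemma T_cong:
  assumes "0 < t" "x \<in> space M" "\<And>y. y \<in> space M \<Longrightarrow> u y = v y"
  shows "T t u x = T t v x"
  unfolding T_def
  by (rule Bochner_Integration.integral_cong) (use assms finite_measuresD(3)[OF K_finite] in auto)

lemma T_nonneg:
  assumes "0 < t" "x \<in> space M" "\<And>y. y \<in> space M \<Longrightarrow> 0 \<le> u y" 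
  shows "0 \<le> T t u x"
  unfolding T_def by (rule integral_nonneg_AE, rule AE_I2)
    (use assms finite_measuresD(3)[OF K_finite] in auto)

lemma T_abs: "0 < t \<Longrightarrow> x \<in> space M \<Longrightarrow> \<bar>T t u x\<bar> \<le> T t (\<lambda>y. \<bar>u y\<bar>) x"
  unfolding T_def by (rule integral_abs_bound)

lemma T_one_le:
  assumes "0 < t" "x \<in> space M" shows "T t (\<lambda>_. 1) x \<le> c"
  using K_bounded[OF assms] finite_measuresD(3)[OF K_finite[OF assms]] by (simp add: T_def)

lemma T_bounded:
  assumes "0 < t" "x \<in> space M" "u \<in> Bb M" "\<And>y. y \<in> space M \<Longrightarrow> \<bar>u y\<bar> \<le> b"
  shows "\<bar>T t u x\<bar> \<le> b * c"
proof -
  have "0 \<le> b" using assms(2,4) by fastforce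
  have "\<bar>T t u x\<bar> \<le> T t (\<lambda>y. \<bar>u y\<bar>) x" by (rule T_abs[OF assms(1,2)])
  also have "\<dots> \<le> T t (\<lambda>y. b * 1) x"
    by (rule T_mono[OF assms(1,2) Bb_abs[OF assms(3)] Bb_const]) (use assms(4) in simp)
  also have "\<dots> = b * T t (\<lambda>_. 1) x" by (rule T_scale)
  also have "\<dots> \<le> b * c" by (rule mult_left_mono[OF T_one_le[OF assms(1,2)] \<open>0 \<le> b\<close>])
  finally show ?thesis .
qed

lemma T_tendsto:
  assumes "0 < t" "x \<in> space M" "\<And>n. u n \<in> Bb M" "\<And>n y. y \<in> space M \<Longrightarrow> \<bar>u n y\<bar> \<le> b"
    "\<And>y. y \<in> space M \<Longrightarrow> (\<lambda>n. u n y) \<longlonglongrightarrow> v y"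
  shows "(\<lambda>n. T t (u n) x) \<longlonglongrightarrow> T t v x"
  unfolding T_def
proof (rule Bb_dominated_convergence[OF K_finite[OF assms(1,2)] assms(3) assms(4)])
  show "AE y in K t x. (\<lambda>n. u n y) \<longlonglongrightarrow> v y"
    by (rule AE_I2) (simp add: assms(5) finite_measuresD(3)[OF K_finite[OF assms(1,2)]])
  show "v \<in> Bb M" by (rule Bb_limit[OF assms(3,4,5)])
qed

lemma T_Bb:
  assumes t: "0 < t" and u: "u \<in> Bb M"
  shows "T t u \<in> Bb M"
proof -
  obtain b where b: "\<And>x. x \<in> space M \<Longrightarrow> \<bar>u x\<bar> \<le> b" using BbE[OF u] by blast
  have "T t u \<in> borel_measurable M"
    using u
  proof (induction rule: Bb_induct)
    case (indicator A)
    then show ?case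
      by (subst measurable_cong[OF T_indicator[OF t]]) (auto intro: K_measurable t)
  next
    case (add u v)
    then show ?case
      by (subst measurable_cong[OF T_add[OF t]]) auto
  next
    case (scale u a)
    then show ?case by (simp add: T_scale[abs_def])
  next
    case (limit U u c)
    show ?case
      by (rule borel_measurable_LIMSEQ_real[OF T_tendsto[OF t _ limit.hyps(1,2,3)] limit.IH])
  qed
  then show ?thesis by (rule BbI[OF _ T_bounded[OF t _ u b]])
qed

lemma T_semigroup:
  assumes t: "0 < t" and s: "0 < s" and u: "u \<in> Bb M" and x: "x \<in> space M"
  shows "T (t + s) u x = T t (T s u) x"
  using u
proof (induction rule: Bb_induct)
  case (indicator A)
  have "T (t + s) (indicator A) x = (\<integral>y. measure (K s y) A \<partial>K t x)"
    using T_indicator[OF _ x indicator, of "t + s"] K_semigroup[OF t s indicator x] t s by simp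
  also have "\<dots> = T t (\<lambda>y. measure (K s y) A) x" by (simp add: T_def)
  also have "\<dots> = T t (T s (indicator A)) x"
    by (rule T_cong[OF t x]) (simp add: T_indicator[OF s _ indicator])
  finally show ?case .
next
  case (add u v)
  have "T t (T s (\<lambda>x. u x + v x)) x = T t (\<lambda>y. T s u y + T s v y) x"
    by (rule T_cong[OF t x]) (rule T_add[OF s _ add.hyps])
  also have "\<dots> = T t (T s u) x + T t (T s v) x"
    by (rule T_add[OF t x]) (intro T_Bb s add.hyps)+
  finally show ?case using T_add[OF _ x add.hyps, of "t + s"] t s add.IH by simp
next
  case (scale u a)
  then show ?case by (simp add: T_scale[abs_def])
next
  case (limit U u b)
  have "(\<lambda>n. T (t + s) (U n) x) \<longlonglongrightarrow> T (t + s) u x"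
    by (rule T_tendsto[OF _ x limit.hyps(1,2,3)]) (use t s in auto)
  moreover have "(\<lambda>n. T t (T s (U n)) x) \<longlonglongrightarrow> T t (T s u) x"
    by (rule T_tendsto[OF t x T_Bb[OF s limit.hyps(1)] T_bounded[OF s _ limit.hyps(1,2)] T_tendsto[OF s _ limit.hyps(1,2,3)]])
  ultimately show ?case using limit.IH by (simp add: LIMSEQ_unique)
qed

text \<open>
  The adjoint of \<open>T t\<close> acts on measures; restricting the image to \<open>C\<close> is needed to isolate the mass that has
  arrived in the support of an invariant measure.
\<close>

lemma pushforward:
  assumes N: "N \<in> finite_measures M" and t: "0 < t" and C: "C \<in> sets M"
  obtains Q where "Q \<in> finite_measures M" "\<And>u. u \<in> Bb M \<Longrightarrow> (\<integral>x. u x \<partial>Q) = (\<integral>x. T t (\<lambda>y. indicator C y * u y) x \<partial>N)"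
proof -
  note Ns = finite_measuresD[OF N]
  define L where "L u = (\<integral>x. T t (\<lambda>y. indicator C y * u y) x \<partial>N)" for u
  have cu: "(\<lambda>y. indicator C y * u y) \<in> Bb M" if "u \<in> Bb M" for u by (intro Bb_mult Bb_indicator C that)
  have L_add: "L (\<lambda>x. u x + v x) = L u + L v" if u: "u \<in> Bb M" and v: "v \<in> Bb M" for u v
  proof -
    have "L (\<lambda>x. u x + v x) = (\<integral>x. T t (\<lambda>y. indicator C y * u y) x + T t (\<lambda>y. indicator C y * v y) x \<partial>N)"
      unfolding L_def
      by (rule Bochner_Integration.integral_cong)
        (use T_add[OF t _ cu[OF u] cu[OF v]] Ns in \<open>auto simp: distrib_left\<close>)
    also have "\<dots> = L u + L v"
      unfolding L_def by (intro Bochner_Integration.integral_add Bb_integrable[OF N] T_Bb t cu u v)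
    finally show ?thesis .
  qed
  have L_lim: "(\<lambda>n. L (U n)) \<longlonglongrightarrow> L u"
    if U: "\<And>n. U n \<in> Bb M" "\<And>n x. x \<in> space M \<Longrightarrow> \<bar>U n x\<bar> \<le> b" "\<And>x. x \<in> space M \<Longrightarrow> (\<lambda>n. U n x) \<longlonglongrightarrow> u x"
      and u: "u \<in> Bb M" for U u b
  proof -
    have b: "\<bar>indicator C x * U n x\<bar> \<le> b" if "x \<in> space M" for n x
      using U(2)[OF that, of n] by (auto simp: indicator_def)
    show ?thesis
      unfolding L_def
    proof (rule Bb_dominated_convergence[OF N T_Bb[OF t cu[OF U(1)]] T_bounded[OF t _ cu[OF U(1)] b] _ T_Bb[OF t cu[OF u]]])
      show "AE x in N. (\<lambda>n. T t (\<lambda>y. indicator C y * U n y) x) \<longlonglongrightarrow> T t (\<lambda>y. indicator C y * u y) x"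
      proof (rule AE_I2)
        fix x assume "x \<in> space N"
        then have x: "x \<in> space M" using Ns by simp
        show "(\<lambda>n. T t (\<lambda>y. indicator C y * U n y) x) \<longlonglongrightarrow> T t (\<lambda>y. indicator C y * u y) x"
          by (rule T_tendsto[OF t x cu[OF U(1)] b]) (assumption, intro tendsto_mult_left U(3))
      qed
    qed
  qed
  have "\<exists>Q\<in>finite_measures M. \<forall>A\<in>sets M. measure Q A = L (indicator A)"
  proof (rule finite_measure_exists)
    show "0 \<le> L (indicator A)" for A
      unfolding L_def
      by (intro integral_nonneg_AE AE_I2 T_nonneg[OF t]) (auto simp: Ns)
    show "L (indicator (A \<union> B)) = L (indicator A) + L (indicator B)"
      if "A \<in> sets M" "B \<in> sets M" "A \<inter> B = {}" for A B
    proof -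
      have "(indicator (A \<union> B) :: 'a \<Rightarrow> real) = (\<lambda>x. indicator A x + indicator B x)"
        using that(3) by (auto simp: fun_eq_iff indicator_def)
      then show ?thesis using L_add[OF Bb_indicator[OF that(1)] Bb_indicator[OF that(2)]] by simp
    qed
    fix A :: "nat \<Rightarrow> 'a set" assume A: "\<And>n. A n \<in> sets M" "decseq A" "(\<Inter>n. A n) = {}"
    have "(\<lambda>n. L (indicator (A n))) \<longlonglongrightarrow> L (\<lambda>_. 0)"
    proof (rule L_lim[OF Bb_indicator[OF A(1)]])
      show "\<bar>indicator (A n) x\<bar> \<le> (1::real)" for n x by (simp add: indicator_def)
      show "(\<lambda>n. indicator (A n) x :: real) \<longlonglongrightarrow> 0" for x
        using LIMSEQ_indicator_decseq[OF A(2), of x] by (simp add: A(3))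
    qed (rule Bb_const)
    then show "(\<lambda>n. L (indicator (A n))) \<longlonglongrightarrow> 0" by (simp add: L_def T_def)
  qed
  then obtain Q where Q: "Q \<in> finite_measures M" "\<And>A. A \<in> sets M \<Longrightarrow> measure Q A = L (indicator A)" by blast
  note Qs = finite_measuresD[OF Q(1)]
  have "(\<integral>x. u x \<partial>Q) = L u" if "u \<in> Bb M" for u
    using that
  proof (induction rule: Bb_induct)
    case (indicator A)
    then show ?case using Q(2) Qs by (simp add: Int_absorb2 sets.sets_into_space)
  next
    case (add u v)
    then show ?case
      using Bb_integrable[OF Q(1) add.hyps(1)] Bb_integrable[OF Q(1) add.hyps(2)] L_add[OF add.hyps] by simp
  next
    case (scale u a)
    have "L (\<lambda>x. a * u x) = a * L u"
      unfolding L_def by (simp add: mult.left_commute[of _ a] T_scale[abs_def])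
    then show ?case using scale.IH by simp
  next
    case (limit U u b)
    have "(\<lambda>n. \<integral>x. U n x \<partial>Q) \<longlonglongrightarrow> (\<integral>x. u x \<partial>Q)"
      by (rule Bb_dominated_convergence[OF Q(1) limit.hyps(1,2) _ limit.hyps(4)])
        (auto intro!: AE_I2 limit.hyps(3) simp: Qs)
    moreover have "(\<lambda>n. L (U n)) \<longlonglongrightarrow> L u" by (rule L_lim[OF limit.hyps(1,2,3,4)])
    ultimately show ?case using limit.IH LIMSEQ_unique by auto
  qed
  then show ?thesis using that Q(1) unfolding L_def by blast
qed

lemma adjoint:
  assumes N: "N \<in> finite_measures M" and t: "0 < t"
  obtains Q where "Q \<in> finite_measures M" "\<And>u. u \<in> Bb M \<Longrightarrow> (\<integral>x. u x \<partial>Q) = (\<integral>x. T t u x \<partial>N)"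
    "\<And>A. A \<in> sets M \<Longrightarrow> measure Q A = (\<integral>x. T t (indicator A) x \<partial>N)"
proof -
  obtain Q where Q: "Q \<in> finite_measures M"
    "\<And>u. u \<in> Bb M \<Longrightarrow> (\<integral>x. u x \<partial>Q) = (\<integral>x. T t (\<lambda>y. indicator (space M) y * u y) x \<partial>N)"
    by (rule pushforward[OF N t sets.top]) blast
  have eq: "(\<integral>x. u x \<partial>Q) = (\<integral>x. T t u x \<partial>N)" if "u \<in> Bb M" for u
    unfolding Q(2)[OF that]
    by (rule Bochner_Integration.integral_cong[OF refl], rule T_cong[OF t])
      (auto simp: finite_measuresD(3)[OF N])
  have "measure Q A = (\<integral>x. T t (indicator A) x \<partial>N)" if "A \<in> sets M" for A
    using eq[OF Bb_indicator[OF that]] that finite_measuresD[OF Q(1)]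
    by (simp add: Int_absorb2 sets.sets_into_space)
  then show ?thesis using that[OF Q(1) eq] by blast
qed

definition invariant :: "'a measure \<Rightarrow> bool" where
  "invariant N \<longleftrightarrow> N \<in> finite_measures M \<and> (\<forall>t>0. \<forall>A\<in>sets M. (\<integral>x. T t (indicator A) x \<partial>N) = measure N A)"

lemma invariant_integral:
  assumes N: "invariant N" and t: "0 < t" and u: "u \<in> Bb M"
  shows "(\<integral>x. T t u x \<partial>N) = (\<integral>x. u x \<partial>N)"
proof -
  have Nf: "N \<in> finite_measures M" using N by (simp add: invariant_def)
  obtain Q where Q: "Q \<in> finite_measures M" "\<And>u. u \<in> Bb M \<Longrightarrow> (\<integral>x. u x \<partial>Q) = (\<integral>x. T t u x \<partial>N)"
    "\<And>A. A \<in> sets M \<Longrightarrow> measure Q A = (\<integral>x. T t (indicator A) x \<partial>N)"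
    by (rule adjoint[OF Nf t]) blast
  have "Q = N"
  proof (rule measure_eqI)
    show "emeasure Q A = emeasure N A" if "A \<in> sets Q" for A
      using that Q(3) N t finite_measuresD(2)[OF Q(1)]
      by (simp add: emeasure_finite_measures[OF Q(1)] emeasure_finite_measures[OF Nf] invariant_def)
  qed (simp add: finite_measuresD(2)[OF Q(1)] finite_measuresD(2)[OF Nf])
  then show ?thesis using Q(2)[OF u] by simp
qed

lemma invariant_L1:
  assumes N: "invariant N" and t: "0 < t" and u: "u \<in> Bb M" and v: "v \<in> Bb M"
  shows "(\<integral>x. \<bar>T t u x - T t v x\<bar> \<partial>N) \<le> (\<integral>x. \<bar>u x - v x\<bar> \<partial>N)"
proof -
  have Nf: "N \<in> finite_measures M" using N by (simp add: invariant_def)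
  have d: "(\<lambda>x. u x - v x) \<in> Bb M" "(\<lambda>x. \<bar>u x - v x\<bar>) \<in> Bb M" by (intro Bb_intros u v)+
  have "(\<integral>x. \<bar>T t u x - T t v x\<bar> \<partial>N) \<le> (\<integral>x. T t (\<lambda>y. \<bar>u y - v y\<bar>) x \<partial>N)"
  proof (rule Bb_integral_mono[OF Nf])
    show "(\<lambda>x. \<bar>T t u x - T t v x\<bar>) \<in> Bb M" by (intro Bb_intros T_Bb t u v)
    show "T t (\<lambda>y. \<bar>u y - v y\<bar>) \<in> Bb M" by (intro T_Bb t d)
    show "\<bar>T t u x - T t v x\<bar> \<le> T t (\<lambda>y. \<bar>u y - v y\<bar>) x" if "x \<in> space M" for x
      using T_abs[OF t that, of "\<lambda>y. u y - v y"] T_diff[OF t that u v] by simp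
  qed
  then show ?thesis using invariant_integral[OF N t d(2)] by simp
qed

definition fixed :: "('a \<Rightarrow> real) \<Rightarrow> bool" where
  "fixed f \<longleftrightarrow> f \<in> Bb M \<and> (\<forall>t>0. \<forall>x\<in>space M. T t f x = f x)"

end

locale abs_cont_kernel_semigroup = kernel_semigroup +
  fixes \<mu> :: "'a measure" and t0 :: real
  assumes cg: "countably_generated M"
    and mu: "\<mu> \<in> finite_measures M"
    and t0: "0 < t0"
    and K_t0: "x \<in> space M \<Longrightarrow> absolutely_continuous \<mu> (K t0 x)"
begin

text \<open>
  Later times inherit the absolute continuity from time \<open>t0\<close> since \<open>T t = T (t - t0) (T t0)\<close>.
\<close>

lemma T_null:
  assumes t: "t0 \<le> t" and A: "A \<in> sets M" "measure \<mu> A = 0" and x: "x \<in> space M"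
  shows "T t (indicator A) x = 0"
proof -
  have *: "T t0 (indicator A) y = 0" if y: "y \<in> space M" for y
    using K_t0[OF y] A absolutely_continuous_iff[OF mu K_finite[OF t0 y]] T_indicator[OF t0 y A(1)] by simp
  show ?thesis
  proof (cases "t = t0")
    case False
    then have s: "0 < t - t0" using t by simp
    have "T t (indicator A) x = T (t - t0) (T t0 (indicator A)) x"
      using T_semigroup[OF s t0 Bb_indicator[OF A(1)] x] by simp
    also have "\<dots> = T (t - t0) (\<lambda>_. 0) x" by (rule T_cong[OF s x *])
    also have "\<dots> = 0" by (simp add: T_def)
    finally show ?thesis .
  qed (use * x in simp)
qed

lemma K_abs_cont: 
  assumes "t0 \<le> t" "x \<in> space M" shows "absolutely_continuous \<mu> (K t x)"
proof -
  have t: "0 < t" using assms(1) t0 by simp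
  show ?thesis
    unfolding absolutely_continuous_iff[OF mu K_finite[OF t assms(2)]]
    using T_null[OF assms(1) _ _ assms(2)] T_indicator[OF t assms(2)] by simp
qed

lemma T_mono_AE:
  assumes t: "t0 \<le> t" and x: "x \<in> space M" and u: "u \<in> Bb M" and v: "v \<in> Bb M"
    and ae: "AE y in \<mu>. u y \<le> v y"
  shows "T t u x \<le> T t v x"
proof -
  have tp: "0 < t" using t t0 by simp
  have "AE y in K t x. u y \<le> v y"
    by (rule absolutely_continuous_AE[OF _ K_abs_cont[OF t x] ae])
      (simp add: finite_measuresD(2)[OF K_finite[OF tp x]] finite_measuresD(2)[OF mu])
  then show ?thesis unfolding T_def
    by (intro integral_mono_AE Bb_integrable[OF K_finite[OF tp x]] u v)
qed

text \<open>
  Since \<open>K t0 x\<close> has a density with respect to \<open>\<mu>\<close>, weak-star convergence in \<open>L\<^sup>\<infinity>(\<mu>)\<close> becomes pointwise convergence,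
  at every single point, after applying \<open>T t0\<close>. The weight \<open>w\<close> allows for the passage to \<open>T t0 (f u) / f\<close>.
\<close>

lemma T_compactness:
  assumes u: "\<And>n::nat. u n \<in> Bb M" "\<And>n x. x \<in> space M \<Longrightarrow> \<bar>u n x\<bar> \<le> b"
  obtains r v where "strict_mono (r :: nat \<Rightarrow> nat)" "v \<in> Bb M"
    "\<And>w x. w \<in> Bb M \<Longrightarrow> x \<in> space M \<Longrightarrow>
      (\<lambda>n. T t0 (\<lambda>y. w y * u (r n) y) x) \<longlonglongrightarrow> T t0 (\<lambda>y. w y * v y) x"
proof -
  obtain r v where r: "strict_mono (r :: nat \<Rightarrow> nat)" and v: "v \<in> Bb M"
    and lim: "\<And>h. integrable \<mu> h \<Longrightarrow> (\<lambda>n. \<integral>x. h x * u (r n) x \<partial>\<mu>) \<longlonglongrightarrow> (\<integral>x. h x * v x \<partial>\<mu>)"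
    by (rule weak_star_compactness[OF cg mu, of u b, OF u]) (assumption, rule that, assumption, assumption, blast)
  have "(\<lambda>n. T t0 (\<lambda>y. w y * u (r n) y) x) \<longlonglongrightarrow> T t0 (\<lambda>y. w y * v y) x"
    if w: "w \<in> Bb M" and x: "x \<in> space M" for w x
  proof -
    obtain D where D: "integrable \<mu> D" "\<And>u. u \<in> Bb M \<Longrightarrow> (\<integral>y. u y \<partial>K t0 x) = (\<integral>y. D y * u y \<partial>\<mu>)"
      by (rule real_density[OF mu K_finite[OF t0 x] K_t0[OF x]]) blast
    have "(\<lambda>n. \<integral>y. D y * w y * u (r n) y \<partial>\<mu>) \<longlonglongrightarrow> (\<integral>y. D y * w y * v y \<partial>\<mu>)"
      by (rule lim) (rule integrable_mult_Bb[OF mu D(1) w])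
    then show ?thesis
      unfolding T_def using D(2)[OF Bb_mult[OF w u(1)]] D(2)[OF Bb_mult[OF w v]] by (simp add: mult.assoc)
  qed
  then show ?thesis using that[OF r v] by blast
qed

text \<open>
  The essential suprema \<open>F m\<close> of the orbit after time \<open>m\<close> are attained along countably many times.
  They decrease in \<open>m\<close>; let \<open>F\<^sub>\<infinity>\<close> be their limit, which is called \<open>H\<close> in the proof.
  Since \<open>T r\<close> respects \<open>\<mu>\<close>-null sets for \<open>r \<ge> t0\<close>, it satisfies
  \<open>F\<^sub>\<infinity> \<le> T r F\<^sub>\<infinity>\<close> for such \<open>r\<close>, so \<open>T r F\<^sub>\<infinity>\<close> increases to a fixed function as \<open>r \<rightarrow> \<infinity>\<close>.
\<close>

lemma dominating_fixed_function:
  assumes g: "g \<in> Bb M" "\<And>x. x \<in> space M \<Longrightarrow> 0 \<le> g x"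
  obtains f e b where "fixed f" "\<And>x. x \<in> space M \<Longrightarrow> 0 \<le> f x"
    "\<And>m::nat. e m \<in> Bb M" "\<And>m x. x \<in> space M \<Longrightarrow> 0 \<le> e m x \<and> e m x \<le> b"
    "\<And>x. x \<in> space M \<Longrightarrow> (\<lambda>m. e m x) \<longlonglongrightarrow> 0"
    "\<And>m t x. t0 + real (Suc m) \<le> t \<Longrightarrow> x \<in> space M \<Longrightarrow> T t g x \<le> f x + e m x"
    "\<And>N. invariant N \<Longrightarrow> (\<integral>x. g x \<partial>N) = 0 \<Longrightarrow> (\<integral>x. f x \<partial>N) = 0"
proof -
  obtain b0 where b0: "0 \<le> b0" "\<And>x. x \<in> space M \<Longrightarrow> \<bar>g x\<bar> \<le> b0" using BbE[OF g(1)] by blast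
  define b where "b = b0 * c"
  have b: "0 \<le> b" using b0 c_nonneg by (simp add: b_def)
  have Tg: "T t g \<in> Bb M" if "0 < t" for t by (rule T_Bb[OF that g(1)])
  have Tgb: "0 \<le> T t g x" "T t g x \<le> b" if "0 < t" "x \<in> space M" for t x
    using T_nonneg[OF that g(2)] T_bounded[OF that g(1) b0(2)] by (auto simp: b_def)
  define I where "I m = {t. real (Suc m) \<le> t}" for m
  have Ipos: "0 < t" if "t \<in> I m" for t m using that by (simp add: I_def)
  define G where "G q t = {x \<in> space M. real_of_rat q < T t g x}" for q t
  have Gs: "G q t \<in> sets M" if "0 < t" for q t
    unfolding G_def using Bb_measurable[OF Tg[OF that]] by measurable
  have "\<exists>J. countable J \<and> J \<subseteq> I m \<and> (\<forall>t\<in>I m. measure \<mu> (G q t - (\<Union>j\<in>J. G q j)) = 0)" for m q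
    using countable_exhaustion[OF mu, of "I m" "G q"] Gs Ipos by metis
  then obtain J where J: "\<And>m q. countable (J m q)" "\<And>m q. J m q \<subseteq> I m"
    "\<And>m q t. t \<in> I m \<Longrightarrow> measure \<mu> (G q t - (\<Union>j\<in>J m q. G q j)) = 0" by metis
  \<comment> \<open>The extra time keeps \<open>D m\<close> nonempty, and the union over \<open>k \<ge> m\<close> makes it decreasing in \<open>m\<close>.\<close>
  define D where "D m = (\<Union>k\<in>{m..}. insert (real (Suc k)) (\<Union>q. J k q))" for m
  have Dc: "countable (D m)" for m unfolding D_def using J(1) by auto
  have DI: "D m \<subseteq> I m" for m
    unfolding D_def using J(2) by (fastforce simp: I_def)
  have Dne: "D m \<noteq> {}" for m by (auto simp: D_def)
  have Dmono: "D m' \<subseteq> D m" if "m \<le> m'" for m m'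
    unfolding D_def using that by (intro UN_mono) auto
  have Dpos: "0 < t" if "t \<in> D m" for t m using that DI Ipos by blast
  define F where "F m x = (SUP t\<in>D m. T t g x)" for m x
  have bdd: "bdd_above ((\<lambda>t. T t g x) ` D m)" if "x \<in> space M" for m x
    using Tgb[OF Dpos that] by (auto intro!: bdd_aboveI)
  have Fub: "T t g x \<le> F m x" if "t \<in> D m" "x \<in> space M" for t m x
    unfolding F_def by (rule cSUP_upper[OF that(1) bdd[OF that(2)]])
  have Flb: "F m x \<le> y" if "\<And>t. t \<in> D m \<Longrightarrow> T t g x \<le> y" for m x y
    unfolding F_def by (rule cSUP_least[OF Dne that])
  have Fb: "0 \<le> F m x" "F m x \<le> b" if x: "x \<in> space M" for m x
  proof -
    show "F m x \<le> b" by (rule Flb) (use Tgb(2)[OF Dpos x] in blast)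
    obtain t where t: "t \<in> D m" using Dne by blast
    show "0 \<le> F m x" using Tgb(1)[OF Dpos[OF t] x] Fub[OF t x] by linarith
  qed
  have Fabs: "\<bar>F m x\<bar> \<le> b" if x: "x \<in> space M" for m x using Fb[OF x, of m] by simp
  have F: "F m \<in> Bb M" for m
  proof (rule BbI[OF _ Fabs])
    show "F m \<in> borel_measurable M"
      unfolding F_def[abs_def]
    proof (rule borel_measurable_cSUP[OF Dc])
      show "T t g \<in> borel_measurable M" if "t \<in> D m" for t
        by (rule Bb_measurable[OF Tg[OF Dpos[OF that]]])
      show "bdd_above ((\<lambda>t. T t g x) ` D m)" if "x \<in> space M" for x by (rule bdd[OF that])
    qed
  qed
  have Fdec: "F m' x \<le> F m x" if "m \<le> m'" "x \<in> space M" for m m' x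
    by (rule Flb) (use Fub[OF _ that(2)] Dmono[OF that(1)] in blast)
  have ess: "AE x in \<mu>. T t g x \<le> F m x" if t: "t \<in> I m" for t m
  proof -
    have "AE x in \<mu>. \<forall>q. x \<notin> G q t - (\<Union>j\<in>J m q. G q j)"
      unfolding AE_all_countable
    proof
      fix q
      have "(\<Union>j\<in>J m q. G q j) \<in> sets M"
        using J(1,2) Gs Ipos by (intro sets.countable_UN'') blast+
      then have "G q t - (\<Union>j\<in>J m q. G q j) \<in> null_sets \<mu>"
        using J(3)[OF t] Gs[OF Ipos[OF t]] by (subst null_iff[OF mu]) auto
      then show "AE x in \<mu>. x \<notin> G q t - (\<Union>j\<in>J m q. G q j)" by (rule AE_not_in)
    qed
    then show ?thesis
      using AE_space
    proof eventually_elim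
      case (elim x)
      have x: "x \<in> space M" using elim(2) finite_measuresD(3)[OF mu] by simp
      show ?case
      proof (rule ccontr)
        assume "\<not> T t g x \<le> F m x"
        then obtain q where q: "F m x < of_rat q" "of_rat q < T t g x" using of_rat_dense not_le by metis
        then have "x \<in> G q t" using x by (simp add: G_def)
        then obtain j where j: "j \<in> J m q" "x \<in> G q j" using elim(1) by blast
        then have "j \<in> D m" by (auto simp: D_def)
        then show False using Fub[of j m x] x j(2) q(1) by (simp add: G_def)
      qed
    qed
  qed
  have TF: "F m' x \<le> T r (F m) x" if r: "t0 \<le> r" and m': "real m + r \<le> real m'" and x: "x \<in> space M" for m m' r x
  proof (rule Flb)
    fix t assume "t \<in> D m'"
    then have t: "real (Suc m') \<le> t" using DI by (auto simp: I_def)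
    then have I: "t - r \<in> I m" using m' by (simp add: I_def)
    have "T t g x = T r (T (t - r) g) x"
      using T_semigroup[OF _ Ipos[OF I] g(1) x, of r] r t0 by simp
    also have "\<dots> \<le> T r (F m) x"
      by (rule T_mono_AE[OF r x Tg[OF Ipos[OF I]] F ess[OF I]])
    finally show "T t g x \<le> T r (F m) x" .
  qed
  define H where "H x = lim (\<lambda>m. F m x)" for x
  have Hlim: "(\<lambda>m. F m x) \<longlonglongrightarrow> H x" and HF: "H x \<le> F m x" if x: "x \<in> space M" for m x
  proof -
    have d: "decseq (\<lambda>m. F m x)" using Fdec[OF _ x] by (auto simp: decseq_def)
    then obtain L where L: "(\<lambda>m. F m x) \<longlonglongrightarrow> L" "\<forall>m. L \<le> F m x"
      by (rule decseq_convergent[of _ 0]) (use Fb[OF x] in auto)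
    moreover have "H x = L" unfolding H_def by (rule limI[OF L(1)])
    ultimately show "(\<lambda>m. F m x) \<longlonglongrightarrow> H x" "H x \<le> F m x" by auto
  qed
  have H: "H \<in> Bb M" by (rule Bb_limit[OF F Fabs Hlim])
  have Hb: "\<bar>H x\<bar> \<le> b" "0 \<le> H x" if x: "x \<in> space M" for x
    using tendsto_rabs[OF Hlim[OF x]] Fabs[OF x] Hlim[OF x] Fb[OF x]
    by (auto intro: LIMSEQ_le_const2 LIMSEQ_le_const)
  have TFlim: "(\<lambda>m. T r (F m) x) \<longlonglongrightarrow> T r H x" if "0 < r" "x \<in> space M" for r x
    by (rule T_tendsto[OF that F Fabs Hlim])
  have TH: "H x \<le> T r H x" if r: "t0 \<le> r" and x: "x \<in> space M" for r x
  proof (rule LIMSEQ_le_const[OF TFlim[OF _ x]])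
    show "0 < r" using r t0 by simp
    have "H x \<le> T r (F m) x" for m
    proof -
      obtain m' :: nat where "real m + r \<le> real m'" using real_arch_simple by blast
      from TF[OF r this x] HF[OF x, of m'] show ?thesis by linarith
    qed
    then show "\<exists>N. \<forall>m\<ge>N. H x \<le> T r (F m) x" by blast
  qed
  have THmono: "T r H x \<le> T r' H x" if r: "0 < r" and r': "r + t0 \<le> r'" and x: "x \<in> space M" for r r' x
  proof -
    have s: "t0 \<le> r' - r" "0 < r' - r" using r' t0 by simp_all
    have "T r H x \<le> T r (T (r' - r) H) x"
      by (rule T_mono[OF r x H T_Bb[OF s(2) H] TH[OF s(1)]])
    also have "\<dots> = T r' H x" using T_semigroup[OF r s(2) H x] by simp
    finally show ?thesis .
  qed
  \<comment> \<open>\<open>T r H\<close> is known to increase only over time steps of length at least \<open>t0\<close>.\<close>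
  define \<tau> where "\<tau> n = real (Suc n) * t0" for n
  have \<tau>: "0 < \<tau> n" for n using t0 by (simp add: \<tau>_def)
  define f where "f x = lim (\<lambda>n. T (\<tau> n) H x)" for x
  have THb: "\<bar>T r H x\<bar> \<le> b * c" if "0 < r" "x \<in> space M" for r x
    by (rule T_bounded[OF that H Hb(1)])
  have flim: "(\<lambda>n. T (\<tau> n) H x) \<longlonglongrightarrow> f x" and Hf: "T (\<tau> n) H x \<le> f x" if x: "x \<in> space M" for x n
  proof -
    have i: "incseq (\<lambda>n. T (\<tau> n) H x)"
      by (rule incseq_SucI, rule THmono[OF \<tau> _ x]) (simp add: \<tau>_def algebra_simps)
    then obtain L where L: "(\<lambda>n. T (\<tau> n) H x) \<longlonglongrightarrow> L" "\<forall>n. T (\<tau> n) H x \<le> L"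
      by (rule incseq_convergent[of _ "b * c"]) (use THb[OF \<tau> x] abs_le_D1 in blast)
    moreover have "f x = L" unfolding f_def by (rule limI[OF L(1)])
    ultimately show "(\<lambda>n. T (\<tau> n) H x) \<longlonglongrightarrow> f x" "T (\<tau> n) H x \<le> f x" by auto
  qed
  have f: "f \<in> Bb M" by (rule Bb_limit[OF T_Bb[OF \<tau> H] THb[OF \<tau>] flim])
  have fpos: "0 \<le> f x" if x: "x \<in> space M" for x
    using order_trans[OF T_nonneg[OF \<tau>[of 0] x, of H, OF Hb(2)] Hf[OF x, of 0]] by simp
  have "T s f x = f x" if s: "0 < s" and x: "x \<in> space M" for s x
  proof -
    have 1: "(\<lambda>n. T s (T (\<tau> n) H) x) \<longlonglongrightarrow> T s f x"
      by (rule T_tendsto[OF s x T_Bb[OF \<tau> H] THb[OF \<tau>] flim])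
    obtain k :: nat where k: "(s + t0) / t0 \<le> real k" using real_arch_simple by blast
    then have k: "s + t0 \<le> real k * t0" using t0 by (simp add: field_simps)
    have "(\<lambda>n. T s (T (\<tau> n) H) x) \<longlonglongrightarrow> f x"
    proof (rule tendsto_sandwich)
      have eq: "T s (T (\<tau> n) H) x = T (s + \<tau> n) H x" for n using T_semigroup[OF s \<tau> H x] by simp
      show "\<forall>\<^sub>F n in sequentially. T (\<tau> (n - 1)) H x \<le> T s (T (\<tau> n) H) x"
        using eventually_gt_at_top[of 0]
      proof eventually_elim
        case (elim n)
        then have "\<tau> (n - 1) + t0 = \<tau> n" by (cases n) (auto simp: \<tau>_def algebra_simps)
        then show ?case unfolding eq by (intro THmono \<tau> x) (use s in linarith)
      qed
      show "\<forall>\<^sub>F n in sequentially. T s (T (\<tau> n) H) x \<le> T (\<tau> (n + k)) H x"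
      proof (rule always_eventually, rule allI)
        fix n
        have "s + \<tau> n + t0 \<le> \<tau> (n + k)" using k by (simp add: \<tau>_def algebra_simps)
        then show "T s (T (\<tau> n) H) x \<le> T (\<tau> (n + k)) H x"
          unfolding eq using add_pos_pos[OF s \<tau>] by (intro THmono x)
      qed
      show "(\<lambda>n. T (\<tau> (n + k)) H x) \<longlonglongrightarrow> f x" by (rule LIMSEQ_ignore_initial_segment[OF flim[OF x]])
      show "(\<lambda>n. T (\<tau> (n - 1)) H x) \<longlonglongrightarrow> f x"
        by (rule LIMSEQ_imp_Suc) (simp add: flim[OF x])
    qed
    from LIMSEQ_unique[OF 1 this] show ?thesis .
  qed
  then have fxd: "fixed f" using f by (simp add: fixed_def)
  define e where "e m x = max 0 (T t0 (F m) x - f x)" for m x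
  show ?thesis
  proof (rule that[OF fxd fpos])
    show "e m \<in> Bb M" for m unfolding e_def by (intro Bb_intros T_Bb t0 F f)
    show "0 \<le> e m x \<and> e m x \<le> b * c" if x: "x \<in> space M" for m x
      using T_bounded[OF t0 x F Fabs, of m] fpos[OF x] b c_nonneg by (auto simp: e_def)
    show "(\<lambda>m. e m x) \<longlonglongrightarrow> 0" if x: "x \<in> space M" for x
    proof -
      have "(\<lambda>m. e m x) \<longlonglongrightarrow> max 0 (T t0 H x - f x)"
        unfolding e_def by (intro tendsto_intros TFlim t0 x)
      moreover have "T t0 H x \<le> f x" using Hf[OF x, of 0] by (simp add: \<tau>_def)
      then have "max 0 (T t0 H x - f x) = 0" by (intro max_absorb1) simp
      ultimately show ?thesis by (simp only:)
    qed
    show "T t g x \<le> f x + e m x" if t: "t0 + real (Suc m) \<le> t" and x: "x \<in> space M" for m t x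
    proof -
      have I: "t - t0 \<in> I m" using t by (simp add: I_def)
      have "T t g x = T t0 (T (t - t0) g) x" using T_semigroup[OF t0 Ipos[OF I] g(1) x] by simp
      also have "\<dots> \<le> T t0 (F m) x" by (rule T_mono_AE[OF order_refl x Tg[OF Ipos[OF I]] F ess[OF I]])
      finally show ?thesis by (simp add: e_def)
    qed
    show "(\<integral>x. f x \<partial>N) = 0" if N: "invariant N" and g0: "(\<integral>x. g x \<partial>N) = 0" for N
    proof -
      have Nf: "N \<in> finite_measures M" using N by (simp add: invariant_def)
      note sp = finite_measuresD(3)[OF Nf]
      have z: "AE x in N. T t g x = 0" if t: "0 < t" for t
      proof -
        have "(\<integral>x. T t g x \<partial>N) = 0" using invariant_integral[OF N t g(1)] g0 by simp
        moreover have "AE x in N. 0 \<le> T t g x" using Tgb(1)[OF t] sp by (intro AE_I2) auto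
        ultimately show ?thesis using integral_nonneg_eq_0_iff_AE[OF Bb_integrable[OF Nf Tg[OF t]]] by simp
      qed
      have "AE x in N. \<forall>t\<in>D 0. T t g x = 0"
        by (rule AE_ball_countable[THEN iffD2, OF Dc]) (use z Dpos in blast)
      then have "AE x in N. H x = 0"
        using AE_space
      proof eventually_elim
        case (elim x)
        then have x: "x \<in> space M" using sp by simp
        have "F 0 x \<le> 0" by (rule Flb) (use elim in simp)
        then show ?case using HF[OF x, of 0] Hb(2)[OF x] by simp
      qed
      then have "(\<integral>x. H x \<partial>N) = (\<integral>x. 0 \<partial>N)"
        using borel_measurable_integrable[OF Bb_integrable[OF Nf H]] by (intro integral_cong_AE) auto
      then have "(\<integral>x. T (\<tau> n) H x \<partial>N) = 0" for n using invariant_integral[OF N \<tau> H] by simp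
      moreover have "(\<lambda>n. \<integral>x. T (\<tau> n) H x \<partial>N) \<longlonglongrightarrow> (\<integral>x. f x \<partial>N)"
        by (rule Bb_dominated_convergence[OF Nf T_Bb[OF \<tau> H] THb[OF \<tau>] _ f])
          (auto intro!: AE_I2 flim simp: sp)
      ultimately show ?thesis using LIMSEQ_unique[OF _ tendsto_const] by auto
    qed
  qed
qed

lemma invariant_abs_cont:
  assumes "invariant N" shows "absolutely_continuous \<mu> N"
proof -
  have Nf: "N \<in> finite_measures M" using assms by (simp add: invariant_def)
  have "measure N A = 0" if A: "A \<in> sets M" "measure \<mu> A = 0" for A
  proof -
    have "measure N A = (\<integral>x. T t0 (indicator A) x \<partial>N)" using assms A t0 by (simp add: invariant_def)
    also have "\<dots> = (\<integral>x. 0 \<partial>N)"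
      by (rule Bochner_Integration.integral_cong[OF refl])
        (use T_null[OF order_refl A] finite_measuresD(3)[OF Nf] in simp)
    finally show ?thesis by simp
  qed
  then show ?thesis using absolutely_continuous_iff[OF mu Nf] by blast
qed

text \<open>
  All invariant measures have densities with respect to \<open>\<mu>\<close>, so countably many of them have supports
  that exhaust all the supports; a convergent series of these is invariant and dominates the others.
\<close>

lemma maximal_invariant_measure:
  obtains N0 where "invariant N0" "\<And>N. invariant N \<Longrightarrow> absolutely_continuous N0 N"
proof -
  note msp = finite_measuresD[OF mu]
  have "\<exists>D. D \<in> borel_measurable M \<and> (\<forall>x. 0 \<le> D x) \<and> density \<mu> (\<lambda>x. ennreal (D x)) = N" if "invariant N" for N
    using real_density[OF mu _ invariant_abs_cont[OF that]] that unfolding invariant_def by metis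
  then obtain D where D: "\<And>N. invariant N \<Longrightarrow> D N \<in> borel_measurable M" "\<And>N x. invariant N \<Longrightarrow> 0 \<le> D N x"
    "\<And>N. invariant N \<Longrightarrow> density \<mu> (\<lambda>x. ennreal (D N x)) = N" by metis
  define G where "G N = {x \<in> space M. 0 < D N x}" for N
  have G: "G N \<in> sets M" if "invariant N" for N
    unfolding G_def using D(1)[OF that] by measurable
  obtain J where J: "countable J" "J \<subseteq> Collect invariant"
    "\<And>N. N \<in> Collect invariant \<Longrightarrow> measure \<mu> (G N - (\<Union>N'\<in>J. G N')) = 0"
    using countable_exhaustion[OF mu, of "Collect invariant" G] G by blast
  have null_inv: "invariant (null_measure M)"
    by (auto simp: invariant_def finite_measures_def intro!: finite_measureI)
  define Ns where "Ns = from_nat_into (insert (null_measure M) J)"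
  have Ns: "invariant (Ns i)" for i
    using from_nat_into[of "insert (null_measure M) J" i] J(2) null_inv by (auto simp: Ns_def)
  have rng: "range Ns = insert (null_measure M) J"
    unfolding Ns_def by (rule range_from_nat_into) (use J(1) in auto)
  have Nf: "Ns i \<in> finite_measures M" for i using Ns by (simp add: invariant_def)
  define a where "a i = (1/2) ^ i / (1 + measure (Ns i) (space M))" for i
  have apos: "0 < a i" for i
    by (auto simp: a_def intro!: divide_pos_pos add_pos_nonneg)
  define d where "d x = (\<Sum>i. ennreal (a i) * ennreal (D (Ns i) x))" for x
  have mm: "h \<in> borel_measurable \<mu>" if "h \<in> borel_measurable M" for h :: "'a \<Rightarrow> ennreal"
    using that by (simp add: measurable_cong_sets[OF msp(2) refl])
  have Dn: "(\<lambda>x. ennreal (D N x)) \<in> borel_measurable \<mu>" if "invariant N" for N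
    by (rule mm) (use D(1)[OF that] in measurable)
  have Dm: "(\<lambda>x. ennreal (a i) * ennreal (D (Ns i) x)) \<in> borel_measurable \<mu>" for i
    using Dn[OF Ns[of i]] by measurable
  have dm: "d \<in> borel_measurable \<mu>" unfolding d_def using Dm by measurable
  define N0 where "N0 = density \<mu> d"
  have s0: "sets N0 = sets M" "space N0 = space M" by (simp_all add: N0_def msp)
  have nn: "(\<integral>\<^sup>+x. u x \<partial>N0) = (\<Sum>i. ennreal (a i) * (\<integral>\<^sup>+x. u x \<partial>Ns i))"
    if u: "u \<in> borel_measurable M" for u
  proof -
    note um = mm[OF u]
    have "(\<integral>\<^sup>+x. u x \<partial>N0) = (\<integral>\<^sup>+x. d x * u x \<partial>\<mu>)"
      unfolding N0_def by (rule nn_integral_density[OF dm um])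
    also have "\<dots> = (\<integral>\<^sup>+x. (\<Sum>i. (ennreal (a i) * ennreal (D (Ns i) x)) * u x) \<partial>\<mu>)"
      by (simp add: d_def)
    also have "\<dots> = (\<Sum>i. \<integral>\<^sup>+x. (ennreal (a i) * ennreal (D (Ns i) x)) * u x \<partial>\<mu>)"
      by (rule nn_integral_suminf) (use Dm um in measurable)
    also have "\<dots> = (\<Sum>i. ennreal (a i) * (\<integral>\<^sup>+x. u x \<partial>Ns i))"
    proof (rule suminf_cong)
      fix i
      note m = Dn[OF Ns[of i]]
      have "(\<integral>\<^sup>+x. u x \<partial>Ns i) = (\<integral>\<^sup>+x. ennreal (D (Ns i) x) * u x \<partial>\<mu>)"
        using nn_integral_density[OF m um] D(3)[OF Ns[of i]] by simp
      then show "(\<integral>\<^sup>+x. (ennreal (a i) * ennreal (D (Ns i) x)) * u x \<partial>\<mu>) = ennreal (a i) * (\<integral>\<^sup>+x. u x \<partial>Ns i)"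
        using m um by (simp add: mult.assoc nn_integral_cmult)
    qed
    finally show ?thesis .
  qed
  have em: "emeasure N0 A = (\<Sum>i. ennreal (a i) * emeasure (Ns i) A)" if A: "A \<in> sets M" for A
    using nn[of "indicator A"] A s0 finite_measuresD(2)[OF Nf] by simp
  have "emeasure N0 (space M) \<le> (\<Sum>i. ennreal ((1/2) ^ i))"
    unfolding em[OF sets.top]
  proof (rule suminf_le)
    fix i
    have "a i * measure (Ns i) (space M) \<le> (1/2) ^ i"
    proof -
      have "measure (Ns i) (space M) / (1 + measure (Ns i) (space M)) \<le> 1"
        by (simp add: divide_le_eq add_pos_nonneg)
      then have "(1/2) ^ i * (measure (Ns i) (space M) / (1 + measure (Ns i) (space M))) \<le> (1/2) ^ i * 1"
        by (intro mult_left_mono) auto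
      then show ?thesis by (simp add: a_def)
    qed
    then show "ennreal (a i) * emeasure (Ns i) (space M) \<le> ennreal ((1/2) ^ i)"
      unfolding emeasure_finite_measures[OF Nf] using apos[of i]
      by (subst ennreal_mult[symmetric]) (auto intro: ennreal_leI)
  qed auto
  also have "\<dots> = ennreal (\<Sum>i. (1/2) ^ i)"
    by (rule suminf_ennreal2) (simp, rule summable_geometric, simp)
  also have "\<dots> < \<infinity>" using ennreal_less_top by (simp only: infinity_ennreal_def)
  finally have N0f: "N0 \<in> finite_measures M"
    by (intro finite_measuresI finite_measureI) (use s0 in auto)
  have inv0: "invariant N0"
    unfolding invariant_def
  proof (intro conjI allI impI ballI N0f)
    fix t :: real and A assume t: "0 < t" and A: "A \<in> sets M"
    have u: "T t (indicator A) \<in> Bb M" by (intro T_Bb t Bb_indicator A)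
    have pos: "0 \<le> T t (indicator A) x" if "x \<in> space M" for x by (rule T_nonneg[OF t that]) simp
    have e: "(\<integral>\<^sup>+x. ennreal (T t (indicator A) x) \<partial>N) = ennreal (\<integral>x. T t (indicator A) x \<partial>N)"
      if "N \<in> finite_measures M" for N
      by (rule nn_integral_eq_integral[OF Bb_integrable[OF that u]])
        (use pos finite_measuresD(3)[OF that] in auto)
    have "ennreal (\<integral>x. T t (indicator A) x \<partial>N0) = (\<Sum>i. ennreal (a i) * (\<integral>\<^sup>+x. ennreal (T t (indicator A) x) \<partial>Ns i))"
      unfolding e[OF N0f, symmetric] using Bb_measurable[OF u] by (intro nn) measurable
    also have "\<dots> = emeasure N0 A"
      unfolding em[OF A] e[OF Nf] emeasure_finite_measures[OF Nf]
      using Ns t A by (simp add: invariant_def)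
    also have "\<dots> = ennreal (measure N0 A)" by (rule emeasure_finite_measures[OF N0f])
    finally show "(\<integral>x. T t (indicator A) x \<partial>N0) = measure N0 A"
    proof (subst (asm) ennreal_inj)
      show "0 \<le> (\<integral>x. T t (indicator A) x \<partial>N0)"
        by (rule integral_nonneg_AE, rule AE_I2) (use pos s0 in auto)
    qed auto
  qed
  have "absolutely_continuous N0 N" if N: "invariant N" for N
  proof -
    have NfN: "N \<in> finite_measures M" using N by (simp add: invariant_def)
    have "measure N A = 0" if A: "A \<in> sets M" "measure N0 A = 0" for A
    proof -
      have "emeasure N0 A = 0" using A by (simp add: emeasure_finite_measures[OF N0f])
      then have "(\<Sum>i. ennreal (a i) * emeasure (Ns i) A) = 0" using em[OF A(1)] by simp
      then have "ennreal (a i) * emeasure (Ns i) A = 0" for i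
        by (subst (asm) suminf_eq_zero_iff) auto
      moreover have "ennreal (a i) \<noteq> 0" for i using apos[of i] by (simp add: ennreal_eq_0_iff not_le)
      ultimately have Ni: "emeasure (Ns i) A = 0" for i by simp
      have zero: "AE x in \<mu>. x \<in> A \<longrightarrow> D N' x = 0" if N': "invariant N'" "emeasure N' A = 0" for N'
      proof -
        note m = Dn[OF N'(1)]
        have "A \<in> null_sets (density \<mu> (\<lambda>x. ennreal (D N' x)))"
          using N'(2) A(1) D(3)[OF N'(1)] finite_measuresD(2)[of N' M] N'(1)
          by (simp add: null_sets_def invariant_def)
        then have "AE x in \<mu>. x \<in> A \<longrightarrow> ennreal (D N' x) = 0"
          using null_sets_density_iff[OF m, of A] by simp
        then show ?thesis by eventually_elim (use D(2)[OF N'(1)] in \<open>auto simp: ennreal_eq_0_iff antisym\<close>)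
      qed
      have "AE x in \<mu>. \<forall>i. x \<in> A \<longrightarrow> D (Ns i) x = 0"
        unfolding AE_all_countable using zero[OF Ns Ni] by blast
      moreover have "AE x in \<mu>. x \<notin> G N - (\<Union>N'\<in>J. G N')"
      proof (rule AE_not_in)
        have "(\<Union>N'\<in>J. G N') \<in> sets M" using J(1,2) G by (intro sets.countable_UN'') auto
        then show "G N - (\<Union>N'\<in>J. G N') \<in> null_sets \<mu>"
          using J(3)[of N] N G[OF N] by (subst null_iff[OF mu]) auto
      qed
      ultimately have "AE x in \<mu>. x \<in> A \<longrightarrow> ennreal (D N x) = 0"
        using AE_space
      proof eventually_elim
        case (elim x)
        have x: "x \<in> space M" using elim msp by simp
        show ?case
        proof
          assume "x \<in> A"
          have "x \<notin> G N'" if "N' \<in> J" for N'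
          proof -
            have "N' \<in> range Ns" unfolding rng using that by simp
            then obtain i where "N' = Ns i" by (rule rangeE)
            then show ?thesis using elim(1) \<open>x \<in> A\<close> by (simp add: G_def)
          qed
          then have "x \<notin> G N" using elim(2) by blast
          then have "D N x \<le> 0" using x by (simp add: G_def)
          then show "ennreal (D N x) = 0" by (simp add: ennreal_neg)
        qed
      qed
      then have "A \<in> null_sets (density \<mu> (\<lambda>x. ennreal (D N x)))"
        using A(1) msp(2) null_sets_density_iff[OF Dn[OF N], of A] by simp
      then show ?thesis using D(3)[OF N] by (simp add: null_sets_def measure_def)
    qed
    then show ?thesis using absolutely_continuous_iff[OF N0f NfN] by blast
  qed
  then show ?thesis using that[OF inv0] by blast
qed

end

section \<open>Convergence on the support of an invariant measure\<close>

lemma Bb_sets_cong: 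
  assumes "sets N = sets M" shows "Bb N = Bb M"
  unfolding Bb_def by (simp only: sets_eq_imp_space_eq[OF assms] measurable_cong_sets[OF assms refl])

context abs_cont_kernel_semigroup
begin

text \<open>
  The support is the set where the density with respect to \<open>\<mu>\<close> is positive; on it, \<open>\<mu>\<close> and \<open>N\<close> have the same
  null sets.
\<close>

lemma invariant_support:
  assumes N: "invariant N"
  obtains C where "C \<in> sets M" "measure N (space M - C) = 0"
    "\<And>A. A \<in> sets M \<Longrightarrow> measure N A = 0 \<Longrightarrow> measure \<mu> (A \<inter> C) = 0"
proof -
  have Nf: "N \<in> finite_measures M" using N by (simp add: invariant_def)
  obtain D :: "'a \<Rightarrow> real" where D: "D \<in> borel_measurable M" "\<And>x. 0 \<le> D x" "density \<mu> D = N"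
    by (rule real_density[OF mu Nf invariant_abs_cont[OF N]]) blast
  have "D \<in> borel_measurable \<mu>"
    using D(1) by (simp add: measurable_cong_sets[OF finite_measuresD(2)[OF mu] refl])
  then have Dm: "(\<lambda>x. ennreal (D x)) \<in> borel_measurable \<mu>" by measurable
  define C where "C = {x \<in> space M. 0 < D x}"
  have C: "C \<in> sets M" unfolding C_def using D(1) by measurable
  have null: "measure N A = 0 \<longleftrightarrow> (AE x in \<mu>. x \<in> A \<longrightarrow> ennreal (D x) = 0)" if A: "A \<in> sets M" for A
    using null_iff[OF Nf A] null_sets_density_iff[OF Dm, of A] D(3) A finite_measuresD(2)[OF mu] by simp
  show ?thesis
  proof (rule that[OF C])
    have "space M - C \<in> sets M" using C by blast
    then show "measure N (space M - C) = 0"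
      by (subst null) (auto intro!: AE_I2 simp: C_def ennreal_neg not_less)
    show "measure \<mu> (A \<inter> C) = 0" if A: "A \<in> sets M" "measure N A = 0" for A
    proof -
      have "AE x in \<mu>. x \<in> A \<longrightarrow> ennreal (D x) = 0" using null A by blast
      then have "AE x in \<mu>. x \<notin> A \<inter> C"
        by eventually_elim (auto simp: C_def ennreal_eq_0_iff)
      then have "A \<inter> C \<in> null_sets \<mu>"
        using AE_iff_null_sets[of "A \<inter> C" \<mu>] A(1) C finite_measuresD(2)[OF mu] by simp
      then show ?thesis by (simp add: null_sets_def measure_def)
    qed
  qed
qed

text \<open>
  A fixed function \<open>f \<ge> 0\<close> conjugates \<open>T\<close> into a Markov semigroup \<open>u \<mapsto> T t (f u) / f\<close> that preserves the
  measure \<open>f N\<close> (Doob's \<open>h\<close>-transform), so that \<open>L1_convergence\<close> applies to functions dominated by \<open>f\<close>.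
\<close>

lemma L1_Cauchy_dominated:
  assumes N: "invariant N" and f: "fixed f" "\<And>x. x \<in> space M \<Longrightarrow> 0 \<le> f x"
    and u: "u \<in> Bb M" and e: "0 < e"
  shows "\<exists>\<tau>>0. \<forall>t\<ge>\<tau>. \<forall>s\<ge>\<tau>. (\<integral>x. \<bar>T t (\<lambda>y. f y * u y) x - T s (\<lambda>y. f y * u y) x\<bar> \<partial>N) \<le> e"
proof -
  have Nf: "N \<in> finite_measures M" using N by (simp add: invariant_def)
  note Ns = finite_measuresD[OF Nf]
  have fB: "f \<in> Bb M" and fT: "\<And>t x. 0 < t \<Longrightarrow> x \<in> space M \<Longrightarrow> T t f x = f x"
    using f by (auto simp: fixed_def)
  define \<pi> where "\<pi> = density N (\<lambda>x. ennreal (f x))"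
  have ps: "sets \<pi> = sets M" "space \<pi> = space M" using Ns by (simp_all add: \<pi>_def)
  have Bbp: "Bb \<pi> = Bb M" by (rule Bb_sets_cong[OF ps(1)])
  have fN: "f \<in> borel_measurable N" by (rule borel_measurable_integrable[OF Bb_integrable[OF Nf fB]])
  have fpos: "AE x in N. 0 \<le> f x" using f(2) Ns by (intro AE_I2) auto
  have intp: "(\<integral>x. w x \<partial>\<pi>) = (\<integral>x. f x * w x \<partial>N)" if "w \<in> Bb M" for w
    unfolding \<pi>_def by (rule integral_real_density[OF fN fpos borel_measurable_integrable[OF Bb_integrable[OF Nf that]]])
  have pf: "\<pi> \<in> finite_measures M"
  proof (rule finite_measuresI[OF finite_measureI ps(1)])
    have "emeasure \<pi> (space M) = (\<integral>\<^sup>+x. ennreal (f x) * indicator (space M) x \<partial>N)"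
      unfolding \<pi>_def by (rule emeasure_density) (use fN Ns in auto)
    also have "\<dots> = (\<integral>\<^sup>+x. ennreal (f x) \<partial>N)" by (rule nn_integral_cong) (use Ns in auto)
    also have "\<dots> = ennreal (\<integral>x. f x \<partial>N)"
      by (rule nn_integral_eq_integral[OF Bb_integrable[OF Nf fB] fpos])
    finally show "emeasure \<pi> (space \<pi>) \<noteq> \<infinity>" by (simp add: ps)
  qed
  \<comment> \<open>The points with \<open>f x = 0\<close> form a null set of \<open>\<pi>\<close>, and \<open>T t (f w)\<close> vanishes there, so that \<open>f P t w = T t (f w)\<close>.\<close>
  define P where "P t w x = (if f x > 0 then T t (\<lambda>y. f y * w y) x / f x else 0)" for t w x
  have fw: "(\<lambda>y. f y * w y) \<in> Bb M" if "w \<in> Bb M" for w by (intro Bb_mult fB that)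
  have Tfw: "\<bar>T t (\<lambda>y. f y * w y) x\<bar> \<le> b * f x"
    if "0 < t" "x \<in> space M" "w \<in> Bb M" "\<And>y. y \<in> space M \<Longrightarrow> \<bar>w y\<bar> \<le> b" for t x w b
  proof -
    have "\<bar>T t (\<lambda>y. f y * w y) x\<bar> \<le> T t (\<lambda>y. \<bar>f y * w y\<bar>) x" by (rule T_abs[OF that(1,2)])
    also have "\<dots> \<le> T t (\<lambda>y. b * f y) x"
    proof (rule T_mono[OF that(1,2)])
      show "\<bar>f y * w y\<bar> \<le> b * f y" if "y \<in> space M" for y
        using mult_right_mono[OF \<open>\<And>y. y \<in> space M \<Longrightarrow> \<bar>w y\<bar> \<le> b\<close>[OF that] f(2)[OF that]] f(2)[OF that]
        by (simp add: abs_mult mult.commute)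
    qed (intro Bb_intros fB that)+
    also have "\<dots> = b * f x" using T_scale[of t b f x] fT[OF that(1,2)] by simp
    finally show ?thesis .
  qed
  have fP: "f x * P t w x = T t (\<lambda>y. f y * w y) x" if t: "0 < t" and x: "x \<in> space M" and w: "w \<in> Bb M" for t x w
  proof (cases "f x > 0")
    case False
    then have "f x = 0" using f(2)[OF x] by simp
    obtain b where "\<And>y. y \<in> space M \<Longrightarrow> \<bar>w y\<bar> \<le> b" by (rule BbE[OF w]) blast
    from Tfw[OF t x w this] show ?thesis using \<open>f x = 0\<close> by simp
  qed (simp add: P_def)
  have P_Bb: "P t w \<in> Bb M" if t: "0 < t" and w: "w \<in> Bb M" for t w
  proof -
    obtain b where b: "0 \<le> b" "\<And>y. y \<in> space M \<Longrightarrow> \<bar>w y\<bar> \<le> b" by (rule BbE[OF w]) blast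
    show ?thesis
    proof (rule BbI)
      show "P t w \<in> borel_measurable M"
        unfolding P_def[abs_def] using Bb_measurable[OF fB] Bb_measurable[OF T_Bb[OF t fw[OF w]]] by measurable
      show "\<bar>P t w x\<bar> \<le> b" if "x \<in> space M" for x
        using Tfw[OF t that w b(2)] b(1) by (auto simp: P_def field_simps)
    qed
  qed
  interpret P: markov_semigroup \<pi> P
  proof (rule markov_semigroup.intro)
    show "finite_measure \<pi>" by (rule finite_measuresD[OF pf])
    show "P t (\<lambda>_. 1) x \<le> 1" if "0 < t" "x \<in> space \<pi>" for t x
      using fT[of t x] that by (simp add: P_def ps)
    fix t :: real and w assume t: "0 < t" and "w \<in> Bb \<pi>"
    then have w: "w \<in> Bb M" by (simp add: Bbp)
    show "P t w \<in> Bb \<pi>" using P_Bb[OF t w] by (simp add: Bbp)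
    show "(\<integral>x. P t w x \<partial>\<pi>) = (\<integral>x. w x \<partial>\<pi>)"
    proof -
      have "(\<integral>x. f x * P t w x \<partial>N) = (\<integral>x. T t (\<lambda>y. f y * w y) x \<partial>N)"
        by (rule Bochner_Integration.integral_cong) (use fP[OF t _ w] Ns in auto)
      then show ?thesis
        unfolding intp[OF P_Bb[OF t w]] intp[OF w] using invariant_integral[OF N t fw[OF w]] by simp
    qed
    show "0 \<le> P t w x" if "\<And>y. y \<in> space \<pi> \<Longrightarrow> 0 \<le> w y" "x \<in> space \<pi>" for x
    proof -
      have "0 \<le> T t (\<lambda>y. f y * w y) x"
        by (rule T_nonneg[OF t]) (use that f(2) in \<open>auto simp: ps\<close>)
      then show ?thesis by (simp add: P_def)
    qed
    show "P t (\<lambda>y. a * w y + b * v y) x = a * P t w x + b * P t v x"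
      if "v \<in> Bb \<pi>" "x \<in> space \<pi>" for v a b x
    proof -
      have v: "v \<in> Bb M" and x: "x \<in> space M" using that by (simp_all add: Bbp ps)
      have "T t (\<lambda>y. f y * (a * w y + b * v y)) x = T t (\<lambda>y. a * (f y * w y) + b * (f y * v y)) x"
        by (simp add: algebra_simps)
      also have "\<dots> = T t (\<lambda>y. a * (f y * w y)) x + T t (\<lambda>y. b * (f y * v y)) x"
        by (rule T_add[OF t x]) (intro Bb_intros fB w v)+
      also have "\<dots> = a * T t (\<lambda>y. f y * w y) x + b * T t (\<lambda>y. f y * v y) x" by (simp only: T_scale)
      finally show ?thesis by (simp add: P_def add_divide_distrib)
    qed
    show "P (t + s) w x = P t (P s w) x" if s: "0 < s" and "x \<in> space \<pi>" for s x
    proof -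
      have x: "x \<in> space M" using that by (simp add: ps)
      have "T (t + s) (\<lambda>y. f y * w y) x = T t (T s (\<lambda>y. f y * w y)) x"
        by (rule T_semigroup[OF t s fw[OF w] x])
      also have "\<dots> = T t (\<lambda>y. f y * P s w y) x"
        by (rule T_cong[OF t x]) (simp add: fP[OF s _ w])
      finally show ?thesis by (simp add: P_def)
    qed
  qed
  obtain C where C: "C \<in> sets M" "measure N (space M - C) = 0"
    "\<And>A. A \<in> sets M \<Longrightarrow> measure N A = 0 \<Longrightarrow> measure \<mu> (A \<inter> C) = 0"
    by (rule invariant_support[OF N]) blast
  have Cc: "space M - C \<in> sets M" using C(1) by blast
  have "AE x in N. T t0 (indicator (space M - C)) x = 0"
  proof -
    have "(\<integral>x. T t0 (indicator (space M - C)) x \<partial>N) = 0"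
      using N t0 Cc C(2) by (simp add: invariant_def)
    moreover have "AE x in N. 0 \<le> T t0 (indicator (space M - C)) x"
      using T_nonneg[OF t0, of _ "indicator (space M - C)"] Ns by (intro AE_I2) auto
    ultimately show ?thesis
      using integral_nonneg_eq_0_iff_AE[OF Bb_integrable[OF Nf T_Bb[OF t0 Bb_indicator[OF Cc]]]] by simp
  qed
  then have "AE x in N. 0 < ennreal (f x) \<longrightarrow>
     (\<exists>\<kappa>\<in>finite_measures \<pi>. absolutely_continuous \<pi> \<kappa> \<and> (\<forall>B\<in>sets \<pi>. P t0 (indicator B) x = measure \<kappa> B))"
    using AE_space
  proof eventually_elim
    case (elim x)
    have x: "x \<in> space M" using elim Ns by simp
    show ?case
    proof
      assume "0 < ennreal (f x)"
      then have fx: "0 < f x" by (simp add: ennreal_less_zero_iff)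
      have Pind: "P t0 (indicator B) x = T t0 (\<lambda>y. f y * indicator B y) x / f x" for B
        using fx by (simp add: P_def)
      have TB: "T t0 (\<lambda>y. f y * indicator (A \<union> B) y) x = T t0 (\<lambda>y. f y * indicator A y) x + T t0 (\<lambda>y. f y * indicator B y) x"
        if "A \<in> sets M" "B \<in> sets M" "A \<inter> B = {}" for A B
      proof -
        have "T t0 (\<lambda>y. f y * indicator (A \<union> B) y) x = T t0 (\<lambda>y. f y * indicator A y + f y * indicator B y) x"
          by (rule T_cong[OF t0 x]) (use that in \<open>auto simp: indicator_def\<close>)
        then show ?thesis using T_add[OF t0 x fw[OF Bb_indicator[OF that(1)]] fw[OF Bb_indicator[OF that(2)]]] by simp
      qed
      have "\<exists>\<kappa>\<in>finite_measures M. \<forall>B\<in>sets M. measure \<kappa> B = P t0 (indicator B) x"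
      proof (rule finite_measure_exists)
        show "0 \<le> P t0 (indicator A) x" if "A \<in> sets M" for A
          unfolding Pind using fx f(2) by (intro divide_nonneg_pos T_nonneg[OF t0 x]) auto
        show "P t0 (indicator (A \<union> B)) x = P t0 (indicator A) x + P t0 (indicator B) x"
          if "A \<in> sets M" "B \<in> sets M" "A \<inter> B = {}" for A B
          unfolding Pind TB[OF that] by (simp add: add_divide_distrib)
        fix A :: "nat \<Rightarrow> 'a set" assume A: "\<And>n. A n \<in> sets M" "decseq A" "(\<Inter>n. A n) = {}"
        obtain b where b: "\<And>y. y \<in> space M \<Longrightarrow> \<bar>f y\<bar> \<le> b" by (rule BbE[OF fB]) blast
        have "(\<lambda>n. T t0 (\<lambda>y. f y * indicator (A n) y) x) \<longlonglongrightarrow> T t0 (\<lambda>y. f y * indicator {} y) x"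
        proof (rule T_tendsto[OF t0 x fw[OF Bb_indicator[OF A(1)]]])
          show "\<bar>f y * indicator (A n) y\<bar> \<le> b" if "y \<in> space M" for n y
            using b[OF that] by (auto simp: indicator_def)
          show "(\<lambda>n. f y * indicator (A n) y) \<longlonglongrightarrow> f y * indicator {} y" for y
            using LIMSEQ_indicator_decseq[OF A(2), of y] unfolding A(3) by (rule tendsto_mult_left)
        qed
        then have "(\<lambda>n. T t0 (\<lambda>y. f y * indicator (A n) y) x) \<longlonglongrightarrow> 0" by (simp add: T_def)
        from tendsto_divide[OF this tendsto_const[of "f x"]] fx show "(\<lambda>n. P t0 (indicator (A n)) x) \<longlonglongrightarrow> 0"
          unfolding Pind by simp
      qed
      then obtain \<kappa> where \<kappa>: "\<kappa> \<in> finite_measures M" "\<And>B. B \<in> sets M \<Longrightarrow> measure \<kappa> B = P t0 (indicator B) x" by blast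
      have fmp: "finite_measures \<pi> = finite_measures M" by (simp add: finite_measures_def ps)
      have "measure \<kappa> A = 0" if A: "A \<in> sets M" "measure \<pi> A = 0" for A
      proof -
        let ?A = "A \<inter> {y \<in> space M. 0 < f y}"
        have A': "?A \<in> sets M" using A(1) Bb_measurable[OF fB] by measurable
        have "(\<integral>y. f y * indicator A y \<partial>N) = 0"
          using intp[OF Bb_indicator[OF A(1)]] A ps by simp
        moreover have "AE y in N. 0 \<le> f y * indicator A y" by (rule AE_I2) (simp add: f(2) Ns)
        ultimately have "AE y in N. f y * indicator A y = 0"
          using integral_nonneg_eq_0_iff_AE[OF Bb_integrable[OF Nf fw[OF Bb_indicator[OF A(1)]]]] by blast
        then have "AE y in N. y \<notin> ?A" by eventually_elim (auto simp: indicator_def)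
        then have "measure N ?A = 0"
          using AE_iff_null_sets[of ?A N] A' Ns null_iff[OF Nf A'] by simp
        then have "measure \<mu> (?A \<inter> C) = 0" by (rule C(3)[OF A'])
        then have z: "T t0 (indicator (?A \<inter> C)) x = 0" using A' C(1) by (intro T_null order_refl x) auto
        obtain b where b: "0 \<le> b" "\<And>y. y \<in> space M \<Longrightarrow> \<bar>f y\<bar> \<le> b" by (rule BbE[OF fB]) blast
        have AC: "?A \<inter> C \<in> sets M" using A' C(1) by blast
        have "T t0 (\<lambda>y. f y * indicator A y) x \<le> T t0 (\<lambda>y. b * (indicator (?A \<inter> C) y + indicator (space M - C) y)) x"
        proof (rule T_mono[OF t0 x fw[OF Bb_indicator[OF A(1)]]])
          show "(\<lambda>y. b * (indicator (?A \<inter> C) y + indicator (space M - C) y)) \<in> Bb M"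
            by (intro Bb_mult Bb_add Bb_const Bb_indicator AC Cc)
          show "f y * indicator A y \<le> b * (indicator (?A \<inter> C) y + indicator (space M - C) y)" if "y \<in> space M" for y
            using b(1) b(2)[OF that] f(2)[OF that] that by (auto simp: indicator_def)
        qed
        also have "\<dots> = b * (T t0 (indicator (?A \<inter> C)) x + T t0 (indicator (space M - C)) x)"
          unfolding T_scale using T_add[OF t0 x Bb_indicator[OF AC] Bb_indicator[OF Cc]] by simp
        also have "\<dots> = 0" using z elim(1) by simp
        finally have "measure \<kappa> A \<le> 0"
          unfolding \<kappa>(2)[OF A(1)] Pind using fx by (simp add: divide_le_0_iff)
        then show ?thesis by (simp add: measure_le_0_iff)
      qed
      then have "absolutely_continuous \<pi> \<kappa>" using absolutely_continuous_iff[OF pf \<kappa>(1)] by blast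
      then show "\<exists>\<kappa>\<in>finite_measures \<pi>. absolutely_continuous \<pi> \<kappa> \<and> (\<forall>B\<in>sets \<pi>. P t0 (indicator B) x = measure \<kappa> B)"
        using \<kappa> fmp by (intro bexI[of _ \<kappa>]) (simp_all add: ps)
    qed
  qed
  then have ac: "AE x in \<pi>. \<exists>\<kappa>\<in>finite_measures \<pi>. absolutely_continuous \<pi> \<kappa> \<and> (\<forall>B\<in>sets \<pi>. P t0 (indicator B) x = measure \<kappa> B)"
    unfolding \<pi>_def[symmetric] using fN by (subst (1) \<pi>_def) (simp add: AE_density)
  have "\<exists>g\<in>Bb \<pi>. ((\<lambda>t. \<integral>x. \<bar>P t u x - g x\<bar> \<partial>\<pi>) \<longlongrightarrow> 0) at_top"
  proof (rule P.L1_convergence[OF _ t0 ac])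
    show "u \<in> Bb \<pi>" using u by (simp add: Bbp)
    fix w :: "nat \<Rightarrow> 'a \<Rightarrow> real" and b
    assume w: "\<And>n. w n \<in> Bb \<pi>" and wb: "\<And>n x. x \<in> space \<pi> \<Longrightarrow> \<bar>w n x\<bar> \<le> b"
    have wM: "\<And>n. w n \<in> Bb M" "\<And>n x. x \<in> space M \<Longrightarrow> \<bar>w n x\<bar> \<le> b" using w wb by (simp_all add: Bbp ps)
    obtain r v where r: "strict_mono (r :: nat \<Rightarrow> nat)" "v \<in> Bb M"
      and lim: "\<And>h x. h \<in> Bb M \<Longrightarrow> x \<in> space M \<Longrightarrow>
        (\<lambda>n. T t0 (\<lambda>y. h y * w (r n) y) x) \<longlonglongrightarrow> T t0 (\<lambda>y. h y * v y) x"
      by (rule T_compactness[of w b, OF wM]) (assumption, rule that, assumption, assumption, blast)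
    have "(\<lambda>n. P t0 (w (r n)) x) \<longlonglongrightarrow> P t0 v x" if x: "x \<in> space M" for x
    proof (cases "0 < f x")
      case True
      then show ?thesis using tendsto_divide[OF lim[OF fB x] tendsto_const[of "f x"]] by (simp add: P_def)
    qed (simp add: P_def)
    then show "\<exists>r v. strict_mono (r :: nat \<Rightarrow> nat) \<and> v \<in> Bb \<pi> \<and> (AE x in \<pi>. (\<lambda>n. P t0 (w (r n)) x) \<longlonglongrightarrow> P t0 v x)"
      using r by (intro exI[of _ r] exI[of _ v]) (auto simp: Bbp ps intro: AE_I2)
  qed
  then obtain g where g: "g \<in> Bb M" and lim: "((\<lambda>t. \<integral>x. \<bar>P t u x - g x\<bar> \<partial>\<pi>) \<longlongrightarrow> 0) at_top"
    unfolding Bbp by blast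
  have "\<forall>\<^sub>F t in at_top. (\<integral>x. \<bar>P t u x - g x\<bar> \<partial>\<pi>) < e / 2"
    by (rule order_tendstoD(2)[OF lim]) (use e in simp)
  then obtain \<tau>0 where \<tau>0: "\<And>t. \<tau>0 \<le> t \<Longrightarrow> (\<integral>x. \<bar>P t u x - g x\<bar> \<partial>\<pi>) < e / 2"
    by (auto simp: eventually_at_top_linorder)
  define \<tau> where "\<tau> = max 1 \<tau>0"
  have "(\<integral>x. \<bar>T t (\<lambda>y. f y * u y) x - T s (\<lambda>y. f y * u y) x\<bar> \<partial>N) \<le> e" if "\<tau> \<le> t" "\<tau> \<le> s" for t s
  proof -
    have ts: "0 < t" "0 < s" "\<tau>0 \<le> t" "\<tau>0 \<le> s" using that by (auto simp: \<tau>_def)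
    have d: "(\<lambda>x. \<bar>P t u x - P s u x\<bar>) \<in> Bb M" "(\<lambda>x. \<bar>P t u x - g x\<bar>) \<in> Bb M" "(\<lambda>x. \<bar>P s u x - g x\<bar>) \<in> Bb M"
      by (intro Bb_abs Bb_diff P_Bb ts u g)+
    have "(\<integral>x. \<bar>T t (\<lambda>y. f y * u y) x - T s (\<lambda>y. f y * u y) x\<bar> \<partial>N) = (\<integral>x. f x * \<bar>P t u x - P s u x\<bar> \<partial>N)"
    proof (rule Bochner_Integration.integral_cong[OF refl])
      fix x assume "x \<in> space N"
      then have x: "x \<in> space M" using Ns by simp
      have "\<bar>f x * P t u x - f x * P s u x\<bar> = f x * \<bar>P t u x - P s u x\<bar>"
        using f(2)[OF x] by (simp add: right_diff_distrib[symmetric] abs_mult)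
      then show "\<bar>T t (\<lambda>y. f y * u y) x - T s (\<lambda>y. f y * u y) x\<bar> = f x * \<bar>P t u x - P s u x\<bar>"
        using fP[OF ts(1) x u] fP[OF ts(2) x u] by simp
    qed
    also have "\<dots> = (\<integral>x. \<bar>P t u x - P s u x\<bar> \<partial>\<pi>)" by (rule intp[OF d(1), symmetric])
    also have "\<dots> \<le> (\<integral>x. \<bar>P t u x - g x\<bar> + \<bar>P s u x - g x\<bar> \<partial>\<pi>)"
      by (rule Bb_integral_mono[OF pf d(1) Bb_add[OF d(2,3)]]) linarith
    also have "\<dots> = (\<integral>x. \<bar>P t u x - g x\<bar> \<partial>\<pi>) + (\<integral>x. \<bar>P s u x - g x\<bar> \<partial>\<pi>)"
      by (rule Bochner_Integration.integral_add[OF Bb_integrable[OF pf d(2)] Bb_integrable[OF pf d(3)]])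
    also have "\<dots> \<le> e" using \<tau>0[OF ts(3)] \<tau>0[OF ts(4)] by simp
    finally show ?thesis .
  qed
  then show ?thesis by (intro exI[of _ \<tau>]) (auto simp: \<tau>_def)
qed

text \<open>
  For large \<open>r\<close> the function \<open>T r v\<close> is, up to an error that is small in \<open>L\<^sup>1(N)\<close>, dominated by
  the fixed function that \<open>dominating_fixed_function\<close> provides for the constant 1.
\<close>

lemma L1_Cauchy:
  assumes N: "invariant N" and v: "v \<in> Bb M" and e: "0 < e"
  shows "\<exists>\<tau>>0. \<forall>t\<ge>\<tau>. \<forall>s\<ge>\<tau>. (\<integral>x. \<bar>T t v x - T s v x\<bar> \<partial>N) \<le> e"
proof -
  have Nf: "N \<in> finite_measures M" using N by (simp add: invariant_def)
  note Ns = finite_measuresD[OF Nf]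
  obtain b where b: "0 \<le> b" "\<And>x. x \<in> space M \<Longrightarrow> \<bar>v x\<bar> \<le> b" by (rule BbE[OF v]) blast
  obtain f err B where f: "fixed f" "\<And>x. x \<in> space M \<Longrightarrow> 0 \<le> f x"
    and err: "\<And>m::nat. err m \<in> Bb M" "\<And>m x. x \<in> space M \<Longrightarrow> 0 \<le> err m x \<and> err m x \<le> B"
      "\<And>x. x \<in> space M \<Longrightarrow> (\<lambda>m. err m x) \<longlonglongrightarrow> 0"
    and dom: "\<And>m t x. t0 + real (Suc m) \<le> t \<Longrightarrow> x \<in> space M \<Longrightarrow> T t (\<lambda>_. 1) x \<le> f x + err m x"
  proof -
    show ?thesis
      by (rule dominating_fixed_function[of "\<lambda>_. 1"]) (rule Bb_const, simp, rule that)
  qed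
  have fB: "f \<in> Bb M" using f by (simp add: fixed_def)
  have "(\<lambda>m. \<integral>x. err m x \<partial>N) \<longlonglongrightarrow> (\<integral>x. 0 \<partial>N)"
    by (rule Bb_dominated_convergence[OF Nf err(1), where c=B])
      (use err(2,3) Ns in \<open>auto intro!: AE_I2 Bb_const simp: abs_le_iff\<close>)
  then have "(\<lambda>m. b * (\<integral>x. err m x \<partial>N)) \<longlonglongrightarrow> 0"
    using tendsto_mult_left[of _ 0 sequentially b] by simp
  then have "\<forall>\<^sub>F m in sequentially. b * (\<integral>x. err m x \<partial>N) < e / 3"
    by (rule order_tendstoD) (use e in simp)
  then obtain m where m: "b * (\<integral>x. err m x \<partial>N) < e / 3" by (auto simp: eventually_sequentially)
  define r where "r = t0 + real (Suc m)"
  have r: "0 < r" using t0 by (simp add: r_def)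
  have Tr: "T r v \<in> Bb M" by (rule T_Bb[OF r v])
  define u where "u x = (if 0 < f x then max (- b) (min b (T r v x / f x)) else 0)" for x
  have u: "u \<in> Bb M"
  proof (rule BbI[of _ _ b])
    show "u \<in> borel_measurable M"
      unfolding u_def[abs_def] using Bb_measurable[OF fB] Bb_measurable[OF Tr] by measurable
    show "\<bar>u x\<bar> \<le> b" for x using b(1) by (auto simp: u_def)
  qed
  have fu: "(\<lambda>y. f y * u y) \<in> Bb M" by (intro Bb_mult fB u)
  have close: "\<bar>T r v x - f x * u x\<bar> \<le> b * err m x" if x: "x \<in> space M" for x
  proof -
    have "\<bar>T r v x\<bar> \<le> T r (\<lambda>y. \<bar>v y\<bar>) x" by (rule T_abs[OF r x])
    also have "\<dots> \<le> T r (\<lambda>y. b * 1) x" by (rule T_mono[OF r x Bb_abs[OF v] Bb_const]) (use b in simp)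
    also have "\<dots> = b * T r (\<lambda>_. 1) x" by (rule T_scale)
    also have "\<dots> \<le> b * (f x + err m x)" by (rule mult_left_mono[OF dom[OF _ x] b(1)]) (simp add: r_def)
    finally have le: "\<bar>T r v x\<bar> \<le> b * f x + b * err m x" by (simp add: distrib_left)
    have nn: "0 \<le> b * err m x" using b(1) err(2)[OF x] by simp
    show ?thesis
    proof (cases "0 < f x")
      case True
      then have "f x * u x = max (- (b * f x)) (min (b * f x) (T r v x))"
        by (simp add: u_def max_mult_distrib_left min_mult_distrib_left mult.commute)
      then show ?thesis using le nn by (auto simp: max_def min_def abs_le_iff)
    next
      case False
      then have "f x = 0" using f(2)[OF x] by simp
      then show ?thesis using le by simp
    qed
  qed
  have small: "(\<integral>x. \<bar>T r v x - f x * u x\<bar> \<partial>N) \<le> e / 3"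
  proof -
    have "(\<integral>x. \<bar>T r v x - f x * u x\<bar> \<partial>N) \<le> (\<integral>x. b * err m x \<partial>N)"
      by (rule Bb_integral_mono[OF Nf _ _ close]) (intro Bb_intros Tr fB u err)+
    then show ?thesis using m by simp
  qed
  obtain \<tau> where \<tau>: "0 < \<tau>" "\<And>t s. \<tau> \<le> t \<Longrightarrow> \<tau> \<le> s \<Longrightarrow>
      (\<integral>x. \<bar>T t (\<lambda>y. f y * u y) x - T s (\<lambda>y. f y * u y) x\<bar> \<partial>N) \<le> e / 3"
    using L1_Cauchy_dominated[OF N f u, of "e / 3"] e by auto
  have "(\<integral>x. \<bar>T t v x - T s v x\<bar> \<partial>N) \<le> e" if ts: "r + \<tau> \<le> t" "r + \<tau> \<le> s" for t s
  proof -
    define t' where "t' = t - r"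
    define s' where "s' = s - r"
    have p: "0 < t'" "0 < s'" "\<tau> \<le> t'" "\<tau> \<le> s'" "t = t' + r" "s = s' + r"
      using ts \<tau>(1) by (auto simp: t'_def s'_def)
    let ?a = "T t' (\<lambda>y. f y * u y)" and ?b = "T s' (\<lambda>y. f y * u y)"
    have d: "(\<lambda>x. \<bar>T t' (T r v) x - ?a x\<bar>) \<in> Bb M" "(\<lambda>x. \<bar>?a x - ?b x\<bar>) \<in> Bb M" "(\<lambda>x. \<bar>T s' (T r v) x - ?b x\<bar>) \<in> Bb M"
      by (intro Bb_abs Bb_diff T_Bb p Tr fu)+
    have "(\<integral>x. \<bar>T t v x - T s v x\<bar> \<partial>N)
        \<le> (\<integral>x. \<bar>T t' (T r v) x - ?a x\<bar> + \<bar>?a x - ?b x\<bar> + \<bar>T s' (T r v) x - ?b x\<bar> \<partial>N)"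
    proof (rule Bb_integral_mono[OF Nf])
      show "(\<lambda>x. \<bar>T t v x - T s v x\<bar>) \<in> Bb M"
        using r p by (intro Bb_abs Bb_diff T_Bb v) auto
      show "(\<lambda>x. \<bar>T t' (T r v) x - ?a x\<bar> + \<bar>?a x - ?b x\<bar> + \<bar>T s' (T r v) x - ?b x\<bar>) \<in> Bb M"
        by (intro Bb_add d)
      show "\<bar>T t v x - T s v x\<bar> \<le> \<bar>T t' (T r v) x - ?a x\<bar> + \<bar>?a x - ?b x\<bar> + \<bar>T s' (T r v) x - ?b x\<bar>"
        if x: "x \<in> space M" for x
        unfolding p(5,6) T_semigroup[OF p(1) r v x] T_semigroup[OF p(2) r v x] by linarith
    qed
    also have "\<dots> = (\<integral>x. \<bar>T t' (T r v) x - ?a x\<bar> \<partial>N) + (\<integral>x. \<bar>?a x - ?b x\<bar> \<partial>N) + (\<integral>x. \<bar>T s' (T r v) x - ?b x\<bar> \<partial>N)"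
      using d[THEN Bb_integrable[OF Nf]] by simp
    also have "\<dots> \<le> e / 3 + e / 3 + e / 3"
      using invariant_L1[OF N p(1) Tr fu] invariant_L1[OF N p(2) Tr fu] small \<tau>(2)[OF p(3,4)]
      by (intro add_mono) auto
    finally show ?thesis by simp
  qed
  then show ?thesis using r \<tau>(1) by (intro exI[of _ "r + \<tau>"]) auto
qed

text \<open>
  If uniformity over all measurable sets failed along sets \<open>A n\<close>, a subsequence of \<open>T t0 1\<^bsub>A n\<^esub>\<close> would
  converge pointwise to some \<open>v\<close>, and the Cauchy property for the single function \<open>v\<close> would be violated.
\<close>

lemma L1_Cauchy_uniform:
  assumes N: "invariant N" and e: "0 < e"
  shows "\<exists>\<tau>>0. \<forall>t\<ge>\<tau>. \<forall>s\<ge>\<tau>. \<forall>A\<in>sets M. (\<integral>x. \<bar>T t (indicator A) x - T s (indicator A) x\<bar> \<partial>N) \<le> e"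
proof (rule ccontr)
  assume no: "\<not> ?thesis"
  have Nf: "N \<in> finite_measures M" using N by (simp add: invariant_def)
  note Ns = finite_measuresD[OF Nf]
  have "\<forall>n::nat. \<exists>p. t0 + real (Suc n) \<le> fst p \<and> t0 + real (Suc n) \<le> fst (snd p) \<and> snd (snd p) \<in> sets M \<and>
      e < (\<integral>x. \<bar>T (fst p) (indicator (snd (snd p))) x - T (fst (snd p)) (indicator (snd (snd p))) x\<bar> \<partial>N)"
  proof
    fix n :: nat
    have "0 < t0 + real (Suc n)" using t0 by simp
    then obtain t s A where "t0 + real (Suc n) \<le> t" "t0 + real (Suc n) \<le> s" "A \<in> sets M"
      "\<not> (\<integral>x. \<bar>T t (indicator A) x - T s (indicator A) x\<bar> \<partial>N) \<le> e" using no by blast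
    then show "\<exists>p. t0 + real (Suc n) \<le> fst p \<and> t0 + real (Suc n) \<le> fst (snd p) \<and> snd (snd p) \<in> sets M \<and>
      e < (\<integral>x. \<bar>T (fst p) (indicator (snd (snd p))) x - T (fst (snd p)) (indicator (snd (snd p))) x\<bar> \<partial>N)"
      by (intro exI[of _ "(t, s, A)"]) simp
  qed
  from choice[OF this] obtain p where p: "\<forall>n::nat. t0 + real (Suc n) \<le> fst (p n) \<and> t0 + real (Suc n) \<le> fst (snd (p n)) \<and> snd (snd (p n)) \<in> sets M \<and>
      e < (\<integral>x. \<bar>T (fst (p n)) (indicator (snd (snd (p n)))) x - T (fst (snd (p n))) (indicator (snd (snd (p n)))) x\<bar> \<partial>N)" ..
  define t where "t n = fst (p n) - t0" for n
  define s where "s n = fst (snd (p n)) - t0" for n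
  define A where "A n = snd (snd (p n))" for n
  have ts: "real (Suc n) \<le> t n" "real (Suc n) \<le> s n" for n using spec[OF p, of n] by (simp_all add: t_def s_def)
  have pos: "0 < t n" "0 < s n" for n using ts[of n] by simp_all
  have A: "A n \<in> sets M" and big: "e < (\<integral>x. \<bar>T (t n + t0) (indicator (A n)) x - T (s n + t0) (indicator (A n)) x\<bar> \<partial>N)" for n
    using spec[OF p, of n] by (simp_all add: t_def s_def A_def)
  have ind: "\<bar>indicator (A n) x\<bar> \<le> (1::real)" for n x by (simp add: indicator_def)
  obtain r w where r: "strict_mono (r :: nat \<Rightarrow> nat)" "w \<in> Bb M"
    and lim: "\<And>h x. h \<in> Bb M \<Longrightarrow> x \<in> space M \<Longrightarrow>
      (\<lambda>n. T t0 (\<lambda>y. h y * indicator (A (r n)) y) x) \<longlonglongrightarrow> T t0 (\<lambda>y. h y * w y) x"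
    by (rule T_compactness[of "\<lambda>n. indicator (A n)" 1, OF Bb_indicator[OF A] ind]) (rule that, assumption, assumption, blast)
  define v where "v = T t0 w"
  have v: "v \<in> Bb M" unfolding v_def by (rule T_Bb[OF t0 r(2)])
  define z where "z n = T t0 (indicator (A (r n)))" for n
  have z: "z n \<in> Bb M" for n unfolding z_def by (intro T_Bb t0 Bb_indicator A)
  have zb: "\<bar>z n x\<bar> \<le> 1 * c" if "x \<in> space M" for n x
    unfolding z_def by (rule T_bounded[OF t0 that Bb_indicator[OF A] ind])
  have zlim: "(\<lambda>n. z n x) \<longlonglongrightarrow> v x" if "x \<in> space M" for x
    using lim[OF Bb_const[of 1] that] by (simp add: z_def v_def)
  have "(\<lambda>n. \<integral>x. \<bar>z n x - v x\<bar> \<partial>N) \<longlonglongrightarrow> 0"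
    by (rule Bb_L1_limit[OF Nf z zb _ v]) (auto intro!: AE_I2 zlim simp: Ns)
  then have "\<forall>\<^sub>F n in sequentially. (\<integral>x. \<bar>z n x - v x\<bar> \<partial>N) < e / 3"
    by (rule order_tendstoD) (use e in simp)
  then obtain n0 where n0: "\<And>n. n0 \<le> n \<Longrightarrow> (\<integral>x. \<bar>z n x - v x\<bar> \<partial>N) < e / 3" by (auto simp: eventually_sequentially)
  obtain \<tau> where \<tau>: "\<And>t s. \<tau> \<le> t \<Longrightarrow> \<tau> \<le> s \<Longrightarrow> (\<integral>x. \<bar>T t v x - T s v x\<bar> \<partial>N) \<le> e / 3"
    using L1_Cauchy[OF N v, of "e / 3"] e by auto
  obtain n1 :: nat where n1: "\<tau> \<le> real n1" using real_arch_simple by blast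
  define n where "n = max n0 n1"
  have rn: "n \<le> r n" using r(1) by (rule strict_mono_imp_increasing)
  then have big': "\<tau> \<le> t (r n)" "\<tau> \<le> s (r n)" using ts[of "r n"] n1 by (auto simp: n_def)
  let ?t = "t (r n)" and ?s = "s (r n)"
  have b: "(\<lambda>x. \<bar>T ?t (z n) x - T ?t v x\<bar>) \<in> Bb M" "(\<lambda>x. \<bar>T ?t v x - T ?s v x\<bar>) \<in> Bb M" "(\<lambda>x. \<bar>T ?s (z n) x - T ?s v x\<bar>) \<in> Bb M"
    by (intro Bb_abs Bb_diff T_Bb pos z v)+
  have "(\<integral>x. \<bar>T (?t + t0) (indicator (A (r n))) x - T (?s + t0) (indicator (A (r n))) x\<bar> \<partial>N)
      \<le> (\<integral>x. \<bar>T ?t (z n) x - T ?t v x\<bar> + \<bar>T ?t v x - T ?s v x\<bar> + \<bar>T ?s (z n) x - T ?s v x\<bar> \<partial>N)"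
  proof (rule Bb_integral_mono[OF Nf])
    show "(\<lambda>x. \<bar>T (?t + t0) (indicator (A (r n))) x - T (?s + t0) (indicator (A (r n))) x\<bar>) \<in> Bb M"
      by (intro Bb_abs Bb_diff T_Bb add_pos_pos pos t0 Bb_indicator A)
    show "(\<lambda>x. \<bar>T ?t (z n) x - T ?t v x\<bar> + \<bar>T ?t v x - T ?s v x\<bar> + \<bar>T ?s (z n) x - T ?s v x\<bar>) \<in> Bb M"
      by (intro Bb_add b)
    show "\<bar>T (?t + t0) (indicator (A (r n))) x - T (?s + t0) (indicator (A (r n))) x\<bar>
        \<le> \<bar>T ?t (z n) x - T ?t v x\<bar> + \<bar>T ?t v x - T ?s v x\<bar> + \<bar>T ?s (z n) x - T ?s v x\<bar>" if x: "x \<in> space M" for x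
      unfolding T_semigroup[OF pos(1) t0 Bb_indicator[OF A] x] T_semigroup[OF pos(2) t0 Bb_indicator[OF A] x] z_def by linarith
  qed
  also have "\<dots> = (\<integral>x. \<bar>T ?t (z n) x - T ?t v x\<bar> \<partial>N) + (\<integral>x. \<bar>T ?t v x - T ?s v x\<bar> \<partial>N) + (\<integral>x. \<bar>T ?s (z n) x - T ?s v x\<bar> \<partial>N)"
    using b[THEN Bb_integrable[OF Nf]] by simp
  also have "\<dots> \<le> e / 3 + e / 3 + e / 3"
    using invariant_L1[OF N pos(1) z v, of "r n" n] invariant_L1[OF N pos(2) z v, of "r n" n] \<tau>[OF big'] n0[of n]
    by (intro add_mono) (auto simp: n_def)
  finally show False using big[of "r n"] by simp
qed

text \<open>
  The integrand is bounded by \<open>2 c\<close>, so a density in \<open>L\<^sup>1(N0)\<close> may be truncated at the cost of a small error, and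
  for a bounded density the claim is \<open>L1_Cauchy_uniform\<close>.
\<close>

lemma abs_cont_Cauchy:
  assumes N0: "invariant N0" and N: "N \<in> finite_measures M" and ac: "absolutely_continuous N0 N" and e: "0 < e"
  shows "\<exists>\<tau>>0. \<forall>t\<ge>\<tau>. \<forall>s\<ge>\<tau>. \<forall>A\<in>sets M. (\<integral>x. \<bar>T t (indicator A) x - T s (indicator A) x\<bar> \<partial>N) \<le> e"
proof -
  have N0f: "N0 \<in> finite_measures M" using N0 by (simp add: invariant_def)
  note Ns = finite_measuresD[OF N0f]
  obtain D where D: "D \<in> borel_measurable M" "\<And>x. 0 \<le> D x" "integrable N0 D"
    and Dint: "\<And>u. u \<in> Bb M \<Longrightarrow> (\<integral>x. u x \<partial>N) = (\<integral>x. D x * u x \<partial>N0)"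
    by (rule real_density[OF N0f N ac]) blast
  \<comment> \<open>Truncating the density at a large \<open>j\<close> changes the integrals by at most \<open>e / 2\<close>.\<close>
  have "(\<lambda>j. \<integral>x. D x - min (D x) (real j) \<partial>N0) \<longlonglongrightarrow> (\<integral>x. 0 \<partial>N0)"
  proof (rule integral_dominated_convergence[where w=D])
    have Dm: "D \<in> borel_measurable N0" by (rule borel_measurable_integrable[OF D(3)])
    show "(\<lambda>x. D x - min (D x) (real j)) \<in> borel_measurable N0" for j using Dm by measurable
    show "AE x in N0. (\<lambda>j. D x - min (D x) (real j)) \<longlonglongrightarrow> 0"
    proof (rule AE_I2)
      fix x
      obtain k :: nat where k: "D x \<le> real k" using real_arch_simple by blast
      have "D x - min (D x) (real j) = 0" if "k \<le> j" for j using that k by simp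
      then have "\<forall>\<^sub>F j in sequentially. D x - min (D x) (real j) = 0" by (auto simp: eventually_sequentially)
      then show "(\<lambda>j. D x - min (D x) (real j)) \<longlonglongrightarrow> 0" by (rule tendsto_eventually)
    qed
    show "AE x in N0. norm (D x - min (D x) (real j)) \<le> D x" for j
      using D(2) by (intro AE_I2) (simp add: min_def)
  qed (use D in auto)
  then have "(\<lambda>j. 2 * c * (\<integral>x. D x - min (D x) (real j) \<partial>N0)) \<longlonglongrightarrow> 0"
    using tendsto_mult_left[of _ 0 sequentially "2 * c"] by simp
  then have "\<forall>\<^sub>F j in sequentially. 2 * c * (\<integral>x. D x - min (D x) (real j) \<partial>N0) < e / 2"
    by (rule order_tendstoD) (use e in simp)
  then obtain j where j: "2 * c * (\<integral>x. D x - min (D x) (real j) \<partial>N0) < e / 2" by (auto simp: eventually_sequentially)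
  define e' where "e' = e / (2 * (real j + 1))"
  have e': "0 < e'" "real j * e' \<le> e / 2"
  proof -
    show "0 < e'" using e by (simp add: e'_def)
    have "real j / (real j + 1) \<le> 1" by simp
    then have "e / 2 * (real j / (real j + 1)) \<le> e / 2 * 1" using e by (intro mult_left_mono) auto
    then show "real j * e' \<le> e / 2" by (simp add: e'_def mult.commute)
  qed
  obtain \<tau> where \<tau>: "0 < \<tau>" "\<And>t s A. \<tau> \<le> t \<Longrightarrow> \<tau> \<le> s \<Longrightarrow> A \<in> sets M \<Longrightarrow>
      (\<integral>x. \<bar>T t (indicator A) x - T s (indicator A) x\<bar> \<partial>N0) \<le> e'"
    using L1_Cauchy_uniform[OF N0 e'(1)] by blast
  have "(\<integral>x. \<bar>T t (indicator A) x - T s (indicator A) x\<bar> \<partial>N) \<le> e" if ts: "\<tau> \<le> t" "\<tau> \<le> s" and A: "A \<in> sets M" for t s A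
  proof -
    have p: "0 < t" "0 < s" using ts \<tau>(1) by simp_all
    let ?d = "\<lambda>x. \<bar>T t (indicator A) x - T s (indicator A) x\<bar>"
    have d: "?d \<in> Bb M" by (intro Bb_abs Bb_diff T_Bb p Bb_indicator A)
    have db: "?d x \<le> 2 * c" if "x \<in> space M" for x
      using T_bounded[OF p(1) that Bb_indicator[OF A], of 1] T_bounded[OF p(2) that Bb_indicator[OF A], of 1]
      by (simp add: indicator_def)
    have i: "integrable N0 ?d" "integrable N0 (\<lambda>x. D x * ?d x)" "integrable N0 (\<lambda>x. D x - min (D x) (real j))"
      using Bb_integrable[OF N0f d] integrable_mult_Bb[OF N0f D(3) d] D(3) Bb_integrable[OF N0f Bb_const[of "real j"]]
      by auto
    have "(\<integral>x. ?d x \<partial>N) = (\<integral>x. D x * ?d x \<partial>N0)" by (rule Dint[OF d])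
    also have "\<dots> \<le> (\<integral>x. real j * ?d x + 2 * c * (D x - min (D x) (real j)) \<partial>N0)"
    proof (rule integral_mono)
      show "integrable N0 (\<lambda>x. real j * ?d x + 2 * c * (D x - min (D x) (real j)))" using i by auto
      fix x assume "x \<in> space N0"
      then have x: "x \<in> space M" using Ns by simp
      have "D x * ?d x = min (D x) (real j) * ?d x + (D x - min (D x) (real j)) * ?d x"
        by (simp add: algebra_simps)
      also have "\<dots> \<le> real j * ?d x + (D x - min (D x) (real j)) * (2 * c)"
        by (intro add_mono mult_right_mono mult_left_mono db[OF x]) auto
      finally show "D x * ?d x \<le> real j * ?d x + 2 * c * (D x - min (D x) (real j))" by (simp add: mult.commute)
    qed (rule i)
    also have "\<dots> = real j * (\<integral>x. ?d x \<partial>N0) + 2 * c * (\<integral>x. D x - min (D x) (real j) \<partial>N0)"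
      using i by simp
    also have "\<dots> \<le> e / 2 + e / 2"
    proof (rule add_mono)
      have "real j * (\<integral>x. ?d x \<partial>N0) \<le> real j * e'" by (intro mult_left_mono \<tau>(2) ts A) simp
      then show "real j * (\<integral>x. ?d x \<partial>N0) \<le> e / 2" using e'(2) by linarith
    qed (use j in simp)
    finally show ?thesis by simp
  qed
  then show ?thesis using \<tau>(1) by blast
qed

end

section \<open>Convergence on the whole space\<close>

lemma simple_approximation:
  assumes u: "u \<in> Bb M" and e: "0 < e"
  shows "\<exists>(k::nat) A a. (\<forall>i<k. A i \<in> sets M) \<and> (\<forall>x\<in>space M. \<bar>u x - (\<Sum>i<k. a i * indicator (A i) x)\<bar> \<le> (e::real))"
proof -
  obtain b where b: "\<And>x. x \<in> space M \<Longrightarrow> \<bar>u x\<bar> \<le> b" by (rule BbE[OF u]) blast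
  define q where "q x = \<lfloor>(u x + b) / e\<rfloor>" for x
  obtain k :: nat where k: "2 * b / e < real k" using reals_Archimedean2 by blast
  define A where "A i = {x \<in> space M. q x = int i}" for i :: nat
  have "A i \<in> sets M" for i
    unfolding A_def q_def using Bb_measurable[OF u] by measurable
  moreover have "\<bar>u x - (\<Sum>i<k. (e * real i - b) * indicator (A i) x)\<bar> \<le> e" if x: "x \<in> space M" for x
  proof -
    have "0 \<le> (u x + b) / e" "(u x + b) / e \<le> 2 * b / e"
      using b[OF x] e by (auto simp: abs_le_iff intro!: divide_right_mono)
    then have q: "0 \<le> q x" "q x < int k" using k unfolding q_def by linarith+
    have ind: "(e * real i - b) * indicator (A i) x = (if i = nat (q x) then e * real i - b else 0)" for i
      using x q(1) by (auto simp: A_def indicator_def)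
    have "nat (q x) \<in> {..<k}" using q by (simp add: nat_less_iff)
    then have "(\<Sum>i<k. (e * real i - b) * indicator (A i) x) = e * real (nat (q x)) - b"
      unfolding ind by (subst sum.delta) simp_all
    moreover have "e * of_int (q x) \<le> u x + b" "u x + b \<le> e * (of_int (q x) + 1)"
    proof -
      have "of_int (q x) \<le> (u x + b) / e" "(u x + b) / e \<le> of_int (q x) + 1"
        unfolding q_def by linarith+
      then show "e * of_int (q x) \<le> u x + b" "u x + b \<le> e * (of_int (q x) + 1)"
        using e by (simp_all add: field_simps)
    qed
    ultimately show ?thesis using q(1) by (simp add: abs_le_iff algebra_simps)
  qed
  ultimately have "(\<forall>i<k. A i \<in> sets M) \<and>
      (\<forall>x\<in>space M. \<bar>u x - (\<Sum>i<k. (e * real i - b) * indicator (A i) x)\<bar> \<le> e)" by simp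
  then show ?thesis by (intro exI[of _ k] exI[of _ A] exI[of _ "\<lambda>i. e * real i - b"])
qed

text \<open>
  The masses of a setwise convergent sequence are bounded, so a uniform approximation by simple functions
  controls all the integrals at once. Bounded pointwise approximation would not be uniform along the sequence.
\<close>

lemma setwise_limit_integral:
  assumes \<nu>: "\<And>n::nat. \<nu> n \<in> finite_measures M" and N: "N \<in> finite_measures M"
    and lim: "\<And>A. A \<in> sets M \<Longrightarrow> (\<lambda>n. measure (\<nu> n) A) \<longlonglongrightarrow> measure N A"
    and u: "u \<in> Bb M"
  shows "(\<lambda>n. \<integral>x. u x \<partial>\<nu> n) \<longlonglongrightarrow> (\<integral>x. u x \<partial>N)"
proof -
  have "Bseq (\<lambda>n. measure (\<nu> n) (space M))" by (rule convergent_imp_Bseq[OF convergentI[OF lim[OF sets.top]]])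
  then obtain B0 where "\<And>n. \<bar>measure (\<nu> n) (space M)\<bar> \<le> B0" by (auto simp: Bseq_def)
  then have B0: "measure (\<nu> n) (space M) \<le> B0" for n using abs_le_D1 by blast
  define B where "B = max 1 (max B0 (measure N (space M)))"
  have B: "0 < B" "measure (\<nu> n) (space M) \<le> B" "measure N (space M) \<le> B" for n
    using B0[of n] by (auto simp: B_def)
  show ?thesis
  proof (rule tendsto_approx)
    fix e :: real assume e: "0 < e"
    then have "0 < e / B" using B by simp
    from simple_approximation[OF u this]
    obtain k :: nat and A a where kAa: "(\<forall>i<k. A i \<in> sets M) \<and>
        (\<forall>x\<in>space M. \<bar>u x - (\<Sum>i<k. a i * indicator (A i) x)\<bar> \<le> e / B)"
      by (elim exE)
    then have A: "i < k \<Longrightarrow> A i \<in> sets M" for i by simp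
    have ap: "\<bar>u x - (\<Sum>i<k. a i * indicator (A i) x)\<bar> \<le> e / B" if "x \<in> space M" for x
      by (rule bspec[OF conjunct2[OF kAa] that])
    define s where "s x = (\<Sum>i<k. a i * indicator (A i) x)" for x :: 'a
    have ints: "(\<integral>x. s x \<partial>R) = (\<Sum>i<k. a i * measure R (A i))" and close: "\<bar>(\<integral>x. u x \<partial>R) - (\<integral>x. s x \<partial>R)\<bar> \<le> e"
      if R: "R \<in> finite_measures M" "measure R (space M) \<le> B" for R
    proof -
      note Rs = finite_measuresD[OF R(1)]
      have i: "integrable R (\<lambda>x. a i * indicator (A i) x)" if "i < k" for i
        by (intro Bb_integrable[OF R(1)] Bb_mult Bb_const Bb_indicator A that)
      have "(\<integral>x. s x \<partial>R) = (\<Sum>i<k. \<integral>x. a i * indicator (A i) x \<partial>R)"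
        unfolding s_def by (rule Bochner_Integration.integral_sum) (use i in auto)
      also have "\<dots> = (\<Sum>i<k. a i * measure R (A i))"
      proof (rule sum.cong[OF refl])
        fix i assume "i \<in> {..<k}"
        then have "A i \<in> sets R" using A Rs by simp
        then show "(\<integral>x. a i * indicator (A i) x \<partial>R) = a i * measure R (A i)"
          by (simp add: Int_absorb2 sets.sets_into_space)
      qed
      finally show "(\<integral>x. s x \<partial>R) = (\<Sum>i<k. a i * measure R (A i))" .
      have si: "integrable R s" unfolding s_def[abs_def] by (rule Bochner_Integration.integrable_sum) (use i in auto)
      have ui: "integrable R u" by (rule Bb_integrable[OF R(1) u])
      have "\<bar>(\<integral>x. u x \<partial>R) - (\<integral>x. s x \<partial>R)\<bar> = \<bar>\<integral>x. u x - s x \<partial>R\<bar>" using si ui by simp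
      also have "\<dots> \<le> (\<integral>x. \<bar>u x - s x\<bar> \<partial>R)" by (rule integral_abs_bound)
      also have "\<dots> \<le> (\<integral>x. e / B \<partial>R)"
      proof (rule integral_mono)
        show "integrable R (\<lambda>x. \<bar>u x - s x\<bar>)" using si ui by simp
        show "integrable R (\<lambda>x. e / B)" by (rule Bb_integrable[OF R(1) Bb_const])
        show "\<bar>u x - s x\<bar> \<le> e / B" if "x \<in> space R" for x
          using ap that Rs unfolding s_def by simp
      qed
      also have "\<dots> = e / B * measure R (space M)" using Rs by simp
      also have "\<dots> \<le> e / B * B" using e B(1) by (intro mult_left_mono R(2)) simp
      finally show "\<bar>(\<integral>x. u x \<partial>R) - (\<integral>x. s x \<partial>R)\<bar> \<le> e" using B(1) by simp
    qed
    have "(\<lambda>n. \<integral>x. s x \<partial>\<nu> n) \<longlonglongrightarrow> (\<integral>x. s x \<partial>N)"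
      unfolding ints[OF \<nu> B(2)] ints[OF N B(3)] by (intro tendsto_sum tendsto_mult_left lim A) simp
    then show "\<exists>b l'. b \<longlonglongrightarrow> l' \<and> (\<forall>n. \<bar>(\<integral>x. u x \<partial>\<nu> n) - b n\<bar> \<le> e) \<and> \<bar>(\<integral>x. u x \<partial>N) - l'\<bar> \<le> e"
      using close[OF \<nu> B(2)] close[OF N B(3)] by blast
  qed
qed

lemma measure_decseq_empty:
  assumes N: "N \<in> finite_measures M" and A: "\<And>n::nat. A n \<in> sets M" "decseq A" "(\<Inter>n. A n) = {}"
  shows "(\<lambda>n. measure N (A n)) \<longlonglongrightarrow> 0"
proof -
  interpret finite_measure N by (rule finite_measuresD[OF N])
  have "(\<lambda>k. measure N (A k)) \<longlonglongrightarrow> measure N (\<Inter>k. A k)"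
    by (rule finite_Lim_measure_decseq) (use A(1,2) finite_measuresD[OF N] in auto)
  then show ?thesis by (simp add: A(3))
qed

lemma integral_mono_finite_measures:
  assumes P: "P \<in> finite_measures M" and Q: "Q \<in> finite_measures M"
    and le: "\<And>A. A \<in> sets M \<Longrightarrow> measure P A \<le> measure Q A"
    and u: "u \<in> Bb M" "\<And>x. x \<in> space M \<Longrightarrow> 0 \<le> u x"
  shows "(\<integral>x. u x \<partial>P) \<le> (\<integral>x. u x \<partial>Q)"
proof -
  note Ps = finite_measuresD[OF P] and Qs = finite_measuresD[OF Q]
  have "\<exists>R\<in>finite_measures M. \<forall>A\<in>sets M. measure R A = measure Q A - measure P A"
  proof (rule finite_measure_exists)
    fix A B assume "A \<in> sets M" "B \<in> sets M" "A \<inter> B = {}"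
    then show "measure Q (A \<union> B) - measure P (A \<union> B) = measure Q A - measure P A + (measure Q B - measure P B)"
      using finite_measure.finite_measure_Union[OF Ps(1), of A B] finite_measure.finite_measure_Union[OF Qs(1), of A B] Ps Qs
      by simp
  next
    fix A :: "nat \<Rightarrow> 'a set" assume A: "\<And>n. A n \<in> sets M" "decseq A" "(\<Inter>n. A n) = {}"
    show "(\<lambda>n. measure Q (A n) - measure P (A n)) \<longlonglongrightarrow> 0"
      using tendsto_diff[OF measure_decseq_empty[OF Q A] measure_decseq_empty[OF P A]] by simp
  qed (use le in simp)
  then obtain R where R: "R \<in> finite_measures M" "\<And>A. A \<in> sets M \<Longrightarrow> measure R A = measure Q A - measure P A" by blast
  \<comment> \<open>The difference of the measures, regarded as a signed measure, is represented by \<open>R - 0\<close> and by \<open>Q - P\<close>.\<close>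
  have "pairing M (measure R) u = (\<integral>x. u x \<partial>Q) - (\<integral>x. u x \<partial>P)"
    by (rule pairing_eq[OF measure_in_signed_measures[OF R(1)] Q P R(2) u(1)])
  moreover have "null_measure M \<in> finite_measures M"
    by (intro finite_measuresI finite_measureI) auto
  then have "pairing M (measure R) u = (\<integral>x. u x \<partial>R) - (\<integral>x. u x \<partial>null_measure M)"
    by (rule pairing_eq[OF measure_in_signed_measures[OF R(1)] R(1) _ _ u(1)]) (simp add: measure_def)
  moreover have "(\<integral>x. u x \<partial>null_measure M) = 0" by simp
  moreover have "0 \<le> (\<integral>x. u x \<partial>R)"
    using u(2) finite_measuresD[OF R(1)] by (intro integral_nonneg_AE AE_I2) auto
  ultimately show ?thesis by linarith
qed

text \<open>
  The orbit of \<open>p\<close> under the adjoint semigroup increases, and its mass stays bounded. The setwise limit along integer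
  times is also the limit along all times by monotonicity, hence invariant.
\<close>

lemma (in kernel_semigroup) invariant_majorant:
  assumes p: "p \<in> finite_measures M"
    and sub: "\<And>t A. 0 < t \<Longrightarrow> A \<in> sets M \<Longrightarrow> measure p A \<le> (\<integral>x. T t (indicator A) x \<partial>p)"
  obtains N where "invariant N" "\<And>A. A \<in> sets M \<Longrightarrow> measure p A \<le> measure N A"
proof -
  note ps = finite_measuresD[OF p]
  have subu: "(\<integral>x. u x \<partial>p) \<le> (\<integral>x. T t u x \<partial>p)" if t: "0 < t" and u: "u \<in> Bb M" "\<And>x. x \<in> space M \<Longrightarrow> 0 \<le> u x" for t u
  proof -
    obtain Q where Q: "Q \<in> finite_measures M" "\<And>u. u \<in> Bb M \<Longrightarrow> (\<integral>x. u x \<partial>Q) = (\<integral>x. T t u x \<partial>p)"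
      "\<And>A. A \<in> sets M \<Longrightarrow> measure Q A = (\<integral>x. T t (indicator A) x \<partial>p)"
      by (rule adjoint[OF p t]) blast
    have "(\<integral>x. u x \<partial>p) \<le> (\<integral>x. u x \<partial>Q)"
      by (rule integral_mono_finite_measures[OF p Q(1) _ u]) (use Q(3) sub[OF t] in auto)
    then show ?thesis using Q(2)[OF u(1)] by simp
  qed
  define \<alpha> where "\<alpha> A s = (\<integral>x. T s (indicator A) x \<partial>p)" for A s
  have mono: "\<alpha> A s \<le> \<alpha> A s'" if "A \<in> sets M" "0 < s" "s \<le> s'" for A s s'
  proof (cases "s = s'")
    case False
    then have d: "0 < s' - s" using that by simp
    have "\<alpha> A s \<le> (\<integral>x. T (s' - s) (T s (indicator A)) x \<partial>p)"
      unfolding \<alpha>_def by (rule subu[OF d T_Bb[OF that(2) Bb_indicator[OF that(1)]]]) (rule T_nonneg[OF that(2)], auto)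
    also have "\<dots> = \<alpha> A s'"
      unfolding \<alpha>_def
      by (rule Bochner_Integration.integral_cong)
        (use T_semigroup[OF d that(2) Bb_indicator[OF that(1)]] ps in auto)
    finally show ?thesis .
  qed simp
  have bdd: "\<alpha> A s \<le> c * measure p (space M)" if "A \<in> sets M" "0 < s" for A s
  proof -
    have "\<alpha> A s \<le> (\<integral>x. c \<partial>p)"
      unfolding \<alpha>_def
    proof (rule Bb_integral_mono[OF p T_Bb[OF that(2) Bb_indicator[OF that(1)]] Bb_const])
      show "T s (indicator A) x \<le> c" if "x \<in> space M" for x
        using T_bounded[OF \<open>0 < s\<close> that Bb_indicator[OF \<open>A \<in> sets M\<close>], of 1] by (simp add: indicator_def)
    qed
    then show ?thesis using ps by (simp add: mult.commute)
  qed
  define L where "L A = lim (\<lambda>n. \<alpha> A (real (Suc n)))" for A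
  have Llim: "(\<lambda>n. \<alpha> A (real (Suc n))) \<longlonglongrightarrow> L A" and Lub: "\<alpha> A (real (Suc n)) \<le> L A" if A: "A \<in> sets M" for A n
  proof -
    have "incseq (\<lambda>n. \<alpha> A (real (Suc n)))" by (rule incseq_SucI, rule mono[OF A]) auto
    then obtain l where l: "(\<lambda>n. \<alpha> A (real (Suc n))) \<longlonglongrightarrow> l" "\<forall>n. \<alpha> A (real (Suc n)) \<le> l"
      by (rule incseq_convergent[of _ "c * measure p (space M)"]) (use bdd[OF A] in auto)
    moreover have "L A = l" unfolding L_def by (rule limI[OF l(1)])
    ultimately show "(\<lambda>n. \<alpha> A (real (Suc n))) \<longlonglongrightarrow> L A" "\<alpha> A (real (Suc n)) \<le> L A" by auto
  qed
  have "\<exists>Q. Q \<in> finite_measures M \<and> (\<forall>u\<in>Bb M. (\<integral>x. u x \<partial>Q) = (\<integral>x. T (real (Suc n)) u x \<partial>p)) \<and>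
    (\<forall>A\<in>sets M. measure Q A = \<alpha> A (real (Suc n)))" for n
    by (rule adjoint[OF p, of "real (Suc n)"]) (auto simp: \<alpha>_def)
  then obtain Q where Q: "\<And>n. Q n \<in> finite_measures M"
    "\<And>n u. u \<in> Bb M \<Longrightarrow> (\<integral>x. u x \<partial>Q n) = (\<integral>x. T (real (Suc n)) u x \<partial>p)"
    "\<And>n A. A \<in> sets M \<Longrightarrow> measure (Q n) A = \<alpha> A (real (Suc n))"
    by metis
  have Qlim: "(\<lambda>n. measure (Q n) A) \<longlonglongrightarrow> L A" if "A \<in> sets M" for A
    using Llim[OF that] Q(3)[OF that] by simp
  obtain N where N: "N \<in> finite_measures M" "\<And>A. A \<in> sets M \<Longrightarrow> measure N A = L A"
    using setwise_limit_is_measure[OF Q(1) Qlim] by blast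
  have "(\<integral>x. T t (indicator A) x \<partial>N) = measure N A" if t: "0 < t" and A: "A \<in> sets M" for t A
  proof -
    have TA: "T t (indicator A) \<in> Bb M" by (intro T_Bb t Bb_indicator A)
    have 1: "(\<lambda>n. \<integral>x. T t (indicator A) x \<partial>Q n) \<longlonglongrightarrow> (\<integral>x. T t (indicator A) x \<partial>N)"
      by (rule setwise_limit_integral[OF Q(1) N(1) _ TA]) (use Qlim N(2) in simp)
    have eq: "(\<integral>x. T t (indicator A) x \<partial>Q n) = \<alpha> A (real (Suc n) + t)" for n
      unfolding Q(2)[OF TA] \<alpha>_def
      by (rule Bochner_Integration.integral_cong) (use T_semigroup[OF _ t Bb_indicator[OF A]] ps in auto)
    obtain k :: nat where k: "t \<le> real k" using real_arch_simple by blast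
    have "(\<lambda>n. \<integral>x. T t (indicator A) x \<partial>Q n) \<longlonglongrightarrow> L A"
      unfolding eq
    proof (rule tendsto_sandwich[OF _ _ Llim[OF A] LIMSEQ_ignore_initial_segment[OF Llim[OF A], of k]])
      show "\<forall>\<^sub>F n in sequentially. \<alpha> A (real (Suc n)) \<le> \<alpha> A (real (Suc n) + t)"
        using t by (intro always_eventually allI mono A) auto
      show "\<forall>\<^sub>F n in sequentially. \<alpha> A (real (Suc n) + t) \<le> \<alpha> A (real (Suc (n + k)))"
        using t k by (intro always_eventually allI mono A) auto
    qed
    then show ?thesis using LIMSEQ_unique[OF 1] N(2)[OF A] by simp
  qed
  then have "invariant N" using N(1) by (simp add: invariant_def)
  moreover have "measure p A \<le> measure N A" if A: "A \<in> sets M" for A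
    using sub[of "real (Suc 0)" A] Lub[OF A, of 0] N(2)[OF A] A by (simp add: \<alpha>_def)
  ultimately show ?thesis using that by blast
qed

context abs_cont_kernel_semigroup
begin

text \<open>
  Let \<open>C\<close> support the maximal invariant measure. The fixed function that dominates the orbit of the
  indicator of the complement of \<open>C\<close> vanishes under all invariant measures, hence is zero, so each orbit
  of measures loses its mass outside \<open>C\<close>; what has arrived in \<open>C\<close> converges.
\<close>

theorem Cauchy_if_separated:
  assumes sep: "\<And>f. fixed f \<Longrightarrow> (\<And>x. x \<in> space M \<Longrightarrow> 0 \<le> f x) \<Longrightarrow>
      (\<And>N. invariant N \<Longrightarrow> (\<integral>x. f x \<partial>N) = 0) \<Longrightarrow> (\<And>x. x \<in> space M \<Longrightarrow> f x = 0)"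
    and N: "N \<in> finite_measures M" and e: "0 < e"
  shows "\<exists>\<tau>>0. \<forall>t\<ge>\<tau>. \<forall>s\<ge>\<tau>. \<forall>A\<in>sets M. \<bar>(\<integral>x. T t (indicator A) x \<partial>N) - (\<integral>x. T s (indicator A) x \<partial>N)\<bar> \<le> e"
proof -
  note Ns = finite_measuresD[OF N]
  obtain N0 where N0: "invariant N0" "\<And>N. invariant N \<Longrightarrow> absolutely_continuous N0 N"
    by (rule maximal_invariant_measure) blast
  have N0f: "N0 \<in> finite_measures M" using N0 by (simp add: invariant_def)
  obtain C where C: "C \<in> sets M" "measure N0 (space M - C) = 0"
    "\<And>A. A \<in> sets M \<Longrightarrow> measure N0 A = 0 \<Longrightarrow> measure \<mu> (A \<inter> C) = 0"
    by (rule invariant_support[OF N0(1)]) blast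
  have Cc: "space M - C \<in> sets M" using C(1) by blast
  let ?g = "indicator (space M - C) :: 'a \<Rightarrow> real"
  have g: "?g \<in> Bb M" by (rule Bb_indicator[OF Cc])
  obtain f err B where f: "fixed f" "\<And>x. x \<in> space M \<Longrightarrow> 0 \<le> f x"
    and err: "\<And>m::nat. err m \<in> Bb M" "\<And>m x. x \<in> space M \<Longrightarrow> 0 \<le> err m x \<and> err m x \<le> B"
      "\<And>x. x \<in> space M \<Longrightarrow> (\<lambda>m. err m x) \<longlonglongrightarrow> 0"
    and dom: "\<And>m t x. t0 + real (Suc m) \<le> t \<Longrightarrow> x \<in> space M \<Longrightarrow> T t ?g x \<le> f x + err m x"
    and inv: "\<And>N. invariant N \<Longrightarrow> (\<integral>x. ?g x \<partial>N) = 0 \<Longrightarrow> (\<integral>x. f x \<partial>N) = 0"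
    by (rule dominating_fixed_function[OF g]) (simp, rule that)
  have f0: "f x = 0" if "x \<in> space M" for x
  proof (rule sep[OF f _ that])
    fix N' assume N': "invariant N'"
    then have N'f: "N' \<in> finite_measures M" by (simp add: invariant_def)
    have "measure N' (space M - C) = 0"
      using absolutely_continuous_iff[OF N0f N'f] N0(2)[OF N'] C(2) Cc by blast
    then have "(\<integral>x. ?g x \<partial>N') = 0"
      using Cc finite_measuresD[OF N'f] by (simp add: Int_absorb2 sets.sets_into_space)
    then show "(\<integral>x. f x \<partial>N') = 0" by (rule inv[OF N'])
  qed
  have "(\<lambda>m. \<integral>x. err m x \<partial>N) \<longlonglongrightarrow> (\<integral>x. 0 \<partial>N)"
    by (rule Bb_dominated_convergence[OF N err(1), where c=B])
      (use err(2,3) Ns in \<open>auto intro!: AE_I2 Bb_const simp: abs_le_iff\<close>)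
  then have "(\<lambda>m. c * (\<integral>x. err m x \<partial>N)) \<longlonglongrightarrow> 0"
    using tendsto_mult_left[of _ 0 sequentially c] by simp
  then have "\<forall>\<^sub>F m in sequentially. c * (\<integral>x. err m x \<partial>N) < e / 3"
    by (rule order_tendstoD) (use e in simp)
  then obtain m where m: "c * (\<integral>x. err m x \<partial>N) < e / 3" by (auto simp: eventually_sequentially)
  define r where "r = t0 + real (Suc m)"
  have r: "0 < r" "t0 \<le> r" using t0 by (simp_all add: r_def)
  obtain Q where Q: "Q \<in> finite_measures M"
    "\<And>u. u \<in> Bb M \<Longrightarrow> (\<integral>x. u x \<partial>Q) = (\<integral>x. T r (\<lambda>y. indicator C y * u y) x \<partial>N)"
    by (rule pushforward[OF N r(1) C(1)]) blast
  have "measure Q A = 0" if A: "A \<in> sets M" "measure N0 A = 0" for A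
  proof -
    have AC: "A \<inter> C \<in> sets M" using A C(1) by blast
    have "measure Q A = (\<integral>x. indicator A x \<partial>Q)"
      using A finite_measuresD[OF Q(1)] by (simp add: Int_absorb2 sets.sets_into_space)
    also have "\<dots> = (\<integral>x. T r (\<lambda>y. indicator C y * indicator A y) x \<partial>N)" by (rule Q(2)[OF Bb_indicator[OF A(1)]])
    also have "\<dots> = (\<integral>x. 0 \<partial>N)"
    proof (rule Bochner_Integration.integral_cong[OF refl])
      fix x assume "x \<in> space N"
      then have x: "x \<in> space M" using Ns by simp
      have "T r (\<lambda>y. indicator C y * indicator A y) x = T r (indicator (A \<inter> C)) x"
        by (rule T_cong[OF r(1) x]) (simp add: indicator_inter_arith)
      then show "T r (\<lambda>y. indicator C y * indicator A y) x = 0" using T_null[OF r(2) AC C(3)[OF A] x] by simp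
    qed
    finally show ?thesis by simp
  qed
  then have "absolutely_continuous N0 Q" using absolutely_continuous_iff[OF N0f Q(1)] by blast
  from abs_cont_Cauchy[OF N0(1) Q(1) this, of "e / 3"] e
  obtain \<tau> where \<tau>: "0 < \<tau>" "\<And>t s A. \<tau> \<le> t \<Longrightarrow> \<tau> \<le> s \<Longrightarrow> A \<in> sets M \<Longrightarrow>
      (\<integral>x. \<bar>T t (indicator A) x - T s (indicator A) x\<bar> \<partial>Q) \<le> e / 3" by auto
  have approx: "\<bar>(\<integral>x. T (r + t) (indicator A) x \<partial>N) - (\<integral>x. T t (indicator A) x \<partial>Q)\<bar> \<le> e / 3"
    if t: "0 < t" and A: "A \<in> sets M" for t A
  proof -
    let ?u = "T t (indicator A)"
    have u: "?u \<in> Bb M" by (intro T_Bb t Bb_indicator A)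
    have ub: "0 \<le> ?u x" "?u x \<le> c" if "x \<in> space M" for x
      using T_nonneg[OF t that, of "indicator A"] T_bounded[OF t that Bb_indicator[OF A], of 1] by (auto simp: indicator_def)
    have Cu: "(\<lambda>y. indicator C y * ?u y) \<in> Bb M" "(\<lambda>y. ?g y * ?u y) \<in> Bb M"
      by (intro Bb_mult Bb_indicator C(1) Cc u)+
    have split: "T (r + t) (indicator A) x = T r (\<lambda>y. indicator C y * ?u y) x + T r (\<lambda>y. ?g y * ?u y) x"
      if x: "x \<in> space M" for x
    proof -
      have "T (r + t) (indicator A) x = T r ?u x" by (rule T_semigroup[OF r(1) t Bb_indicator[OF A] x])
      also have "\<dots> = T r (\<lambda>y. indicator C y * ?u y + ?g y * ?u y) x"
        by (rule T_cong[OF r(1) x]) (simp add: indicator_def)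
      also have "\<dots> = T r (\<lambda>y. indicator C y * ?u y) x + T r (\<lambda>y. ?g y * ?u y) x"
        by (rule T_add[OF r(1) x Cu])
      finally show ?thesis .
    qed
    have "(\<integral>x. T (r + t) (indicator A) x \<partial>N)
        = (\<integral>x. T r (\<lambda>y. indicator C y * ?u y) x + T r (\<lambda>y. ?g y * ?u y) x \<partial>N)"
      by (rule Bochner_Integration.integral_cong) (use split Ns in auto)
    also have "\<dots> = (\<integral>x. ?u x \<partial>Q) + (\<integral>x. T r (\<lambda>y. ?g y * ?u y) x \<partial>N)"
      unfolding Q(2)[OF u]
      by (intro Bochner_Integration.integral_add Bb_integrable[OF N] T_Bb r Cu)
    finally have eq: "(\<integral>x. T (r + t) (indicator A) x \<partial>N) - (\<integral>x. ?u x \<partial>Q) = (\<integral>x. T r (\<lambda>y. ?g y * ?u y) x \<partial>N)" by simp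
    have "0 \<le> (\<integral>x. T r (\<lambda>y. ?g y * ?u y) x \<partial>N)"
      by (intro integral_nonneg_AE AE_I2 T_nonneg[OF r(1)]) (use ub Ns in auto)
    moreover have "(\<integral>x. T r (\<lambda>y. ?g y * ?u y) x \<partial>N) \<le> (\<integral>x. c * err m x \<partial>N)"
    proof (rule Bb_integral_mono[OF N T_Bb[OF r(1) Cu(2)] Bb_mult[OF Bb_const err(1)]])
      fix x assume x: "x \<in> space M"
      have "T r (\<lambda>y. ?g y * ?u y) x \<le> T r (\<lambda>y. c * ?g y) x"
        by (rule T_mono[OF r(1) x Cu(2) Bb_mult[OF Bb_const g]]) (use ub in \<open>auto simp: indicator_def\<close>)
      also have "\<dots> = c * T r ?g x" by (rule T_scale)
      also have "\<dots> \<le> c * err m x"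
        using dom[of m r x] f0[OF x] x by (intro mult_left_mono c_nonneg) (simp add: r_def)
      finally show "T r (\<lambda>y. ?g y * ?u y) x \<le> c * err m x" .
    qed
    ultimately show ?thesis using eq m by simp
  qed
  have "\<bar>(\<integral>x. T t (indicator A) x \<partial>N) - (\<integral>x. T s (indicator A) x \<partial>N)\<bar> \<le> e"
    if ts: "r + \<tau> \<le> t" "r + \<tau> \<le> s" and A: "A \<in> sets M" for t s A
  proof -
    have p: "0 < t - r" "0 < s - r" "\<tau> \<le> t - r" "\<tau> \<le> s - r" using ts \<tau>(1) by auto
    have i: "integrable Q (T (t - r) (indicator A))" "integrable Q (T (s - r) (indicator A))"
      by (intro Bb_integrable[OF Q(1)] T_Bb p Bb_indicator A)+
    have "\<bar>(\<integral>x. T (t - r) (indicator A) x \<partial>Q) - (\<integral>x. T (s - r) (indicator A) x \<partial>Q)\<bar> \<le> e / 3"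
      using integral_abs_bound[of Q "\<lambda>x. T (t - r) (indicator A) x - T (s - r) (indicator A) x"] i \<tau>(2)[OF p(3,4) A]
      by simp
    moreover have "\<bar>(\<integral>x. T t (indicator A) x \<partial>N) - (\<integral>x. T (t - r) (indicator A) x \<partial>Q)\<bar> \<le> e / 3"
      "\<bar>(\<integral>x. T s (indicator A) x \<partial>N) - (\<integral>x. T (s - r) (indicator A) x \<partial>Q)\<bar> \<le> e / 3"
      using approx[OF p(1) A] approx[OF p(2) A] by simp_all
    ultimately show ?thesis by linarith
  qed
  then show ?thesis using r \<tau>(1) by (intro exI[of _ "r + \<tau>"]) auto
qed

corollary limit_measure_if_separated:
  assumes sep: "\<And>f. fixed f \<Longrightarrow> (\<And>x. x \<in> space M \<Longrightarrow> 0 \<le> f x) \<Longrightarrow>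
      (\<And>N. invariant N \<Longrightarrow> (\<integral>x. f x \<partial>N) = 0) \<Longrightarrow> (\<And>x. x \<in> space M \<Longrightarrow> f x = 0)"
    and N: "N \<in> finite_measures M"
  obtains L where "L \<in> finite_measures M"
    "\<And>e. 0 < e \<Longrightarrow> \<exists>\<tau>>0. \<forall>t\<ge>\<tau>. \<forall>A\<in>sets M. \<bar>(\<integral>x. T t (indicator A) x \<partial>N) - measure L A\<bar> \<le> e"
proof -
  define a where "a A t = (\<integral>x. T t (indicator A) x \<partial>N)" for A t
  have C: "\<exists>\<tau>>0. \<forall>t\<ge>\<tau>. \<forall>s\<ge>\<tau>. \<forall>A\<in>sets M. \<bar>a A t - a A s\<bar> \<le> e" if "0 < e" for e
    unfolding a_def by (rule Cauchy_if_separated[OF _ N that]) (rule sep)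
  have "\<exists>Q. Q \<in> finite_measures M \<and> (\<forall>A\<in>sets M. measure Q A = a A (real (Suc n)))" for n
    by (rule adjoint[OF N, of "real (Suc n)"]) (auto simp: a_def)
  then obtain Q where Q: "\<And>n. Q n \<in> finite_measures M" "\<And>n A. A \<in> sets M \<Longrightarrow> measure (Q n) A = a A (real (Suc n))"
    by metis
  have conv: "convergent (\<lambda>n. a A (real (Suc n)))" if A: "A \<in> sets M" for A
  proof -
    have "Cauchy (\<lambda>n. a A (real (Suc n)))"
    proof (rule CauchyI)
      fix e :: real assume e: "0 < e"
      then obtain \<tau> where \<tau>: "\<And>t s. \<tau> \<le> t \<Longrightarrow> \<tau> \<le> s \<Longrightarrow> \<bar>a A t - a A s\<bar> \<le> e / 2"
        using C[of "e / 2"] A by auto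
      obtain k :: nat where k: "\<tau> \<le> real k" using real_arch_simple by blast
      have "norm (a A (real (Suc m)) - a A (real (Suc n))) < e" if "k \<le> m" "k \<le> n" for m n
        using \<tau>[of "real (Suc m)" "real (Suc n)"] that k e by simp
      then show "\<exists>M. \<forall>m\<ge>M. \<forall>n\<ge>M. norm (a A (real (Suc m)) - a A (real (Suc n))) < e" by blast
    qed
    then show ?thesis by (simp add: Cauchy_convergent_iff)
  qed
  define l where "l A = lim (\<lambda>n. a A (real (Suc n)))" for A
  have al: "(\<lambda>n. a A (real (Suc n))) \<longlonglongrightarrow> l A" if "A \<in> sets M" for A
    using conv[OF that] unfolding l_def by (simp add: convergent_LIMSEQ_iff)
  have Ql: "(\<lambda>n. measure (Q n) A) \<longlonglongrightarrow> l A" if "A \<in> sets M" for A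
    using al[OF that] Q(2)[OF that] by simp
  obtain L where L: "L \<in> finite_measures M" "\<And>A. A \<in> sets M \<Longrightarrow> measure L A = l A"
    using setwise_limit_is_measure[OF Q(1) Ql] by blast
  have "\<exists>\<tau>>0. \<forall>t\<ge>\<tau>. \<forall>A\<in>sets M. \<bar>a A t - measure L A\<bar> \<le> e" if e: "0 < e" for e
  proof -
    obtain \<tau> where \<tau>: "0 < \<tau>" "\<And>t s A. \<tau> \<le> t \<Longrightarrow> \<tau> \<le> s \<Longrightarrow> A \<in> sets M \<Longrightarrow> \<bar>a A t - a A s\<bar> \<le> e"
      using C[OF e] by blast
    obtain k :: nat where k: "\<tau> \<le> real k" using real_arch_simple by blast
    have "\<bar>a A t - measure L A\<bar> \<le> e" if "\<tau> \<le> t" "A \<in> sets M" for t A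
    proof -
      have "(\<lambda>n. \<bar>a A t - a A (real (Suc n))\<bar>) \<longlonglongrightarrow> \<bar>a A t - l A\<bar>"
        by (intro tendsto_intros al that)
      then have "\<bar>a A t - l A\<bar> \<le> e"
        by (rule LIMSEQ_le_const2) (use \<tau>(2)[OF that(1) _ that(2)] k in \<open>auto intro!: exI[of _ k]\<close>)
      then show ?thesis using L(2)[OF that(2)] by simp
    qed
    then show ?thesis using \<tau>(1) by blast
  qed
  then show ?thesis using that[OF L(1)] unfolding a_def by blast
qed

end

section \<open>The equivalence\<close>

lemma pairing_indicator:
  assumes "\<nu> \<in> signed_measures M" "A \<in> sets M"
  shows "pairing M \<nu> (indicator A) = \<nu> A"
  using Jordan_decomposition[OF assms] assms(2)
  by (simp add: pairing_def neg_part_def Int_absorb2 sets.sets_into_space)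

lemma pairing_cong:
  assumes "\<And>x. x \<in> space M \<Longrightarrow> f x = g x" shows "pairing M \<nu> f = pairing M \<nu> g"
  unfolding pairing_def neg_part_def
  by (intro arg_cong2[where f="(-)"] Bochner_Integration.integral_cong) (auto simp: assms)

lemma pairing_tendsto:
  assumes \<nu>: "\<nu> \<in> signed_measures M"
    and u: "\<And>n. u n \<in> Bb M" "\<And>n x. x \<in> space M \<Longrightarrow> \<bar>u n x\<bar> \<le> b"
    and lim: "\<And>x. x \<in> space M \<Longrightarrow> (\<lambda>n. u n x) \<longlonglongrightarrow> v x"
  shows "(\<lambda>n. pairing M \<nu> (u n)) \<longlonglongrightarrow> pairing M \<nu> v"
proof -
  have v: "v \<in> Bb M" by (rule Bb_limit[OF u lim])
  have "(\<lambda>n. \<integral>x. u n x \<partial>N) \<longlonglongrightarrow> (\<integral>x. v x \<partial>N)" if N: "N \<in> finite_measures M" for N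
    by (rule Bb_dominated_convergence[OF N u _ v])
      (auto intro!: AE_I2 lim simp: finite_measuresD(3)[OF N])
  from tendsto_diff[OF this[OF pos_part_finite[OF \<nu>]] this[OF neg_part_finite[OF \<nu>]]]
  show ?thesis unfolding pairing_def .
qed

lemma pairing_add:
  assumes \<nu>: "\<nu> \<in> signed_measures M" and u: "u \<in> Bb M" and v: "v \<in> Bb M"
  shows "pairing M \<nu> (\<lambda>x. u x + v x) = pairing M \<nu> u + pairing M \<nu> v"
  using u v by (simp add: pairing_def Bb_integrable[OF pos_part_finite[OF \<nu>]] Bb_integrable[OF neg_part_finite[OF \<nu>]])

lemma pairing_scale: "pairing M \<nu> (\<lambda>x. a * u x) = a * pairing M \<nu> u"
  by (simp add: pairing_def right_diff_distrib)

lemma pairing_diff_measure: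
  assumes \<nu>: "\<nu> \<in> signed_measures M" and \<rho>: "\<rho> \<in> signed_measures M" and f: "f \<in> Bb M"
  shows "pairing M (\<lambda>A. \<nu> A - \<rho> A) f = pairing M \<nu> f - pairing M \<rho> f"
  using f
proof (induction rule: Bb_induct)
  note d = signed_measures_diff[OF \<nu> \<rho>]
  {
    case (indicator A)
    then show ?case by (simp add: pairing_indicator \<nu> \<rho> d)
  next
    case (add u v)
    then show ?case by (simp add: pairing_add \<nu> \<rho> d)
  next
    case (scale u a)
    then show ?case by (simp add: pairing_scale right_diff_distrib)
  next
    case (limit U u b)
    note l = pairing_tendsto[OF _ limit.hyps(1,2,3)]
    have "(\<lambda>n. pairing M (\<lambda>A. \<nu> A - \<rho> A) (U n)) \<longlonglongrightarrow> pairing M \<nu> u - pairing M \<rho> u"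
      unfolding limit.IH by (intro tendsto_diff l \<nu> \<rho>)
    then show ?case using LIMSEQ_unique[OF l[OF d]] by blast
  }
qed

lemma Dirac_signed_measure: "(\<lambda>A. indicator A x) \<in> signed_measures M"
  unfolding signed_measures_def
  by (intro CollectI allI impI indicator_sums) (auto simp: disjoint_family_on_def)

text \<open>
  Pairing with Dirac measures turns the weak convergence of functions into pointwise convergence.
\<close>

lemma pairing_Dirac:
  assumes x: "x \<in> space M" and f: "f \<in> Bb M"
  shows "pairing M (\<lambda>A. indicator A x) f = f x"
  using f
proof (induction rule: Bb_induct)
  case (limit U u b)
  show ?case
    using LIMSEQ_unique[OF pairing_tendsto[OF Dirac_signed_measure limit.hyps(1,2,3)]] limit.hyps(3)[OF x] limit.IH
    by simp
qed (simp_all add: pairing_indicator pairing_add pairing_scale Dirac_signed_measure)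

lemma pairing_le_tv_norm:
  assumes \<nu>: "\<nu> \<in> signed_measures M" and f: "f \<in> Bb M" "\<And>x. x \<in> space M \<Longrightarrow> \<bar>f x\<bar> \<le> b"
    and b: "0 \<le> b" and e: "tv_norm M \<nu> \<le> ennreal e" "0 \<le> e"
  shows "\<bar>pairing M \<nu> f\<bar> \<le> b * e"
proof -
  have i: "\<bar>\<integral>x. f x \<partial>N\<bar> \<le> b * measure N (space M)" if N: "N \<in> finite_measures M" for N
  proof -
    have "\<bar>\<integral>x. f x \<partial>N\<bar> \<le> (\<integral>x. \<bar>f x\<bar> \<partial>N)" by (rule integral_abs_bound)
    also have "\<dots> \<le> (\<integral>x. b \<partial>N)" by (rule Bb_integral_mono[OF N Bb_abs[OF f(1)] Bb_const f(2)])
    finally show ?thesis using finite_measuresD(3)[OF N] by (simp add: mult.commute)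
  qed
  let ?p = "measure (pos_part M \<nu>) (space M)" and ?n = "measure (neg_part M \<nu>) (space M)"
  have "ennreal (?p + ?n) \<le> ennreal e"
    using e(1) unfolding tv_norm_def total_variation_def emeasure_finite_measures[OF pos_part_finite[OF \<nu>]]
      emeasure_finite_measures[OF neg_part_finite[OF \<nu>]] by (simp only: ennreal_plus measure_nonneg)
  then have "?p + ?n \<le> e" by (simp only: ennreal_le_iff[OF e(2)])
  then have "b * (?p + ?n) \<le> b * e" by (rule mult_left_mono[OF _ b])
  then show ?thesis
    using i[OF pos_part_finite[OF \<nu>]] i[OF neg_part_finite[OF \<nu>]]
    unfolding pairing_def by (simp add: distrib_left)
qed

lemma measure_pos_part_nonneg:
  assumes \<nu>: "\<nu> \<in> signed_measures M" and nn: "\<And>A. A \<in> sets M \<Longrightarrow> 0 \<le> \<nu> A" and A: "A \<in> sets M"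
  shows "measure (pos_part M \<nu>) A = \<nu> A"
proof (rule antisym)
  show "measure (pos_part M \<nu>) A \<le> \<nu> A"
  proof (rule pos_part_least[OF \<nu> A])
    fix B assume B: "B \<in> sets M" "B \<subseteq> A"
    have "0 \<le> \<nu> (A - B)" using A B by (intro nn) auto
    then show "\<nu> B \<le> \<nu> A" using signed_measures_Diff[OF \<nu> B(1) A B(2)] by simp
  qed
  show "\<nu> A \<le> measure (pos_part M \<nu>) A" by (rule pos_part_le[OF \<nu> A A order_refl])
qed

lemma pairing_nonneg:
  assumes \<nu>: "\<nu> \<in> signed_measures M" and nn: "\<And>A. A \<in> sets M \<Longrightarrow> 0 \<le> \<nu> A" and f: "f \<in> Bb M"
  shows "pairing M \<nu> f = (\<integral>x. f x \<partial>pos_part M \<nu>)"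
proof -
  have "null_measure M \<in> finite_measures M"
    by (intro finite_measuresI finite_measureI) auto
  from pairing_eq[OF \<nu> pos_part_finite[OF \<nu>] this _ f] show ?thesis
    using measure_pos_part_nonneg[OF \<nu> nn] by (simp add: measure_def)
qed

lemma ennreal_tendsto_0_iff_le:
  "(f \<longlongrightarrow> (0::ennreal)) F \<longleftrightarrow> (\<forall>e>0. eventually (\<lambda>t. f t \<le> ennreal e) F)"
proof
  assume f: "(f \<longlongrightarrow> 0) F"
  have "eventually (\<lambda>t. f t \<le> ennreal e) F" if "0 < e" for e
  proof -
    have "eventually (\<lambda>t. f t < ennreal e) F"
      by (rule order_tendstoD(2)[OF f]) (use that in simp)
    then show ?thesis by eventually_elim simp
  qed
  then show "\<forall>e>0. eventually (\<lambda>t. f t \<le> ennreal e) F" by blast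
next
  assume f: "\<forall>e>0. eventually (\<lambda>t. f t \<le> ennreal e) F"
  show "(f \<longlongrightarrow> 0) F"
  proof (rule order_tendstoI)
    fix a :: ennreal assume "0 < a"
    then obtain q where q: "0 < q" "q < a" using dense by blast
    then have "q < top" using less_le_trans[OF q(2) top_greatest] by simp
    then have q': "q = ennreal (enn2real q)" by simp
    then have "0 < enn2real q" using q(1) by (metis ennreal_less_zero_iff)
    with f have "eventually (\<lambda>t. f t \<le> ennreal (enn2real q)) F" by blast
    then show "eventually (\<lambda>t. f t < a) F"
      by eventually_elim (use q(2) q' in \<open>metis le_less_trans\<close>)
  qed simp
qed

theorem theorem4p1:
  fixes M :: "'a measure"
    and T :: "real \<Rightarrow> ('a \<Rightarrow> real) \<Rightarrow> 'a \<Rightarrow> real"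
    and k :: "real \<Rightarrow> 'a \<Rightarrow> 'a set \<Rightarrow> real"
    and S :: "real \<Rightarrow> ('a set \<Rightarrow> real) \<Rightarrow> 'a set \<Rightarrow> real"
    and \<mu> :: "'a set \<Rightarrow> real"
    and t0 :: real
  assumes "countably_generated M"
    and "bounded_semigroup M T"
    and "\<And>t. t > 0 \<Longrightarrow> kernel_operator M (k t) (T t)"
    and "\<And>t. t > 0 \<Longrightarrow> positive_operator M (T t)"
    and "\<And>t. t > 0 \<Longrightarrow> S t = dual_operator M (k t)"
    and "\<mu> \<in> signed_measures M" and "\<And>A. A \<in> sets M \<Longrightarrow> 0 \<le> \<mu> A"
    and "t0 > 0"
    and "\<And>x. x \<in> space M \<Longrightarrow> abs_cont M (k t0 x) \<mu>"
  shows
    "((\<forall>f\<in>Bb M. \<exists>g\<in>Bb M. limitin (weak_topology M) (\<lambda>t. T t f) g at_top) \<longleftrightarrow>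
      (\<forall>\<nu>\<in>signed_measures M. \<exists>\<rho>\<in>signed_measures M.
         ((\<lambda>t. tv_norm M (\<lambda>A. S t \<nu> A - \<rho> A)) \<longlongrightarrow> 0) at_top)) \<and>
     ((\<forall>\<nu>\<in>signed_measures M. \<exists>\<rho>\<in>signed_measures M.
         ((\<lambda>t. tv_norm M (\<lambda>A. S t \<nu> A - \<rho> A)) \<longlongrightarrow> 0) at_top) \<longleftrightarrow>
      separates M (fix_measures M S) (fix_functions M T))"
    (is "(?i \<longleftrightarrow> ?ii) \<and> (?ii \<longleftrightarrow> ?iii)")
proof -
  note kop = assms(3) and t0 = assms(8) and mu = assms(6,7)
  have TB: "T t f \<in> Bb M" and Tk: "\<And>x. x \<in> space M \<Longrightarrow> T t f x = pairing M (k t x) f"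
    if "0 < t" "f \<in> Bb M" for t f
    using kop[OF that(1)] that(2) by (auto simp: kernel_operator_def)
  have ks: "k t x \<in> signed_measures M" if "0 < t" "x \<in> space M" for t x
    using kop[OF that(1)] that(2) by (auto simp: kernel_operator_def bounded_kernel_def)
  have kT: "k t x A = T t (indicator A) x" if "0 < t" "x \<in> space M" "A \<in> sets M" for t x A
    using Tk[OF that(1) Bb_indicator[OF that(3)] that(2)] pairing_indicator[OF ks[OF that(1,2)] that(3)] by simp
  have kpos: "0 \<le> k t x A" if "0 < t" "x \<in> space M" "A \<in> sets M" for t x A
    using assms(4)[OF that(1)] that Bb_indicator[OF that(3)] unfolding kT[OF that] positive_operator_def by simp
  define K where "K t x = pos_part M (k t x)" for t x
  have Kf: "K t x \<in> finite_measures M" if "0 < t" "x \<in> space M" for t x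
    unfolding K_def by (rule pos_part_finite[OF ks[OF that]])
  have Km: "measure (K t x) A = k t x A" if "0 < t" "x \<in> space M" "A \<in> sets M" for t x A
    unfolding K_def by (rule measure_pos_part_nonneg[OF ks[OF that(1,2)] kpos[OF that(1,2)] that(3)])
  have TK: "T t f x = (\<integral>y. f y \<partial>K t x)" if "0 < t" "f \<in> Bb M" "x \<in> space M" for t f x
    unfolding K_def Tk[OF that] by (rule pairing_nonneg[OF ks[OF that(1,3)] kpos[OF that(1,3)] that(2)])
  have sg: "T (t + s) f x = T t (T s f) x" if "0 < t" "0 < s" "f \<in> Bb M" "x \<in> space M" for t s f x
    using assms(2) that by (auto simp: bounded_semigroup_def operator_semigroup_def)
  obtain c where c: "0 \<le> c" "\<And>t x. 0 < t \<Longrightarrow> x \<in> space M \<Longrightarrow> T t (indicator (space M)) x \<le> c"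
  proof -
    define s where "s = (SUP t\<in>{0<..}. op_norm M (T t))"
    have s: "s < \<infinity>" using assms(2) by (simp add: bounded_semigroup_def s_def)
    have "T t (indicator (space M)) x \<le> enn2real s" if t: "0 < t" and x: "x \<in> space M" for t x
    proof -
      let ?u = "indicator (space M) :: 'a \<Rightarrow> real"
      have "ennreal \<bar>T t ?u x\<bar> \<le> sup_norm M (T t ?u)" unfolding sup_norm_def by (rule SUP_upper[OF x])
      also have "\<dots> \<le> op_norm M (T t)"
        unfolding op_norm_def
      proof (rule SUP_upper)
        have "sup_norm M ?u \<le> 1" unfolding sup_norm_def by (rule SUP_least) simp
        then show "?u \<in> {f \<in> Bb M. sup_norm M f \<le> 1}" by (simp add: Bb_indicator)
      qed
      also have "\<dots> \<le> s" unfolding s_def by (rule SUP_upper) (use t in simp)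
      also have "\<dots> = ennreal (enn2real s)" using s by simp
      finally show ?thesis by (simp add: ennreal_le_iff)
    qed
    then show ?thesis using that[of "enn2real s"] by simp
  qed
  define \<mu>' where "\<mu>' = pos_part M \<mu>"
  have mu': "\<mu>' \<in> finite_measures M" "\<And>A. A \<in> sets M \<Longrightarrow> measure \<mu>' A = \<mu> A"
    unfolding \<mu>'_def by (rule pos_part_finite[OF mu(1)], rule measure_pos_part_nonneg[OF mu])
  interpret E: abs_cont_kernel_semigroup M K c \<mu>' t0
  proof (rule abs_cont_kernel_semigroup.intro[OF kernel_semigroup.intro abs_cont_kernel_semigroup_axioms.intro])
    show "0 \<le> c" by (rule c(1))
    show "K t x \<in> finite_measures M" if "0 < t" "x \<in> space M" for t x by (rule Kf[OF that])
    show "(\<lambda>x. measure (K t x) A) \<in> borel_measurable M" if "0 < t" "A \<in> sets M" for t A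
    proof -
      have "(\<lambda>x. k t x A) \<in> borel_measurable M"
        using kop[OF that(1)] that(2) by (auto simp: kernel_operator_def bounded_kernel_def)
      then show ?thesis by (subst measurable_cong[OF Km[OF that(1) _ that(2)]])
    qed
    show "measure (K t x) (space M) \<le> c" if "0 < t" "x \<in> space M" for t x
      using c(2)[OF that] Km[OF that sets.top] kT[OF that sets.top] by simp
    show "measure (K (t + s) x) A = (\<integral>y. measure (K s y) A \<partial>K t x)"
      if t: "0 < t" and s: "0 < s" and A: "A \<in> sets M" and x: "x \<in> space M" for t s A x
    proof -
      have "measure (K (t + s) x) A = T t (T s (indicator A)) x"
        using Km[OF _ x A, of "t + s"] kT[OF _ x A, of "t + s"] sg[OF t s Bb_indicator[OF A] x] t s by simp
      also have "\<dots> = (\<integral>y. T s (indicator A) y \<partial>K t x)" by (rule TK[OF t TB[OF s Bb_indicator[OF A]] x])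
      also have "\<dots> = (\<integral>y. measure (K s y) A \<partial>K t x)"
        by (rule Bochner_Integration.integral_cong)
          (use Km[OF s _ A] kT[OF s _ A] finite_measuresD(3)[OF Kf[OF t x]] in auto)
      finally show ?thesis .
    qed
    show "countably_generated M" "\<mu>' \<in> finite_measures M" "0 < t0" by (rule assms(1) mu'(1) t0)+
    show "absolutely_continuous \<mu>' (K t0 x)" if x: "x \<in> space M" for x
      using assms(9)[OF x] absolutely_continuous_iff[OF mu'(1) Kf[OF t0 x]] mu'(2) Km[OF t0 x]
      by (simp add: abs_cont_def)
  qed
  have TE: "T t f x = E.T t f x" if "0 < t" "f \<in> Bb M" "x \<in> space M" for t f x
    using TK[OF that] by (simp add: E.T_def)
  have S_eq: "S t \<nu> A = (\<integral>x. E.T t (indicator A) x \<partial>P) - (\<integral>x. E.T t (indicator A) x \<partial>N)"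
    if t: "0 < t" and \<nu>: "\<nu> \<in> signed_measures M" and A: "A \<in> sets M"
      and P: "P \<in> finite_measures M" and N: "N \<in> finite_measures M"
      and dec: "\<And>A. A \<in> sets M \<Longrightarrow> \<nu> A = measure P A - measure N A" for t \<nu> A P N
  proof -
    have "S t \<nu> A = pairing M \<nu> (\<lambda>x. k t x A)" using assms(5)[OF t] by (simp add: dual_operator_def)
    also have "\<dots> = pairing M \<nu> (E.T t (indicator A))"
      by (rule pairing_cong) (simp add: kT[OF t _ A] TE[OF t Bb_indicator[OF A]])
    also have "\<dots> = (\<integral>x. E.T t (indicator A) x \<partial>P) - (\<integral>x. E.T t (indicator A) x \<partial>N)"
      by (rule pairing_eq[OF \<nu> P N dec E.T_Bb[OF t Bb_indicator[OF A]]])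
    finally show ?thesis .
  qed
  have S_adj: "S t \<nu> \<in> signed_measures M" "\<And>f. f \<in> Bb M \<Longrightarrow> pairing M (S t \<nu>) f = pairing M \<nu> (T t f)"
    if t: "0 < t" and \<nu>: "\<nu> \<in> signed_measures M" for t \<nu>
  proof -
    note p = pos_part_finite[OF \<nu>] and n = neg_part_finite[OF \<nu>]
    obtain P where P: "P \<in> finite_measures M" "\<And>u. u \<in> Bb M \<Longrightarrow> (\<integral>x. u x \<partial>P) = (\<integral>x. E.T t u x \<partial>pos_part M \<nu>)"
      "\<And>A. A \<in> sets M \<Longrightarrow> measure P A = (\<integral>x. E.T t (indicator A) x \<partial>pos_part M \<nu>)"
      by (rule E.adjoint[OF p t]) blast
    obtain N where N: "N \<in> finite_measures M" "\<And>u. u \<in> Bb M \<Longrightarrow> (\<integral>x. u x \<partial>N) = (\<integral>x. E.T t u x \<partial>neg_part M \<nu>)"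
      "\<And>A. A \<in> sets M \<Longrightarrow> measure N A = (\<integral>x. E.T t (indicator A) x \<partial>neg_part M \<nu>)"
      by (rule E.adjoint[OF n t]) blast
    have dec: "S t \<nu> A = measure P A - measure N A" if "A \<in> sets M" for A
      using S_eq[OF t \<nu> that p n Jordan_decomposition[OF \<nu>]] P(3)[OF that] N(3)[OF that] by simp
    show 1: "S t \<nu> \<in> signed_measures M"
      by (rule signed_measures_cong[OF signed_measures_diff[OF measure_in_signed_measures[OF P(1)] measure_in_signed_measures[OF N(1)]]])
        (simp add: dec)
    show "pairing M (S t \<nu>) f = pairing M \<nu> (T t f)" if f: "f \<in> Bb M" for f
    proof -
      have "pairing M (S t \<nu>) f = pairing M \<nu> (E.T t f)"
        using pairing_eq[OF 1 P(1) N(1) dec f] P(2)[OF f] N(2)[OF f] by (simp add: pairing_def)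
      also have "\<dots> = pairing M \<nu> (T t f)" by (rule pairing_cong) (simp add: TE[OF t f])
      finally show ?thesis .
    qed
  qed
  have Dirac: "\<exists>\<nu>\<in>signed_measures M. \<forall>f\<in>Bb M. pairing M \<nu> f = f x" if x: "x \<in> space M" for x
    by (intro bexI[OF _ Dirac_signed_measure[of x]] ballI pairing_Dirac x)

  \<comment> \<open>A nonnegative fixed function that every invariant measure annihilates is
    annihilated by every fixed signed measure, hence vanishes by (iii).\<close>
  have "?ii" if sep: ?iii
  proof
    have core: "f x = 0" if f: "E.fixed f" and fpos: "\<And>x. x \<in> space M \<Longrightarrow> 0 \<le> f x"
      and zero: "\<And>N. E.invariant N \<Longrightarrow> (\<integral>x. f x \<partial>N) = 0" and x: "x \<in> space M" for f x
    proof (rule ccontr)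
      assume fx: "f x \<noteq> 0"
      have fB: "f \<in> Bb M" using f by (simp add: E.fixed_def)
      have "f \<in> fix_functions M T" using f TE[OF _ fB] by (simp add: fix_functions_def E.fixed_def)
      then obtain \<nu> where "\<nu> \<in> fix_measures M S" and ne: "pairing M \<nu> f \<noteq> 0"
        using sep x fx by (auto simp: separates_def)
      then have \<nu>: "\<nu> \<in> signed_measures M" and fxd: "\<And>t A. 0 < t \<Longrightarrow> A \<in> sets M \<Longrightarrow> S t \<nu> A = \<nu> A"
        by (auto simp: fix_measures_def)
      \<comment> \<open>Both parts of the Jordan decomposition of \<open>\<nu>\<close> are dominated by invariant measures.\<close>
      have part: "(\<integral>x. f x \<partial>pos_part M \<sigma>) = 0"
        if \<sigma>: "\<sigma> \<in> signed_measures M" and le: "\<And>t A. 0 < t \<Longrightarrow> A \<in> sets M \<Longrightarrow>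
          \<sigma> A \<le> (\<integral>x. E.T t (indicator A) x \<partial>pos_part M \<sigma>)" for \<sigma>
      proof -
        note p = pos_part_finite[OF \<sigma>]
        have "measure (pos_part M \<sigma>) A \<le> (\<integral>x. E.T t (indicator A) x \<partial>pos_part M \<sigma>)"
          if t: "0 < t" and A: "A \<in> sets M" for t A
        proof (rule pos_part_least[OF \<sigma> A])
          fix B assume B: "B \<in> sets M" "B \<subseteq> A"
          have "(\<integral>x. E.T t (indicator B) x \<partial>pos_part M \<sigma>) \<le> (\<integral>x. E.T t (indicator A) x \<partial>pos_part M \<sigma>)"
            by (intro Bb_integral_mono[OF p] E.T_Bb E.T_mono t Bb_indicator A B(1))
              (use B(2) in \<open>auto simp: indicator_def\<close>)
          then show "\<sigma> B \<le> (\<integral>x. E.T t (indicator A) x \<partial>pos_part M \<sigma>)"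
            using le[OF t B(1)] by simp
        qed
        then obtain N where N: "E.invariant N" "\<And>A. A \<in> sets M \<Longrightarrow> measure (pos_part M \<sigma>) A \<le> measure N A"
          using E.invariant_majorant[OF p] by blast
        have Nf: "N \<in> finite_measures M" using N by (simp add: E.invariant_def)
        have "(\<integral>x. f x \<partial>pos_part M \<sigma>) \<le> (\<integral>x. f x \<partial>N)"
          by (rule integral_mono_finite_measures[OF p Nf N(2) fB fpos])
        moreover have "0 \<le> (\<integral>x. f x \<partial>pos_part M \<sigma>)"
          by (intro integral_nonneg_AE AE_I2) (use fpos in auto)
        ultimately show ?thesis using zero[OF N(1)] by simp
      qed
      have nn: "0 \<le> (\<integral>x. E.T t (indicator A) x \<partial>N)" if "0 < t" "N \<in> finite_measures M" for t A N
        by (intro integral_nonneg_AE AE_I2 E.T_nonneg that(1)) (use finite_measuresD(3)[OF that(2)] in auto)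
      note Seq = S_eq[OF _ \<nu> _ pos_part_finite[OF \<nu>] neg_part_finite[OF \<nu>] Jordan_decomposition[OF \<nu>]]
      have "(\<integral>x. f x \<partial>pos_part M \<nu>) = 0"
      proof (rule part[OF \<nu>])
        fix t :: real and A assume "0 < t" "A \<in> sets M"
        then show "\<nu> A \<le> (\<integral>x. E.T t (indicator A) x \<partial>pos_part M \<nu>)"
          using fxd[of t A] Seq[of t A] nn[OF _ neg_part_finite[OF \<nu>], of t A] by simp
      qed
      moreover have "(\<integral>x. f x \<partial>neg_part M \<nu>) = 0"
        unfolding neg_part_def
      proof (rule part[OF signed_measures_uminus[OF \<nu>]])
        fix t :: real and A assume "0 < t" "A \<in> sets M"
        then show "- \<nu> A \<le> (\<integral>x. E.T t (indicator A) x \<partial>pos_part M (\<lambda>A. - \<nu> A))"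
          using fxd[of t A] Seq[of t A] nn[OF _ pos_part_finite[OF \<nu>], of t A] by (simp add: neg_part_def)
      qed
      ultimately show False using ne by (simp add: pairing_def)
    qed
    fix \<nu> assume \<nu>: "\<nu> \<in> signed_measures M"
    note p = pos_part_finite[OF \<nu>] and n = neg_part_finite[OF \<nu>]
    obtain P where P: "P \<in> finite_measures M" "\<And>e. 0 < e \<Longrightarrow> \<exists>\<tau>>0. \<forall>t\<ge>\<tau>. \<forall>A\<in>sets M.
        \<bar>(\<integral>x. E.T t (indicator A) x \<partial>pos_part M \<nu>) - measure P A\<bar> \<le> e"
      by (rule E.limit_measure_if_separated[OF _ p]) (rule core, assumption+, rule that)
    obtain N where N: "N \<in> finite_measures M" "\<And>e. 0 < e \<Longrightarrow> \<exists>\<tau>>0. \<forall>t\<ge>\<tau>. \<forall>A\<in>sets M.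
        \<bar>(\<integral>x. E.T t (indicator A) x \<partial>neg_part M \<nu>) - measure N A\<bar> \<le> e"
      by (rule E.limit_measure_if_separated[OF _ n]) (rule core, assumption+, rule that)
    define \<rho> where "\<rho> A = measure P A - measure N A" for A
    have \<rho>: "\<rho> \<in> signed_measures M"
      unfolding \<rho>_def[abs_def] by (intro signed_measures_diff measure_in_signed_measures P N)
    have "((\<lambda>t. tv_norm M (\<lambda>A. S t \<nu> A - \<rho> A)) \<longlongrightarrow> 0) at_top"
      unfolding ennreal_tendsto_0_iff_le
    proof (intro allI impI)
      fix e :: real assume "0 < e"
      then have e: "0 < e / 4" by simp
      obtain \<tau>1 where t1: "0 < \<tau>1" "\<forall>t\<ge>\<tau>1. \<forall>A\<in>sets M. \<bar>(\<integral>x. E.T t (indicator A) x \<partial>pos_part M \<nu>) - measure P A\<bar> \<le> e / 4"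
        using P(2)[OF e] by blast
      obtain \<tau>2 where t2: "0 < \<tau>2" "\<forall>t\<ge>\<tau>2. \<forall>A\<in>sets M. \<bar>(\<integral>x. E.T t (indicator A) x \<partial>neg_part M \<nu>) - measure N A\<bar> \<le> e / 4"
        using N(2)[OF e] by blast
      show "eventually (\<lambda>t. tv_norm M (\<lambda>A. S t \<nu> A - \<rho> A) \<le> ennreal e) at_top"
        using eventually_ge_at_top[of "max \<tau>1 \<tau>2"]
      proof eventually_elim
        case (elim t)
        have t: "0 < t" "\<tau>1 \<le> t" "\<tau>2 \<le> t" using elim t1(1) by auto
        have "tv_norm M (\<lambda>A. S t \<nu> A - \<rho> A) \<le> ennreal (2 * (e / 2))"
        proof (rule tv_norm_le[OF signed_measures_diff[OF S_adj(1)[OF t(1) \<nu>] \<rho>]])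
          fix A assume A: "A \<in> sets M"
          have "S t \<nu> A = (\<integral>x. E.T t (indicator A) x \<partial>pos_part M \<nu>) - (\<integral>x. E.T t (indicator A) x \<partial>neg_part M \<nu>)"
            by (rule S_eq[OF t(1) \<nu> A p n Jordan_decomposition[OF \<nu>]])
          moreover have "\<bar>(\<integral>x. E.T t (indicator A) x \<partial>pos_part M \<nu>) - measure P A\<bar> \<le> e / 4"
            "\<bar>(\<integral>x. E.T t (indicator A) x \<partial>neg_part M \<nu>) - measure N A\<bar> \<le> e / 4"
            using t1(2) t2(2) t A by blast+
          ultimately show "\<bar>S t \<nu> A - \<rho> A\<bar> \<le> e / 2" unfolding \<rho>_def by linarith
        qed
        then show ?case by simp
      qed
    qed
    then show "\<exists>\<rho>\<in>signed_measures M. ((\<lambda>t. tv_norm M (\<lambda>A. S t \<nu> A - \<rho> A)) \<longlongrightarrow> 0) at_top"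
      using \<rho> by blast
  qed
  \<comment> \<open>The pairings converge for each \<open>\<nu>\<close>; the Dirac measures determine the limit
    function, and dominated convergence along integer times identifies the other limits.\<close>
  moreover have "?i" if ii: ?ii
  proof
    fix f assume f: "f \<in> Bb M"
    obtain b where b: "0 \<le> b" "\<And>x. x \<in> space M \<Longrightarrow> \<bar>f x\<bar> \<le> b" by (rule BbE[OF f]) blast
    have "\<forall>\<nu>\<in>signed_measures M. \<exists>l. ((\<lambda>t. pairing M \<nu> (T t f)) \<longlongrightarrow> l) at_top"
    proof
      fix \<nu> assume \<nu>: "\<nu> \<in> signed_measures M"
      then obtain \<rho> where \<rho>: "\<rho> \<in> signed_measures M" and lim: "((\<lambda>t. tv_norm M (\<lambda>A. S t \<nu> A - \<rho> A)) \<longlongrightarrow> 0) at_top"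
        using ii by blast
      have "((\<lambda>t. pairing M \<nu> (T t f)) \<longlongrightarrow> pairing M \<rho> f) at_top"
      proof (rule tendstoI)
        fix e :: real assume e: "0 < e"
        define d where "d = e / (b + 1)"
        have d: "0 < d" using e b(1) by (simp add: d_def)
        have "b * d < e" using e b(1) by (simp add: d_def divide_simps)
        have "eventually (\<lambda>t. tv_norm M (\<lambda>A. S t \<nu> A - \<rho> A) \<le> ennreal d) at_top"
          using lim d unfolding ennreal_tendsto_0_iff_le by blast
        then show "eventually (\<lambda>t. dist (pairing M \<nu> (T t f)) (pairing M \<rho> f) < e) at_top"
          using eventually_gt_at_top[of 0]
        proof eventually_elim
          case (elim t)
          note St = S_adj[OF elim(2) \<nu>]
          have "\<bar>pairing M (\<lambda>A. S t \<nu> A - \<rho> A) f\<bar> \<le> b * d"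
            by (rule pairing_le_tv_norm[OF signed_measures_diff[OF St(1) \<rho>] f b(2) b(1) elim(1)]) (use d in simp_all)
          then show ?case
            using pairing_diff_measure[OF St(1) \<rho> f] St(2)[OF f] \<open>b * d < e\<close> by (simp add: dist_real_def)
        qed
      qed
      then show "\<exists>l. ((\<lambda>t. pairing M \<nu> (T t f)) \<longlongrightarrow> l) at_top" ..
    qed
    from bchoice[OF this] obtain l where
      l: "\<And>\<nu>. \<nu> \<in> signed_measures M \<Longrightarrow> ((\<lambda>t. pairing M \<nu> (T t f)) \<longlongrightarrow> l \<nu>) at_top" by blast
    obtain \<delta> where \<delta>: "\<And>x. x \<in> space M \<Longrightarrow> \<delta> x \<in> signed_measures M"
      "\<And>x f. x \<in> space M \<Longrightarrow> f \<in> Bb M \<Longrightarrow> pairing M (\<delta> x) f = f x"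
      using Dirac by metis
    define g where "g x = l (\<delta> x)" for x
    have seq: "filterlim (\<lambda>n. real (Suc n)) at_top sequentially"
      by (rule filterlim_compose[OF filterlim_real_sequentially filterlim_Suc])
    have Tn: "T (real (Suc n)) f \<in> Bb M" for n by (rule TB[OF _ f]) simp
    have Tb: "\<bar>T (real (Suc n)) f x\<bar> \<le> b * c" if x: "x \<in> space M" for n x
      using E.T_bounded[OF _ x f b(2), of "real (Suc n)"] TE[OF _ f x, of "real (Suc n)"] by simp
    have ptw: "(\<lambda>n. T (real (Suc n)) f x) \<longlonglongrightarrow> g x" if x: "x \<in> space M" for x
      using filterlim_compose[OF l[OF \<delta>(1)[OF x]] seq] \<delta>(2)[OF x Tn] by (simp add: g_def)
    have g: "g \<in> Bb M" by (rule Bb_limit[OF Tn Tb ptw])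
    have "((\<lambda>t. pairing M \<nu> (T t f)) \<longlongrightarrow> pairing M \<nu> g) at_top" if \<nu>: "\<nu> \<in> signed_measures M" for \<nu>
      using LIMSEQ_unique[OF filterlim_compose[OF l[OF \<nu>] seq] pairing_tendsto[OF \<nu> Tn Tb ptw]] l[OF \<nu>] by simp
    moreover have "eventually (\<lambda>t. T t f \<in> Bb M) at_top"
      using eventually_gt_at_top[of 0] by eventually_elim (rule TB[OF _ f])
    ultimately show "\<exists>g\<in>Bb M. limitin (weak_topology M) (\<lambda>t. T t f) g at_top"
      using g unfolding limitin_weak_topology by blast
  qed
  \<comment> \<open>The limit of the transition measures from a point \<open>x\<close> with \<open>f x \<noteq> 0\<close> is fixed
    and does not annihilate \<open>f\<close>.\<close>
  moreover have "?iii" if i: ?i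
    unfolding separates_def
  proof (intro ballI impI)
    fix f assume "f \<in> fix_functions M T" and "\<exists>x\<in>space M. f x \<noteq> 0"
    then obtain x where f: "f \<in> Bb M" "\<And>t x. 0 < t \<Longrightarrow> x \<in> space M \<Longrightarrow> T t f x = f x"
      and x: "x \<in> space M" "f x \<noteq> 0" by (auto simp: fix_functions_def)
    obtain \<delta> where \<delta>: "\<delta> \<in> signed_measures M" "\<And>f. f \<in> Bb M \<Longrightarrow> pairing M \<delta> f = f x"
      using Dirac[OF x(1)] by blast
    have "\<forall>h\<in>Bb M. \<exists>l. ((\<lambda>t. T t h x) \<longlongrightarrow> l) at_top"
    proof
      fix h assume h: "h \<in> Bb M"
      then obtain g where "limitin (weak_topology M) (\<lambda>t. T t h) g at_top" using i by blast
      then have lim: "((\<lambda>t. pairing M \<delta> (T t h)) \<longlongrightarrow> pairing M \<delta> g) at_top"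
        using \<delta>(1) unfolding limitin_weak_topology by blast
      have "eventually (\<lambda>t. pairing M \<delta> (T t h) = T t h x) at_top"
        using eventually_gt_at_top[of 0] by eventually_elim (rule \<delta>(2)[OF TB[OF _ h]])
      from tendsto_cong[OF this] lim show "\<exists>l. ((\<lambda>t. T t h x) \<longlongrightarrow> l) at_top" by blast
    qed
    from bchoice[OF this] obtain l where l: "\<And>h. h \<in> Bb M \<Longrightarrow> ((\<lambda>t. T t h x) \<longlongrightarrow> l h) at_top" by blast
    have seq: "filterlim (\<lambda>n. s + real (Suc n)) at_top sequentially" for s
      by (rule filterlim_tendsto_add_at_top[OF tendsto_const filterlim_compose[OF filterlim_real_sequentially filterlim_Suc]])
    define Q where "Q n = K (real (Suc n)) x" for n
    have Qf: "Q n \<in> finite_measures M" for n unfolding Q_def by (rule Kf[OF _ x(1)]) simp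
    have QT: "(\<integral>y. u y \<partial>Q n) = T (real (Suc n)) u x" if "u \<in> Bb M" for n u
      unfolding Q_def by (rule TK[OF _ that x(1), symmetric]) simp
    have QTl: "(\<lambda>n. \<integral>y. u y \<partial>Q n) \<longlonglongrightarrow> l u" if "u \<in> Bb M" for u
      using filterlim_compose[OF l[OF that] seq[of 0]] QT[OF that] by simp
    have Ql: "(\<lambda>n. measure (Q n) A) \<longlonglongrightarrow> l (indicator A)" if A: "A \<in> sets M" for A
      using QTl[OF Bb_indicator[OF A]] A finite_measuresD[OF Qf]
      by (simp add: Int_absorb2 sets.sets_into_space)
    obtain N where N: "N \<in> finite_measures M" "\<And>A. A \<in> sets M \<Longrightarrow> measure N A = l (indicator A)"
      using setwise_limit_is_measure[OF Qf Ql] by blast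
    have Nl: "(\<integral>y. u y \<partial>N) = l u" if "u \<in> Bb M" for u
      using LIMSEQ_unique[OF setwise_limit_integral[OF Qf N(1) _ that] QTl[OF that]] Ql N(2) by simp
    have n: "null_measure M \<in> finite_measures M"
      by (intro finite_measuresI finite_measureI) auto
    note Ns = measure_in_signed_measures[OF N(1)]
    have "S t (measure N) A = measure N A" if t: "0 < t" and A: "A \<in> sets M" for t A
    proof -
      let ?u = "E.T t (indicator A)"
      have u: "?u \<in> Bb M" by (intro E.T_Bb t Bb_indicator A)
      have "S t (measure N) A = (\<integral>y. ?u y \<partial>N) - (\<integral>y. ?u y \<partial>null_measure M)"
        by (rule S_eq[OF t Ns A N(1) n]) (simp add: measure_def)
      then have "S t (measure N) A = l ?u" using Nl[OF u] by simp
      moreover have "T (real (Suc n)) ?u x = T (t + real (Suc n)) (indicator A) x" for n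
        using TE[OF _ u x(1), of "real (Suc n)"] TE[OF _ Bb_indicator[OF A] x(1), of "t + real (Suc n)"]
          E.T_semigroup[OF _ t Bb_indicator[OF A] x(1), of "real (Suc n)"] t by (simp add: add.commute)
      then have "(\<lambda>n. T (t + real (Suc n)) (indicator A) x) \<longlonglongrightarrow> l ?u"
        using filterlim_compose[OF l[OF u] seq[of 0]] by simp
      then have "l ?u = l (indicator A)"
        by (rule LIMSEQ_unique[OF _ filterlim_compose[OF l[OF Bb_indicator[OF A]] seq]])
      ultimately show ?thesis using N(2)[OF A] by simp
    qed
    then have "measure N \<in> fix_measures M S" using Ns by (simp add: fix_measures_def)
    moreover have "pairing M (measure N) f \<noteq> 0"
    proof -
      have "pairing M (measure N) f = (\<integral>y. f y \<partial>N) - (\<integral>y. f y \<partial>null_measure M)"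
        by (rule pairing_eq[OF Ns N(1) n _ f(1)]) (simp add: measure_def)
      moreover have "l f = f x"
        using LIMSEQ_unique[OF QTl[OF f(1)]] QT[OF f(1)] f(2)[OF _ x(1)] by simp
      ultimately show ?thesis using Nl[OF f(1)] x(2) by simp
    qed
    ultimately show "\<exists>\<nu>\<in>fix_measures M S. pairing M \<nu> f \<noteq> 0" by blast
  qed
  ultimately show ?thesis by blast
qed

end
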